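(* Let $g_0\in G$ and let $\lambda$ be a Borel probability measure on $\mathcal X$ admissible with respect to $\varphi^{g_0}_t$. Put $\mathcal W=\mathrm{pr}((\mathbb B^n_1g_0)\cap\{y_n>0\})$. Then for every $Y\in\mathbb R$, $$\lim_{T\to\infty}\lambda\Big\{x\in\mathcal X:\sup_{|s|\le T}\log\alpha(h^{g_0}_s(x))>Y+\tfrac kn\log T\Big\}=\int_Y^\infty\eta(y)\,dy,$$ where $\eta(y)=\frac nke^{-ny/k}\psi_0(e^{-ny/k})$ and $\psi_0\in L^1(\mathbb R_{>0})$ is the probability density with $\int_X^\infty\psi_0(r)\,dr=\mu(\{\Gamma g:\widehat{\mathbb Z}^ng\cap\mathcal C(B^k_X,\mathcal W)=\emptyset\})$ for $X>0$.
   Context: Fix integers $k\ge1$, $m\ge0$, $n=k+m+1$; $G=\mathrm{SL}(n,\mathbb R)$, $\Gamma=\mathrm{SL}(n,\mathbb Z)$, $\mathcal X=\Gamma\backslash G$, $\mu$ the right-$G$-invariant probability measure. Row vectors $y=(y',y'',y_n)\in\mathbb R^k\times\mathbb R^m\times\mathbb R$, right action; $\widehat{\mathbb Z}^n$ primitive integer vectors. $U(s)=\begin{pmatrix}1_k&0&0\\0&1_m&0\\-s&0&1\end{pmatrix}$ ($s\in\mathbb R^k$, middle block absent if $m=0$), $\Phi(t)=\mathrm{diag}(e^{(m+1)t}1_k,e^{-kt}1_m,e^{-kt})$; for $g_0\in G$, $h^{g_0}_s(x)=xg_0U(s)g_0^{-1}$, $\varphi^{g_0}_t(x)=xg_0\Phi(t)g_0^{-1}$;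 $\lambda$ is admissible w.r.t. $\varphi^{g_0}_t$ if $\lim_{t\to\infty}\lambda(\varphi^{g_0}_tE)=\mu(E)$ for all Borel $E$ with $\mu(\partial E)=0$. Fix a norm $|\cdot|$ on $\mathbb R^k$ ($B^k_X$ its closed balls) and a norm $\|\cdot\|$ on $\mathbb R^n$ ($\mathbb B^n_1$ its closed unit ball); $\alpha(x)=\max_{v\in\mathbb Z^ng\setminus\{0\}}1/\|v\|$ for $x=\Gamma g$. $\mathrm{pr}(y_1,\dots,y_n)=(y_{k+1},\dots,y_n)$; $\mathcal C(\mathcal A,\mathcal W)=\{y:y'\in y_n\mathcal A,(y'',y_n)\in\mathcal W\}$. *)

theory Defs
  imports "HOL-Probability.Probability"
begin

text \<open>Conventions. Vectors in R^d are functions nat => real vanishing outside {0..<d}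
(coordinates 0..d-1 correspond to y_1..y_d); n x n matrices are functions
nat => nat => real vanishing outside {0..<n} x {0..<n}. Row vectors act on the left.\<close>

definition vecs :: "nat \<Rightarrow> (nat \<Rightarrow> real) set" where
  "vecs d = {v. \<forall>i\<ge>d. v i = 0}"

definition mats :: "nat \<Rightarrow> (nat \<Rightarrow> nat \<Rightarrow> real) set" where
  "mats n = {A. \<forall>i j. (n \<le> i \<or> n \<le> j) \<longrightarrow> A i j = 0}"

definition mmul :: "nat \<Rightarrow> (nat \<Rightarrow> nat \<Rightarrow> real) \<Rightarrow> (nat \<Rightarrow> nat \<Rightarrow> real) \<Rightarrow> (nat \<Rightarrow> nat \<Rightarrow> real)" where
  "mmul n A B = (\<lambda>i j. if i < n \<and> j < n then (\<Sum>l<n. A i l * B l j) else 0)"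

definition vmul :: "nat \<Rightarrow> (nat \<Rightarrow> real) \<Rightarrow> (nat \<Rightarrow> nat \<Rightarrow> real) \<Rightarrow> (nat \<Rightarrow> real)" where
  "vmul n v A = (\<lambda>j. if j < n then (\<Sum>i<n. v i * A i j) else 0)"

definition idm :: "nat \<Rightarrow> (nat \<Rightarrow> nat \<Rightarrow> real)" where
  "idm n = (\<lambda>i j. if i < n \<and> i = j then 1 else 0)"

definition mdet :: "nat \<Rightarrow> (nat \<Rightarrow> nat \<Rightarrow> real) \<Rightarrow> real" where
  "mdet n A = (\<Sum>p | p permutes {..<n}. of_int (sign p) * (\<Prod>i<n. A i (p i)))"

definition minv :: "nat \<Rightarrow> (nat \<Rightarrow> nat \<Rightarrow> real) \<Rightarrow> (nat \<Rightarrow> nat \<Rightarrow> real)" where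
  "minv n A = (SOME B. B \<in> mats n \<and> mmul n A B = idm n)"

definition SLR :: "nat \<Rightarrow> (nat \<Rightarrow> nat \<Rightarrow> real) set" where
  "SLR n = {A \<in> mats n. mdet n A = 1}"

definition SLZ :: "nat \<Rightarrow> (nat \<Rightarrow> nat \<Rightarrow> real) set" where
  "SLZ n = {A \<in> SLR n. \<forall>i j. A i j \<in> \<int>}"

definition coset :: "nat \<Rightarrow> (nat \<Rightarrow> nat \<Rightarrow> real) \<Rightarrow> (nat \<Rightarrow> nat \<Rightarrow> real) set" where
  "coset n g = {mmul n \<gamma> g | \<gamma>. \<gamma> \<in> SLZ n}"

definition Xsp :: "nat \<Rightarrow> (nat \<Rightarrow> nat \<Rightarrow> real) set set" where
  "Xsp n = coset n ` SLR n"

definition xact :: "nat \<Rightarrow> (nat \<Rightarrow> nat \<Rightarrow> real) set \<Rightarrow> (nat \<Rightarrow> nat \<Rightarrow> real) \<Rightarrow> (nat \<Rightarrow> nat \<Rightarrow> real) set" where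
  "xact n x h = (\<lambda>a. mmul n a h) ` x"

definition Xtop :: "nat \<Rightarrow> (nat \<Rightarrow> nat \<Rightarrow> real) set topology" where
  "Xtop n = topology (\<lambda>U. U \<subseteq> Xsp n \<and> openin (top_of_set (SLR n)) (\<Union>U))"

definition Xborel :: "nat \<Rightarrow> (nat \<Rightarrow> nat \<Rightarrow> real) set measure" where
  "Xborel n = sigma (Xsp n) {U. openin (Xtop n) U}"

definition zvecs :: "nat \<Rightarrow> (nat \<Rightarrow> real) set" where
  "zvecs n = {v \<in> vecs n. \<forall>i. v i \<in> \<int>}"

definition prim :: "nat \<Rightarrow> (nat \<Rightarrow> real) set" where
  "prim n = {v \<in> zvecs n. v \<noteq> (\<lambda>_. 0) \<and> (\<forall>c::int. c \<ge> 2 \<longrightarrow> (\<lambda>i. v i / of_int c) \<notin> zvecs n)}"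

definition latt :: "nat \<Rightarrow> (nat \<Rightarrow> nat \<Rightarrow> real) set \<Rightarrow> (nat \<Rightarrow> real) set" where
  "latt n x = {vmul n z g | z g. z \<in> zvecs n \<and> g \<in> x}"

definition primlatt :: "nat \<Rightarrow> (nat \<Rightarrow> nat \<Rightarrow> real) set \<Rightarrow> (nat \<Rightarrow> real) set" where
  "primlatt n x = {vmul n z g | z g. z \<in> prim n \<and> g \<in> x}"

definition is_norm_on :: "nat \<Rightarrow> ((nat \<Rightarrow> real) \<Rightarrow> real) \<Rightarrow> bool" where
  "is_norm_on d N \<longleftrightarrow>
     (\<forall>x\<in>vecs d. 0 \<le> N x \<and> (N x = 0 \<longleftrightarrow> x = (\<lambda>_. 0))) \<and>
     (\<forall>x\<in>vecs d. \<forall>c. N (\<lambda>i. c * x i) = \<bar>c\<bar> * N x) \<and>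
     (\<forall>x\<in>vecs d. \<forall>y\<in>vecs d. N (\<lambda>i. x i + y i) \<le> N x + N y)"

definition alpha :: "nat \<Rightarrow> ((nat \<Rightarrow> real) \<Rightarrow> real) \<Rightarrow> (nat \<Rightarrow> nat \<Rightarrow> real) set \<Rightarrow> real" where
  "alpha n N x = (SUP v \<in> latt n x - {\<lambda>_. 0}. 1 / N v)"

definition Umat :: "nat \<Rightarrow> nat \<Rightarrow> (nat \<Rightarrow> real) \<Rightarrow> (nat \<Rightarrow> nat \<Rightarrow> real)" where
  "Umat k m s = (\<lambda>i j. if i < k + m + 1 \<and> j < k + m + 1 then
       (if i = j then 1 else if i = k + m \<and> j < k then - s j else 0) else 0)"

definition Phimat :: "nat \<Rightarrow> nat \<Rightarrow> real \<Rightarrow> (nat \<Rightarrow> nat \<Rightarrow> real)" where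
  "Phimat k m t = (\<lambda>i j. if i < k + m + 1 \<and> i = j then
       (if i < k then exp (real (m + 1) * t) else exp (- real k * t)) else 0)"

definition hflow :: "nat \<Rightarrow> nat \<Rightarrow> (nat \<Rightarrow> nat \<Rightarrow> real) \<Rightarrow> (nat \<Rightarrow> real) \<Rightarrow> (nat \<Rightarrow> nat \<Rightarrow> real) set \<Rightarrow> (nat \<Rightarrow> nat \<Rightarrow> real) set" where
  "hflow k m g0 s x = xact (k + m + 1) x
     (mmul (k + m + 1) g0 (mmul (k + m + 1) (Umat k m s) (minv (k + m + 1) g0)))"

definition phiflow :: "nat \<Rightarrow> nat \<Rightarrow> (nat \<Rightarrow> nat \<Rightarrow> real) \<Rightarrow> real \<Rightarrow> (nat \<Rightarrow> nat \<Rightarrow> real) set \<Rightarrow> (nat \<Rightarrow> nat \<Rightarrow> real) set" where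
  "phiflow k m g0 t x = xact (k + m + 1) x
     (mmul (k + m + 1) g0 (mmul (k + m + 1) (Phimat k m t) (minv (k + m + 1) g0)))"

definition invariant_prob :: "nat \<Rightarrow> (nat \<Rightarrow> nat \<Rightarrow> real) set measure \<Rightarrow> bool" where
  "invariant_prob n \<mu> \<longleftrightarrow> prob_space \<mu> \<and> space \<mu> = Xsp n \<and> sets \<mu> = sets (Xborel n) \<and>
     (\<forall>h\<in>SLR n. \<forall>E\<in>sets \<mu>. measure \<mu> ((\<lambda>x. xact n x h) ` E) = measure \<mu> E)"

definition admissible :: "nat \<Rightarrow> nat \<Rightarrow> (nat \<Rightarrow> nat \<Rightarrow> real) \<Rightarrow> (nat \<Rightarrow> nat \<Rightarrow> real) set measure
    \<Rightarrow> (nat \<Rightarrow> nat \<Rightarrow> real) set measure \<Rightarrow> bool" where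
  "admissible k m g0 \<mu> lam \<longleftrightarrow>
     (\<forall>E\<in>sets (Xborel (k + m + 1)). measure \<mu> (Xtop (k + m + 1) frontier_of E) = 0 \<longrightarrow>
        ((\<lambda>t. measure lam (phiflow k m g0 t ` E)) \<longlongrightarrow> measure \<mu> E) at_top)"

definition prj :: "nat \<Rightarrow> nat \<Rightarrow> (nat \<Rightarrow> real) \<Rightarrow> (nat \<Rightarrow> real)" where
  "prj k n y = (\<lambda>i. if i < n - k then y (k + i) else 0)"

definition yfst :: "nat \<Rightarrow> (nat \<Rightarrow> real) \<Rightarrow> (nat \<Rightarrow> real)" where
  "yfst k y = (\<lambda>i. if i < k then y i else 0)"

definition Cset :: "nat \<Rightarrow> nat \<Rightarrow> (nat \<Rightarrow> real) set \<Rightarrow> (nat \<Rightarrow> real) set \<Rightarrow> (nat \<Rightarrow> real) set" where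
  "Cset k n A W = {y \<in> vecs n. (\<exists>a\<in>A. yfst k y = (\<lambda>i. y (n - 1) * a i)) \<and> prj k n y \<in> W}"

end

theory Submission
  imports Defs "Jordan_Normal_Form.Determinant"
begin

text \<open>
  Write \<open>y = (y', y'', y\<^sub>n)\<close>. The supremum exceeds the threshold iff some nonzero vector \<open>y\<close> of the
  lattice translated by \<open>g\<^sub>0\<close> and some \<open>s\<close> with \<open>|s| \<le> T\<close> bring \<open>(y' - y\<^sub>n s, y'', y\<^sub>n)\<close> into a small
  ball. Applying \<open>\<Phi>(-t)\<close> with \<open>e\<^sup>n\<^sup>t = T\<close> turns this into a condition on \<open>z = y \<Phi>(-t)\<close>, which up to an
  error \<open>O(1/T)\<close> says \<open>|z'| \<le> |z\<^sub>n|\<close> and \<open>p(z'', z\<^sub>n) < e\<^sup>-\<^sup>Y\<close>, with \<open>p\<close> the quotient norm on the last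
  \<open>m + 1\<close> coordinates. Admissibility applied to nearby sets with null frontier then gives the limit, once the
  \<open>\<mu>\<close>-measure of these events is known to be continuous in the error parameter.

  No form of Siegel's mean value theorem is needed: only that certain events are \<open>\<mu>\<close>-null. Averaging over a curve
  in the group, the invariance of \<open>\<mu>\<close> and Fubini reduce this to null sets of the curve parameter, one for each of
  the countably many lattice vectors. The same argument shows that the \<open>n/k\<close>-th power of the minimum of \<open>p\<close> over
  the lattice points with \<open>|z'| < z\<^sub>n\<close> has an absolutely continuous distribution; its Radon-Nikodym derivative
  is the density \<open>\<psi>\<^sub>0\<close>.
\<close>

subsection \<open>Matrices\<close>

text \<open>The exponents are forced: for e^(nt) = T, \<open>Phi (- t)\<close> divides the slope
  y'/y_n by T and multiplies the last m + 1 coordinates by e^(kt) = T^(k/n). The ball |s| <= T thus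
  becomes the unit ball and the term (k/n) log T disappears from the threshold, while the first k
  coordinates of the small ball shrink to size O(1/T). This is why only a quotient norm survives.

  Admissibility speaks of fixed sets with null frontier. Frontiers are never computed: the
  probability of the thickened event is monotone in the thickness, hence continuous outside a
  countable set, and at a continuity point the frontier is null.

  The closed limiting region contains vectors (0, z'', 0) when m > 0, the open one does not. The
  diagonal flow cannot move them off the hyperplane z_n = 0, so a second curve, a shear into the
  last coordinate, is averaged over for them. Off the hyperplane the diagonal flow itself is the
  curve, as it changes each gauge exponentially.

  Fubini is applied to minima over lattice vectors: these are jointly measurable, and being attained
  they take the value of one single vector.\<close>

definition to_mat :: "nat \<Rightarrow> (nat \<Rightarrow> nat \<Rightarrow> real) \<Rightarrow> real mat" where
  "to_mat n A = mat n n (\<lambda>(i, j). A i j)"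

lemma to_mat_carrier [simp]: "to_mat n A \<in> carrier_mat n n"
  by (simp add: to_mat_def)

text \<open>Matrices in \<open>mats n\<close> carry no information outside the block, so identities
  between them can be checked after transfer to the matrix library.\<close>

lemma to_mat_inj: "A \<in> mats n \<Longrightarrow> B \<in> mats n \<Longrightarrow> to_mat n A = to_mat n B \<Longrightarrow> A = B"
proof (intro ext)
  fix i j assume *: "A \<in> mats n" "B \<in> mats n" "to_mat n A = to_mat n B"
  show "A i j = B i j"
  proof (cases "i < n \<and> j < n")
    case True
    then have "A i j = to_mat n A $$ (i, j)" "B i j = to_mat n B $$ (i, j)"
      by (auto simp: to_mat_def)
    with *(3) show ?thesis by simp
  next
    case False
    with * show ?thesis by (auto simp: mats_def not_less)
  qed
qed

lemma mdet_eq_det: "mdet n A = Determinant.det (to_mat n A)"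
proof -
  have "(\<Prod>i<n. A i (p i)) = (\<Prod>i = 0..<n. to_mat n A $$ (i, p i))" if "p permutes {..<n}" for p
    using permutes_in_image[OF that]
    by (intro prod.cong) (auto simp: to_mat_def lessThan_atLeast0)
  then show ?thesis
    unfolding mdet_def det_def'[OF to_mat_carrier] lessThan_atLeast0
    by (intro sum.cong) (auto simp: lessThan_atLeast0)
qed

lemma mmul_mats [simp]: "mmul n A B \<in> mats n"
  by (auto simp: mats_def mmul_def)

lemma idm_mats [simp]: "idm n \<in> mats n"
  by (auto simp: mats_def idm_def)

lemma to_mat_mmul: "to_mat n (mmul n A B) = to_mat n A * to_mat n B"
  by (rule eq_matI) (auto simp: to_mat_def mmul_def scalar_prod_def lessThan_atLeast0)

lemma to_mat_idm: "to_mat n (idm n) = 1\<^sub>m n"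
  by (rule eq_matI) (auto simp: to_mat_def idm_def)

lemma mmul_assoc: "mmul n (mmul n A B) C = mmul n A (mmul n B C)"
  by (rule to_mat_inj[of _ n])
    (simp_all add: to_mat_mmul assoc_mult_mat[of _ n n _ n _ n])

lemma mmul_idm [simp]:
  assumes "A \<in> mats n"
  shows "mmul n A (idm n) = A" "mmul n (idm n) A = A"
  by (rule to_mat_inj[of _ n];
      simp add: assms to_mat_mmul to_mat_idm right_mult_one_mat[of _ n n] left_mult_one_mat[of _ n n])+

lemma vmul_vecs [simp]: "vmul n v A \<in> vecs n"
  by (auto simp: vecs_def vmul_def)

lemma vmul_mmul: "vmul n (vmul n v A) B = vmul n v (mmul n A B)"
proof
  fix j
  have "(\<Sum>i<n. (\<Sum>l<n. v l * A l i) * B i j) = (\<Sum>i<n. v i * (\<Sum>l<n. A i l * B l j))"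
    unfolding sum_distrib_left sum_distrib_right
    by (subst sum.swap) (simp add: mult.assoc)
  then show "vmul n (vmul n v A) B j = vmul n v (mmul n A B) j"
    by (simp add: vmul_def mmul_def)
qed

lemma vmul_idm [simp]:
  assumes "v \<in> vecs n"
  shows "vmul n v (idm n) = v"
proof
  fix j
  note assms
  moreover have "(\<Sum>i<n. v i * idm n i j) = (\<Sum>i<n. if i = j then v i else 0)"
    by (intro sum.cong) (auto simp: idm_def)
  ultimately show "vmul n v (idm n) j = v j" by (simp add: vmul_def vecs_def)
qed

lemma vmul_lincomb:
  "vmul n (\<lambda>i. a * v i + b * w i) A = (\<lambda>i. a * vmul n v A i + b * vmul n w A i)"
proof
  fix j
  have "(\<Sum>i<n. (a * v i + b * w i) * A i j) = a * (\<Sum>i<n. v i * A i j) + b * (\<Sum>i<n. w i * A i j)"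
    by (simp add: distrib_right sum.distrib sum_distrib_left mult.assoc)
  then show "vmul n (\<lambda>i. a * v i + b * w i) A j = a * vmul n v A j + b * vmul n w A j"
    by (simp add: vmul_def)
qed

lemma vmul_scale: "vmul n (\<lambda>i. a * v i) A = (\<lambda>i. a * vmul n v A i)"
  using vmul_lincomb[of n a v 0 v A] by simp

lemma vmul_add: "vmul n (\<lambda>i. v i + w i) A = (\<lambda>i. vmul n v A i + vmul n w A i)"
  using vmul_lincomb[of n 1 v 1 w A] by simp

lemma SLR_mats: "A \<in> SLR n \<Longrightarrow> A \<in> mats n"
  by (simp add: SLR_def)

lemma mmul_SLR [simp]: "A \<in> SLR n \<Longrightarrow> B \<in> SLR n \<Longrightarrow> mmul n A B \<in> SLR n"
  by (simp add: SLR_def mdet_eq_det to_mat_mmul det_mult[OF to_mat_carrier to_mat_carrier])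

lemma idm_SLR [simp]: "idm n \<in> SLR n"
  by (simp add: SLR_def mdet_eq_det to_mat_idm)

lemma idm_SLZ [simp]: "idm n \<in> SLZ n"
  by (simp add: SLZ_def) (simp add: idm_def)

lemma SLZ_SLR: "A \<in> SLZ n \<Longrightarrow> A \<in> SLR n"
  by (simp add: SLZ_def)

lemma mmul_SLZ [simp]: "A \<in> SLZ n \<Longrightarrow> B \<in> SLZ n \<Longrightarrow> mmul n A B \<in> SLZ n"
  by (auto simp: SLZ_def) (auto simp: mmul_def intro!: Ints_sum Ints_mult)

lemma SLR_lower_triangular:
  assumes "A \<in> mats n" "\<And>i j. i < j \<Longrightarrow> j < n \<Longrightarrow> A i j = 0" "(\<Prod>i<n. A i i) = 1"
  shows "A \<in> SLR n"
proof -
  have "Determinant.det (to_mat n A) = prod_list (diag_mat (to_mat n A))"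
    by (rule det_lower_triangular[of n]) (auto simp: assms to_mat_def)
  also have "\<dots> = (\<Prod>i<n. A i i)"
    by (simp add: prod_list_diag_prod to_mat_def lessThan_atLeast0)
  finally show ?thesis
    using assms by (simp add: SLR_def mdet_eq_det)
qed

lemma det_Ints:
  assumes "A \<in> carrier_mat n n" "\<And>i j. i < n \<Longrightarrow> j < n \<Longrightarrow> A $$ (i, j) \<in> (\<int> :: real set)"
  shows "Determinant.det A \<in> \<int>"
  unfolding det_def'[OF assms(1)]
proof (intro Ints_sum Ints_mult Ints_prod)
  fix p i assume "p \<in> {p. p permutes {0..<n}}" "i \<in> {0..<n}"
  then have "p i < n" by (metis atLeastLessThan_iff mem_Collect_eq permutes_in_image)
  with \<open>i \<in> {0..<n}\<close> show "A $$ (i, p i) \<in> \<int>" by (simp add: assms(2))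
qed (simp add: sign_def)

text \<open>With determinant 1 the adjugate is the inverse, and its entries are cofactors, that is,
  integer polynomials in the entries. This gives the inverse in \<open>SLR n\<close> and integrality
  at once.\<close>

lemma SLR_inverse:
  assumes "A \<in> SLR n"
  obtains B where "B \<in> SLR n" "mmul n A B = idm n" "mmul n B A = idm n" "A \<in> SLZ n \<longrightarrow> B \<in> SLZ n"
proof -
  define C where "C = adj_mat (to_mat n A)"
  define B where "B = (\<lambda>i j. if i < n \<and> j < n then C $$ (i, j) else 0)"
  have [simp]: "C \<in> carrier_mat n n" unfolding C_def by (rule adj_mat(1)) simp
  have Bm [simp]: "B \<in> mats n" by (auto simp: B_def mats_def)
  have tB: "to_mat n B = C"
  proof (rule eq_matI)
    have C: "dim_row C = n" "dim_col C = n" using \<open>C \<in> carrier_mat n n\<close> by blast+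
    fix i j assume "i < dim_row C" "j < dim_col C"
    with C show "to_mat n B $$ (i, j) = C $$ (i, j)" by (simp only: C) (simp add: to_mat_def B_def)
  qed (use carrier_matD[OF \<open>C \<in> carrier_mat n n\<close>] in \<open>simp_all add: to_mat_def\<close>)
  have det: "Determinant.det (to_mat n A) = 1" using assms by (simp add: SLR_def mdet_eq_det)
  have one: "1 \<cdot>\<^sub>m 1\<^sub>m n = (1\<^sub>m n :: real mat)" by (rule eq_matI) auto
  have 1: "to_mat n A * C = 1\<^sub>m n" "C * to_mat n A = 1\<^sub>m n"
    using adj_mat(2,3)[OF to_mat_carrier, of n A] unfolding det C_def one by simp_all
  have AB: "mmul n A B = idm n" "mmul n B A = idm n"
    by (rule to_mat_inj[OF mmul_mats idm_mats], simp only: to_mat_mmul tB 1 to_mat_idm)+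
  have "Determinant.det C = 1"
    using det_mult[of "to_mat n A" n C] 1 det by simp
  then have B: "B \<in> SLR n" by (simp add: SLR_def mdet_eq_det tB)
  have Z: "B \<in> SLZ n" if "A \<in> SLZ n"
  proof -
    have "C $$ (i, j) \<in> \<int>" if ij: "i < n" "j < n" for i j
    proof -
      have "Determinant.det (mat_delete (to_mat n A) j i) \<in> \<int>"
      proof (rule det_Ints)
        show "mat_delete (to_mat n A) j i \<in> carrier_mat (n - 1) (n - 1)"
          by (rule mat_delete_carrier) simp
        fix a b assume "a < n - 1" "b < n - 1"
        then show "mat_delete (to_mat n A) j i $$ (a, b) \<in> \<int>"
          using \<open>A \<in> SLZ n\<close> by (simp add: mat_delete_def to_mat_def SLZ_def)
      qed
      moreover have "C $$ (i, j) = (-1) ^ (j + i) * Determinant.det (mat_delete (to_mat n A) j i)"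
        using ij by (simp add: C_def adj_mat_def cofactor_def to_mat_def)
      ultimately show ?thesis by simp
    qed
    then have "\<forall>i j. B i j \<in> \<int>" by (simp add: B_def)
    then show ?thesis using B by (simp add: SLZ_def)
  qed
  show thesis by (rule that[OF B AB]) (use Z in blast)
qed

text \<open>\<open>minv\<close> is merely some right inverse in \<open>mats n\<close>; the existence
  of a two-sided inverse forces the choice and transports its properties.\<close>

lemma minv:
  assumes "A \<in> SLR n"
  shows "minv n A \<in> SLR n" "mmul n A (minv n A) = idm n" "mmul n (minv n A) A = idm n"
    "A \<in> SLZ n \<Longrightarrow> minv n A \<in> SLZ n"
proof -
  from SLR_inverse[OF assms] obtain B
    where B: "B \<in> SLR n" "mmul n A B = idm n" "mmul n B A = idm n" "A \<in> SLZ n \<longrightarrow> B \<in> SLZ n" .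
  have "minv n A \<in> mats n \<and> mmul n A (minv n A) = idm n"
    unfolding minv_def by (rule someI[where x = B]) (use B in \<open>simp add: SLR_mats\<close>)
  then have "minv n A = B"
    using B(1,3) mmul_assoc[of n B A "minv n A"] by (simp add: SLR_mats)
  with B show "minv n A \<in> SLR n" "mmul n A (minv n A) = idm n" "mmul n (minv n A) A = idm n"
    "A \<in> SLZ n \<Longrightarrow> minv n A \<in> SLZ n" by auto
qed

lemma minv_mats [simp]: "A \<in> SLR n \<Longrightarrow> minv n A \<in> mats n"
  by (simp add: minv SLR_mats)

lemma vmul_cancel [simp]:
  assumes "A \<in> SLR n" "v \<in> vecs n"
  shows "vmul n (vmul n v A) (minv n A) = v" "vmul n (vmul n v (minv n A)) A = v"
  using assms by (simp_all add: vmul_mmul minv)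

lemma vmul_zero [simp]: "vmul n (\<lambda>_. 0) A = (\<lambda>_. 0)"
  by (auto simp: vmul_def)

lemma vmul_eq_zero:
  assumes "A \<in> SLR n" "v \<in> vecs n"
  shows "vmul n v A = (\<lambda>_. 0) \<longleftrightarrow> v = (\<lambda>_. 0)"
proof
  assume "vmul n v A = (\<lambda>_. 0)"
  then have "vmul n (vmul n v A) (minv n A) = (\<lambda>_. 0)" by simp
  then show "v = (\<lambda>_. 0)" using assms by simp
qed simp

lemma vmul_zvecs: "z \<in> zvecs n \<Longrightarrow> A \<in> SLZ n \<Longrightarrow> vmul n z A \<in> zvecs n"
  by (auto simp: zvecs_def SLZ_def) (auto simp: vmul_def intro!: Ints_sum Ints_mult)

subsection \<open>Cosets and lattices\<close>

lemma coset_refl: "g \<in> SLR n \<Longrightarrow> g \<in> coset n g"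
  unfolding coset_def by (auto intro!: exI[of _ "idm n"] simp: SLR_mats)

lemma coset_eq:
  assumes "g \<in> SLR n" "h \<in> coset n g"
  shows "h \<in> SLR n" "coset n h = coset n g"
proof -
  obtain c where c: "c \<in> SLZ n" "h = mmul n c g" using assms by (auto simp: coset_def)
  then show "h \<in> SLR n" using assms by (simp add: SLZ_SLR)
  have g: "g = mmul n (minv n c) h"
    using c assms by (simp add: mmul_assoc[symmetric] minv SLZ_SLR SLR_mats)
  show "coset n h = coset n g"
  proof (intro subset_antisym subsetI)
    fix a assume "a \<in> coset n h"
    then obtain d where "d \<in> SLZ n" "a = mmul n d h" by (auto simp: coset_def)
    then have "a = mmul n (mmul n d c) g" "mmul n d c \<in> SLZ n" using c by (simp_all add: mmul_assoc)
    then show "a \<in> coset n g" by (auto simp: coset_def)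
  next
    fix a assume "a \<in> coset n g"
    then obtain d where d: "d \<in> SLZ n" "a = mmul n d g" by (auto simp: coset_def)
    then have "a = mmul n (mmul n d (minv n c)) h" using g by (simp add: mmul_assoc)
    moreover have "mmul n d (minv n c) \<in> SLZ n" using c d by (simp add: minv SLZ_SLR)
    ultimately show "a \<in> coset n h" by (auto simp: coset_def)
  qed
qed

lemma Xsp_mem:
  assumes "x \<in> Xsp n" "g \<in> x"
  shows "g \<in> SLR n" "x = coset n g"
proof -
  obtain g' where "g' \<in> SLR n" "x = coset n g'" using assms(1) unfolding Xsp_def by blast
  with coset_eq[of g' n g] assms(2) show "g \<in> SLR n" "x = coset n g" by simp_all
qed

lemma Xsp_ex: "x \<in> Xsp n \<Longrightarrow> \<exists>g\<in>SLR n. g \<in> x \<and> x = coset n g"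
  using coset_refl unfolding Xsp_def by blast

lemma coset_Xsp [simp]: "g \<in> SLR n \<Longrightarrow> coset n g \<in> Xsp n"
  by (simp add: Xsp_def)

lemma xact_coset: "xact n (coset n g) h = coset n (mmul n g h)"
proof (intro subset_antisym subsetI)
  fix a assume "a \<in> coset n (mmul n g h)"
  then obtain c where c: "c \<in> SLZ n" "a = mmul n c (mmul n g h)" by (auto simp: coset_def)
  then have "a = mmul n (mmul n c g) h" by (simp add: mmul_assoc)
  moreover have "mmul n c g \<in> coset n g" using c by (auto simp: coset_def)
  ultimately show "a \<in> xact n (coset n g) h" by (auto simp: xact_def)
qed (auto simp: xact_def coset_def mmul_assoc)

lemma xact_Xsp [simp]: "x \<in> Xsp n \<Longrightarrow> h \<in> SLR n \<Longrightarrow> xact n x h \<in> Xsp n"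
  by (auto simp: Xsp_def xact_coset)

lemma xact_xact: "x \<in> Xsp n \<Longrightarrow> xact n (xact n x h) h' = xact n x (mmul n h h')"
  by (auto simp: Xsp_def xact_coset mmul_assoc)

lemma xact_idm: "x \<in> Xsp n \<Longrightarrow> xact n x (idm n) = x"
  by (auto simp: Xsp_def xact_coset SLR_mats)

lemma xact_minv [simp]:
  assumes "x \<in> Xsp n" "h \<in> SLR n"
  shows "xact n (xact n x h) (minv n h) = x" "xact n (xact n x (minv n h)) h = x"
  using assms by (simp_all add: xact_xact minv xact_idm)

text \<open>Admissibility and invariance are stated with images under translations, measurability
  and the events below with preimages; invertibility links the two.\<close>

lemma xact_image_eq:
  assumes "E \<subseteq> Xsp n" "h \<in> SLR n"
  shows "(\<lambda>x. xact n x h) ` E = {x \<in> Xsp n. xact n x (minv n h) \<in> E}"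
proof (intro subset_antisym subsetI)
  fix x assume "x \<in> {x \<in> Xsp n. xact n x (minv n h) \<in> E}"
  then show "x \<in> (\<lambda>x. xact n x h) ` E"
    using assms by (auto intro!: image_eqI[of _ _ "xact n x (minv n h)"])
qed (use assms in auto)

text \<open>An integral matrix maps integer vectors to integer vectors, so a single representative
  of the coset already produces the whole lattice.\<close>

lemma latt_coset:
  assumes "g \<in> SLR n"
  shows "latt n (coset n g) = (\<lambda>z. vmul n z g) ` zvecs n"
proof (intro subset_antisym subsetI)
  fix v assume "v \<in> latt n (coset n g)"
  then obtain z c where "z \<in> zvecs n" "c \<in> SLZ n" "v = vmul n (vmul n z c) g"
    unfolding latt_def coset_def by (auto simp: vmul_mmul)
  then show "v \<in> (\<lambda>z. vmul n z g) ` zvecs n" by (auto intro: vmul_zvecs)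
next
  fix v assume "v \<in> (\<lambda>z. vmul n z g) ` zvecs n"
  with coset_refl[OF assms] show "v \<in> latt n (coset n g)" unfolding latt_def by blast
qed

lemma latt_vecs: "v \<in> latt n x \<Longrightarrow> v \<in> vecs n"
  by (auto simp: latt_def)

lemma latt_xact:
  assumes "x \<in> Xsp n" "h \<in> SLR n"
  shows "latt n (xact n x h) = (\<lambda>v. vmul n v h) ` latt n x"
proof -
  obtain g where g: "g \<in> SLR n" "x = coset n g" using Xsp_ex[OF assms(1)] by auto
  then show ?thesis using assms(2)
    by (simp add: xact_coset latt_coset image_image vmul_mmul)
qed

lemma latt_uminus:
  assumes "x \<in> Xsp n" "v \<in> latt n x"
  shows "(\<lambda>i. - v i) \<in> latt n x"
proof -
  obtain g where g: "g \<in> SLR n" "x = coset n g" using Xsp_ex[OF assms(1)] by auto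
  then obtain z where z: "z \<in> zvecs n" "v = vmul n z g" using assms by (auto simp: latt_coset)
  have "(\<lambda>i. - z i) \<in> zvecs n" using z by (auto simp: zvecs_def vecs_def)
  moreover have "(\<lambda>i. - v i) = vmul n (\<lambda>i. - z i) g"
    using vmul_scale[of n "-1" z g] z by simp
  ultimately show ?thesis using g by (auto simp: latt_coset)
qed

lemma countable_zvecs [simp]: "countable (zvecs n)"
proof -
  have "inj_on (\<lambda>v. map v [0..<n]) (zvecs n)"
  proof (rule inj_onI, rule ext)
    fix v w i assume *: "v \<in> zvecs n" "w \<in> zvecs n" "map v [0..<n] = map w [0..<n]"
    then show "v i = w i" by (cases "i < n") (auto simp: zvecs_def vecs_def)
  qed
  moreover have "(\<lambda>v. map v [0..<n]) ` zvecs n \<subseteq> lists \<int>" by (auto simp: zvecs_def)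
  moreover have "countable (lists (\<int> :: real set))" by (intro countable_lists) (simp add: Ints_def)
  ultimately show ?thesis by (meson countable_image_inj_on countable_subset)
qed

lemma countable_latt: "x \<in> Xsp n \<Longrightarrow> countable (latt n x)"
  using Xsp_ex[of x n] by (auto simp: latt_coset)

subsection \<open>The \<open>l\<^sup>1\<close> norm and finiteness of lattice points\<close>

definition l1 :: "nat \<Rightarrow> (nat \<Rightarrow> real) \<Rightarrow> real" where
  "l1 n v = (\<Sum>i<n. \<bar>v i\<bar>)"

definition mnorm :: "nat \<Rightarrow> (nat \<Rightarrow> nat \<Rightarrow> real) \<Rightarrow> real" where
  "mnorm n A = (\<Sum>i<n. \<Sum>j<n. \<bar>A i j\<bar>)"

lemma l1_nonneg [simp]: "0 \<le> l1 n v"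
  by (simp add: l1_def sum_nonneg)

lemma mnorm_nonneg [simp]: "0 \<le> mnorm n A"
  by (simp add: mnorm_def sum_nonneg)

lemma l1_triangle: "l1 n (\<lambda>i. v i + w i) \<le> l1 n v + l1 n w"
  unfolding l1_def sum.distrib[symmetric] by (intro sum_mono) auto

lemma l1_scale: "l1 n (\<lambda>i. c * v i) = \<bar>c\<bar> * l1 n v"
  by (simp add: l1_def abs_mult sum_distrib_left)

lemma l1_minus_commute: "l1 n (\<lambda>i. v i - w i) = l1 n (\<lambda>i. w i - v i)"
  by (simp add: l1_def abs_minus_commute)

lemma l1_triangle_diff: "l1 n v \<le> l1 n w + l1 n (\<lambda>i. v i - w i)"
  using l1_triangle[of n w "\<lambda>i. v i - w i"] by simp

lemma abs_le_l1: "i < n \<Longrightarrow> \<bar>v i\<bar> \<le> l1 n v"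
  unfolding l1_def by (rule member_le_sum[of i "{..<n}" "\<lambda>i. \<bar>v i\<bar>"]) auto

lemma l1_vmul: "l1 n (vmul n v A) \<le> mnorm n A * l1 n v"
proof -
  have "l1 n (vmul n v A) \<le> (\<Sum>j<n. \<Sum>i<n. \<bar>v i\<bar> * \<bar>A i j\<bar>)"
    unfolding l1_def
  proof (intro sum_mono)
    fix j assume "j \<in> {..<n}"
    then show "\<bar>vmul n v A j\<bar> \<le> (\<Sum>i<n. \<bar>v i\<bar> * \<bar>A i j\<bar>)"
      by (simp add: vmul_def) (rule order_trans[OF sum_abs], simp add: abs_mult)
  qed
  also have "\<dots> = (\<Sum>i<n. \<bar>v i\<bar> * (\<Sum>j<n. \<bar>A i j\<bar>))"
    by (subst sum.swap) (simp add: sum_distrib_left)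
  also have "\<dots> \<le> (\<Sum>i<n. \<bar>v i\<bar> * mnorm n A)"
  proof (intro sum_mono mult_left_mono)
    fix i assume "i \<in> {..<n}"
    then show "(\<Sum>j<n. \<bar>A i j\<bar>) \<le> mnorm n A"
      unfolding mnorm_def by (intro member_le_sum[of i "{..<n}" "\<lambda>i. \<Sum>j<n. \<bar>A i j\<bar>"]) (auto intro: sum_nonneg)
  qed simp
  finally show ?thesis by (simp add: l1_def sum_distrib_left mult.commute)
qed

lemma continuous_coordinate [continuous_intros]:
  "continuous_on S (\<lambda>x :: 'a \<Rightarrow> 'b :: topological_space. x i)"
  by (rule continuous_on_subset[OF continuous_on_product_coordinates]) simp

lemma continuous_l1 [continuous_intros]:
  assumes "continuous_on S f"
  shows "continuous_on S (\<lambda>x. l1 n (f x))"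
  unfolding l1_def
  by (intro continuous_on_sum continuous_on_rabs continuous_on_product_then_coordinatewise[OF assms])

lemma continuous_mnorm [continuous_intros]:
  assumes "continuous_on S f"
  shows "continuous_on S (\<lambda>x. mnorm n (f x))"
  unfolding mnorm_def
  by (intro continuous_on_sum continuous_on_rabs
      continuous_on_product_then_coordinatewise[OF continuous_on_product_then_coordinatewise[OF assms]])

lemma continuous_vmul [continuous_intros]:
  assumes "continuous_on S f" "continuous_on S g"
  shows "continuous_on S (\<lambda>x. vmul n (f x) (g x))"
proof (rule continuous_on_coordinatewise_then_product)
  fix j
  have "continuous_on S (\<lambda>x. \<Sum>i<n. f x i * g x i j)"
    by (intro continuous_on_sum continuous_on_mult continuous_on_product_then_coordinatewise[OF assms(1)]
        continuous_on_product_then_coordinatewise[OF continuous_on_product_then_coordinatewise[OF assms(2)]])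
  then show "continuous_on S (\<lambda>x. vmul n (f x) (g x) j)"
    by (cases "j < n") (simp_all add: vmul_def)
qed

lemma continuous_mmul [continuous_intros]:
  assumes "continuous_on S f" "continuous_on S g"
  shows "continuous_on S (\<lambda>x. mmul n (f x) (g x))"
proof (intro continuous_on_coordinatewise_then_product)
  fix i j
  have "continuous_on S (\<lambda>x. \<Sum>l<n. f x i l * g x l j)"
    by (intro continuous_on_sum continuous_on_mult
        continuous_on_product_then_coordinatewise[OF continuous_on_product_then_coordinatewise[OF assms(1)]]
        continuous_on_product_then_coordinatewise[OF continuous_on_product_then_coordinatewise[OF assms(2)]])
  then show "continuous_on S (\<lambda>x. mmul n (f x) (g x) i j)"
    unfolding mmul_def by (cases "i < n \<and> j < n") (simp, simp only: if_False continuous_on_const)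
qed

lemma finite_zvecs_bounded: "finite {z \<in> zvecs n. l1 n z \<le> M}"
proof -
  let ?B = "{z \<in> zvecs n. l1 n z \<le> M}"
  have inj: "inj_on (\<lambda>v. map v [0..<n]) ?B"
  proof (rule inj_onI, rule ext)
    fix v w i assume *: "v \<in> ?B" "w \<in> ?B" "map v [0..<n] = map w [0..<n]"
    then show "v i = w i" by (cases "i < n") (auto simp: zvecs_def vecs_def)
  qed
  have fin: "finite {r \<in> \<int>. \<bar>r\<bar> \<le> M}" by (rule finite_abs_int_segment)
  have "(\<lambda>v. map v [0..<n]) ` ?B \<subseteq> {xs. set xs \<subseteq> {r \<in> \<int>. \<bar>r\<bar> \<le> M} \<and> length xs = n}"
    using order_trans[OF abs_le_l1, of _ n _ M] by (fastforce simp: zvecs_def)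
  moreover have "finite {xs. set xs \<subseteq> {r \<in> \<int>. \<bar>r\<bar> \<le> M} \<and> length xs = n}"
    by (rule finite_lists_length_eq[OF fin])
  ultimately have "finite ((\<lambda>v. map v [0..<n]) ` ?B)" by (rule finite_subset)
  then show ?thesis using inj by (rule finite_imageD)
qed

text \<open>Applying the inverse matrix turns bounded lattice vectors into bounded integer
  vectors.\<close>

lemma finite_latt_bounded:
  assumes "x \<in> Xsp n"
  shows "finite {v \<in> latt n x. l1 n v \<le> M}"
proof -
  obtain g where g: "g \<in> SLR n" "x = coset n g" using Xsp_ex[OF assms] by auto
  have "{v \<in> latt n x. l1 n v \<le> M} \<subseteq> (\<lambda>z. vmul n z g) ` {z \<in> zvecs n. l1 n z \<le> mnorm n (minv n g) * M}"
  proof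
    fix v assume v: "v \<in> {v \<in> latt n x. l1 n v \<le> M}"
    then obtain z where z: "z \<in> zvecs n" "v = vmul n z g" using g by (auto simp: latt_coset)
    then have "z = vmul n v (minv n g)" using g by (simp add: zvecs_def)
    then have "l1 n z \<le> mnorm n (minv n g) * l1 n v" by (simp add: l1_vmul)
    also have "\<dots> \<le> mnorm n (minv n g) * M" using v by (intro mult_left_mono) auto
    finally show "v \<in> (\<lambda>z. vmul n z g) ` {z \<in> zvecs n. l1 n z \<le> mnorm n (minv n g) * M}" using z by blast
  qed
  then show ?thesis by (rule finite_subset) (simp add: finite_zvecs_bounded)
qed

lemma latt_nonzero_ex:
  assumes "x \<in> Xsp n" "0 < n"
  shows "\<exists>v\<in>latt n x. v \<noteq> (\<lambda>_. 0)"
proof -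
  obtain g where g: "g \<in> SLR n" "x = coset n g" using Xsp_ex[OF assms(1)] by auto
  define z where "z = (\<lambda>i::nat. if i = 0 then 1 else (0::real))"
  have z: "z \<in> zvecs n" "z \<noteq> (\<lambda>_. 0)"
    using assms(2) by (auto simp: z_def zvecs_def vecs_def fun_eq_iff)
  then have "vmul n z g \<in> latt n x" "vmul n z g \<noteq> (\<lambda>_. 0)"
    using g by (auto simp: latt_coset vmul_eq_zero zvecs_def)
  then show ?thesis by blast
qed

text \<open>The function space has the product topology, so compactness comes from Tychonoff, with
  the factor {0} at every coordinate from \<open>d\<close> on.\<close>

lemma compact_l1_ball: "compact {v \<in> vecs d. l1 d v \<le> M}"
proof -
  define B where "B = (\<lambda>i. if i < d then {-M..M} else {0::real})"
  have "compact (B i)" for i by (simp add: B_def)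
  then have "compactin (product_topology (\<lambda>i. euclidean) UNIV) (PiE UNIV B)"
    by (simp add: compactin_PiE)
  then have comp: "compact (PiE UNIV B)" by (simp add: euclidean_product_topology)
  have cl: "closed {v. l1 d v \<le> M}"
    by (intro closed_Collect_le continuous_intros)
  have "{v \<in> vecs d. l1 d v \<le> M} = PiE UNIV B \<inter> {v. l1 d v \<le> M}"
  proof (intro subset_antisym subsetI)
    fix v assume v: "v \<in> {v \<in> vecs d. l1 d v \<le> M}"
    then have "v i \<in> B i" for i
      using abs_le_l1[of i d v] by (cases "i < d") (auto simp: B_def vecs_def abs_le_iff)
    with v show "v \<in> PiE UNIV B \<inter> {v. l1 d v \<le> M}" by (simp add: PiE_iff)
  next
    fix v assume v: "v \<in> PiE UNIV B \<inter> {v. l1 d v \<le> M}"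
    then have vB: "v i \<in> B i" for i by (simp add: PiE_iff)
    have "v i = 0" if "d \<le> i" for i using vB[of i] that by (simp add: B_def)
    then have "v \<in> vecs d" by (simp add: vecs_def)
    with v show "v \<in> {v \<in> vecs d. l1 d v \<le> M}" by auto
  qed
  with comp cl show ?thesis by (simp add: compact_Int_closed)
qed

subsection \<open>Norms on coordinate spaces\<close>

lemma vecs_closed_add: "v \<in> vecs n \<Longrightarrow> w \<in> vecs n \<Longrightarrow> (\<lambda>i. v i + w i) \<in> vecs n"
  by (simp add: vecs_def)

lemma vecs_closed_scale: "v \<in> vecs n \<Longrightarrow> (\<lambda>i. c * v i) \<in> vecs n"
  by (simp add: vecs_def)

lemma vecs_closed_diff: "v \<in> vecs n \<Longrightarrow> w \<in> vecs n \<Longrightarrow> (\<lambda>i. v i - w i) \<in> vecs n"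
  by (simp add: vecs_def)

lemma vecs_zero [simp]: "(\<lambda>_. 0) \<in> vecs n"
  by (simp add: vecs_def)

lemma vecs_mono: "v \<in> vecs k \<Longrightarrow> k \<le> n \<Longrightarrow> v \<in> vecs n"
  by (auto simp: vecs_def)

context
  fixes d :: nat and N :: "(nat \<Rightarrow> real) \<Rightarrow> real"
  assumes N: "is_norm_on d N"
begin

lemma norm_ge0: "x \<in> vecs d \<Longrightarrow> 0 \<le> N x"
  and norm_eq0: "x \<in> vecs d \<Longrightarrow> N x = 0 \<longleftrightarrow> x = (\<lambda>_. 0)"
  and norm_scale: "x \<in> vecs d \<Longrightarrow> N (\<lambda>i. c * x i) = \<bar>c\<bar> * N x"
  and norm_add: "x \<in> vecs d \<Longrightarrow> y \<in> vecs d \<Longrightarrow> N (\<lambda>i. x i + y i) \<le> N x + N y"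
  using N unfolding is_norm_on_def by blast+

lemma norm_triangle_diff:
  assumes "x \<in> vecs d" "y \<in> vecs d"
  shows "N x \<le> N y + N (\<lambda>i. x i - y i)"
  using norm_add[OF assms(2) vecs_closed_diff[OF assms]] by simp

lemma norm_upper: "\<exists>C>0. \<forall>x\<in>vecs d. N x \<le> C * l1 d x"
proof -
  define e where "e = (\<lambda>i j::nat. if j = i then 1 else (0::real))"
  have e: "e i \<in> vecs d" if "i < d" for i using that by (auto simp: e_def vecs_def)
  \<comment> \<open>The norm axioms handle binary sums only, hence an induction on the number of
    coordinates kept.\<close>
  have trunc: "N (\<lambda>i. if i < j then x i else 0) \<le> (\<Sum>i<j. \<bar>x i\<bar> * N (e i))"
    if "x \<in> vecs d" "j \<le> d" for x j
    using that(2)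
  proof (induction j)
    case 0
    show ?case using norm_eq0[of "\<lambda>_. 0"] by simp
  next
    case (Suc j)
    have 1: "(\<lambda>i. if i < j then x i else 0) \<in> vecs d" using that by (auto simp: vecs_def)
    have 2: "(\<lambda>i. x j * e j i) \<in> vecs d" using e[of j] Suc.prems by (simp add: vecs_closed_scale)
    have "(\<lambda>i. if i < Suc j then x i else 0) = (\<lambda>i. (if i < j then x i else 0) + x j * e j i)"
      by (rule ext) (auto simp: e_def less_Suc_eq)
    then have "N (\<lambda>i. if i < Suc j then x i else 0) \<le> N (\<lambda>i. if i < j then x i else 0) + N (\<lambda>i. x j * e j i)"
      using norm_add[OF 1 2] by simp
    also have "N (\<lambda>i. x j * e j i) = \<bar>x j\<bar> * N (e j)"
      using e[of j] Suc.prems by (simp add: norm_scale)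
    finally show ?case using Suc by simp
  qed
  define C where "C = 1 + (\<Sum>i<d. N (e i))"
  have pos: "0 \<le> (\<Sum>i<d. N (e i))" using norm_ge0 e by (intro sum_nonneg) auto
  have "N x \<le> C * l1 d x" if x: "x \<in> vecs d" for x
  proof -
    have "(\<lambda>i. if i < d then x i else 0) = x" using x by (auto simp: vecs_def)
    then have "N x \<le> (\<Sum>i<d. \<bar>x i\<bar> * N (e i))" using trunc[OF x, of d] by simp
    also have "\<dots> \<le> (\<Sum>i<d. \<bar>x i\<bar> * C)"
    proof (intro sum_mono mult_left_mono)
      fix i assume "i \<in> {..<d}"
      then have "N (e i) \<le> (\<Sum>i<d. N (e i))"
        using norm_ge0 e by (intro member_le_sum[of i "{..<d}" "\<lambda>i. N (e i)"]) auto
      then show "N (e i) \<le> C" by (simp add: C_def)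
    qed simp
    finally show ?thesis by (simp add: l1_def sum_distrib_left mult.commute)
  qed
  moreover have "C > 0" using pos by (simp add: C_def)
  ultimately show ?thesis by blast
qed

lemma norm_continuous: "continuous_on (vecs d) N"
proof -
  obtain C where C: "C > 0" "\<And>x. x \<in> vecs d \<Longrightarrow> N x \<le> C * l1 d x" using norm_upper by blast
  show ?thesis
    unfolding continuous_on_def
  proof (intro ballI)
    fix x assume x: "x \<in> vecs d"
    have lim: "((\<lambda>y. C * l1 d (\<lambda>i. y i - x i)) \<longlongrightarrow> 0) (at x within vecs d)"
    proof -
      have "continuous_on (vecs d) (\<lambda>y. C * l1 d (\<lambda>i. y i - x i))"
        by (intro continuous_on_mult continuous_l1 continuous_on_const continuous_on_coordinatewise_then_product
            continuous_on_diff continuous_coordinate)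
      then have "((\<lambda>y. C * l1 d (\<lambda>i. y i - x i)) \<longlongrightarrow> C * l1 d (\<lambda>i. x i - x i)) (at x within vecs d)"
        using x by (simp only: continuous_on_def) 
      then show ?thesis by (simp add: l1_def)
    qed
    have "\<forall>\<^sub>F y in at x within vecs d. norm (N y - N x) \<le> C * l1 d (\<lambda>i. y i - x i)"
      unfolding eventually_at_filter
    proof (rule always_eventually, intro allI impI)
      fix y assume "y \<in> vecs d"
      have "N y \<le> N x + C * l1 d (\<lambda>i. y i - x i)"
        using norm_triangle_diff[OF \<open>y \<in> vecs d\<close> x] C(2)[OF vecs_closed_diff[OF \<open>y \<in> vecs d\<close> x]] by linarith
      moreover have "N x \<le> N y + C * l1 d (\<lambda>i. y i - x i)"
        using norm_triangle_diff[OF x \<open>y \<in> vecs d\<close>] C(2)[OF vecs_closed_diff[OF x \<open>y \<in> vecs d\<close>]]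
        by (subst l1_minus_commute) linarith
      ultimately show "norm (N y - N x) \<le> C * l1 d (\<lambda>i. y i - x i)" by (simp add: abs_le_iff)
    qed
    from Lim_null_comparison[OF this lim] show "(N \<longlongrightarrow> N x) (at x within vecs d)"
      by (simp add: LIM_zero_iff)
  qed
qed

text \<open>A continuous positive function has a positive minimum on the compact \<open>l1\<close>
  unit sphere; homogeneity does the rest.\<close>

lemma norm_lower: "\<exists>c>0. \<forall>x\<in>vecs d. c * l1 d x \<le> N x"
proof -
  define S where "S = {v \<in> vecs d. l1 d v \<le> 1} \<inter> {v. l1 d v = 1}"
  have "closed {v. l1 d v = 1}" by (intro closed_Collect_eq continuous_intros)
  then have S: "compact S" unfolding S_def by (intro compact_Int_closed compact_l1_ball)
  have cont: "continuous_on S N"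
    by (rule continuous_on_subset[OF norm_continuous]) (auto simp: S_def)
  have S0: "0 < N v" if "v \<in> S" for v
  proof -
    have "v \<in> vecs d" "v \<noteq> (\<lambda>_. 0)" using that by (auto simp: S_def l1_def)
    then show ?thesis using norm_ge0[of v] norm_eq0[of v] by auto
  qed
  have "\<exists>c>0. \<forall>v\<in>S. c \<le> N v"
  proof (cases "S = {}")
    \<comment> \<open>This happens for \<open>d = 0\<close>, where the sphere is empty and any
      positive constant will do.\<close>
    case True
    then show ?thesis by (auto intro: exI[of _ 1])
  next
    case False
    then obtain w where "w \<in> S" "\<forall>v\<in>S. N w \<le> N v" using continuous_attains_inf[OF S _ cont] by blast
    then show ?thesis using S0 by blast
  qed
  then obtain c where c: "c > 0" "\<And>v. v \<in> S \<Longrightarrow> c \<le> N v" by blast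
  have "c * l1 d x \<le> N x" if x: "x \<in> vecs d" for x
  proof (cases "l1 d x = 0")
    case True
    then show ?thesis using norm_ge0[OF x] by simp
  next
    case False
    then have pos: "0 < l1 d x" using l1_nonneg[of d x] by linarith
    define y where "y = (\<lambda>i. inverse (l1 d x) * x i)"
    have "y \<in> S" using x pos by (auto simp: S_def y_def vecs_closed_scale l1_scale)
    then have "c \<le> N y" by (rule c)
    also have "N y = inverse (l1 d x) * N x" using x pos by (simp add: y_def norm_scale)
    finally show ?thesis using pos by (simp add: field_simps)
  qed
  with c(1) show ?thesis by blast
qed

end

subsection \<open>The topology of the space of lattices\<close>

text \<open>Points are cosets, so \<open>\<Union>U\<close> is the preimage of \<open>U\<close> under
  the projection and the quotient topology is being described. Unions of intersections behave well
  because distinct cosets are disjoint.\<close>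

lemma istopology_Xtop: "istopology (\<lambda>U. U \<subseteq> Xsp n \<and> openin (top_of_set (SLR n)) (\<Union>U))"
  unfolding istopology_def
proof (intro conjI allI impI)
  fix S T assume *: "S \<subseteq> Xsp n \<and> openin (top_of_set (SLR n)) (\<Union>S)"
    "T \<subseteq> Xsp n \<and> openin (top_of_set (SLR n)) (\<Union>T)"
  show "S \<inter> T \<subseteq> Xsp n" using *(1)[THEN conjunct1] by blast
  have "\<Union>(S \<inter> T) = \<Union>S \<inter> \<Union>T"
  proof (intro subset_antisym subsetI)
    fix g assume "g \<in> \<Union>S \<inter> \<Union>T"
    then obtain x y where xy: "x \<in> S" "y \<in> T" "g \<in> x" "g \<in> y" by blast
    have "x \<in> Xsp n" by (rule subsetD[OF *(1)[THEN conjunct1] xy(1)])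
    then have x: "x = coset n g" using xy(3) by (rule Xsp_mem(2))
    have "y \<in> Xsp n" by (rule subsetD[OF *(2)[THEN conjunct1] xy(2)])
    then have y: "y = coset n g" using xy(4) by (rule Xsp_mem(2))
    have "x = y" unfolding x y ..
    then have "x \<in> S \<inter> T" using xy by simp
    then show "g \<in> \<Union>(S \<inter> T)" using xy(3) by (rule UnionI)
  qed blast
  moreover have "openin (top_of_set (SLR n)) (\<Union>S \<inter> \<Union>T)"
    using *(1)[THEN conjunct2] *(2)[THEN conjunct2] by (rule openin_Int)
  ultimately show "openin (top_of_set (SLR n)) (\<Union>(S \<inter> T))" by (simp only:)
next
  fix K assume *: "\<forall>S\<in>K. S \<subseteq> Xsp n \<and> openin (top_of_set (SLR n)) (\<Union>S)"
  show "\<Union>K \<subseteq> Xsp n" by (rule Union_least) (use * in simp)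
  have "\<Union>(\<Union>K) = \<Union>(Union ` K)" by (rule subset_antisym; force)
  moreover have "openin (top_of_set (SLR n)) (\<Union>(Union ` K))"
    by (rule openin_Union) (use * in auto)
  ultimately show "openin (top_of_set (SLR n)) (\<Union>(\<Union>K))" by (simp only:)
qed

lemma openin_Xtop: "openin (Xtop n) U \<longleftrightarrow> U \<subseteq> Xsp n \<and> openin (top_of_set (SLR n)) (\<Union>U)"
  unfolding Xtop_def by (simp add: topology_inverse'[OF istopology_Xtop])

lemma Union_Xsp: "\<Union>(Xsp n) = SLR n"
proof (intro subset_antisym subsetI)
  fix g assume "g \<in> \<Union>(Xsp n)"
  then obtain x where "x \<in> Xsp n" "g \<in> x" by blast
  then show "g \<in> SLR n" by (rule Xsp_mem(1))
next
  fix g assume "g \<in> SLR n"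
  then show "g \<in> \<Union>(Xsp n)" by (intro UnionI[OF coset_Xsp coset_refl])
qed

lemma topspace_Xtop [simp]: "topspace (Xtop n) = Xsp n"
proof -
  have "openin (Xtop n) (Xsp n)" by (simp add: openin_Xtop Union_Xsp)
  then have "Xsp n \<subseteq> topspace (Xtop n)" by (rule openin_subset)
  moreover have "topspace (Xtop n) \<subseteq> Xsp n" using openin_topspace[of "Xtop n"] by (simp only: openin_Xtop)
  ultimately show ?thesis by blast
qed

lemma space_Xborel [simp]: "space (Xborel n) = Xsp n"
  unfolding Xborel_def by (rule space_measure_of) (auto simp: openin_Xtop)

lemma openin_Xborel: "openin (Xtop n) U \<Longrightarrow> U \<in> sets (Xborel n)"
proof -
  have "{U. openin (Xtop n) U} \<subseteq> Pow (Xsp n)" by (auto simp: openin_Xtop)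
  then show "openin (Xtop n) U \<Longrightarrow> U \<in> sets (Xborel n)"
    unfolding Xborel_def by (simp add: sets_measure_of sigma_sets.Basic)
qed

section \<open>Events that a lattice meets a given set\<close>

definition Ev :: "nat \<Rightarrow> (nat \<Rightarrow> real) set \<Rightarrow> (nat \<Rightarrow> nat \<Rightarrow> real) set set" where
  "Ev n A = {x \<in> Xsp n. \<exists>v\<in>latt n x. v \<noteq> (\<lambda>_. 0) \<and> v \<in> A}"

lemma Ev_mono: "A \<inter> vecs n \<subseteq> B \<Longrightarrow> Ev n A \<subseteq> Ev n B"
  using latt_vecs unfolding Ev_def by blast

lemma Ev_subset: "Ev n A \<subseteq> Xsp n"
  by (auto simp: Ev_def)

lemma coset_Ev:
  assumes "g \<in> SLR n"
  shows "coset n g \<in> Ev n A \<longleftrightarrow> (\<exists>z\<in>zvecs n. z \<noteq> (\<lambda>_. 0) \<and> vmul n z g \<in> A)"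
  using assms by (auto simp: Ev_def latt_coset vmul_eq_zero zvecs_def)

lemma Union_Ev: "\<Union>(Ev n A) = {g \<in> SLR n. \<exists>z\<in>zvecs n. z \<noteq> (\<lambda>_. 0) \<and> vmul n z g \<in> A}"
proof (intro subset_antisym subsetI)
  fix g assume "g \<in> \<Union>(Ev n A)"
  then obtain x where x: "x \<in> Ev n A" "g \<in> x" by blast
  then have "x \<in> Xsp n" using Ev_subset by blast
  from Xsp_mem[OF this x(2)] x(1) show "g \<in> {g \<in> SLR n. \<exists>z\<in>zvecs n. z \<noteq> (\<lambda>_. 0) \<and> vmul n z g \<in> A}"
    by (simp add: coset_Ev)
next
  fix g assume g: "g \<in> {g \<in> SLR n. \<exists>z\<in>zvecs n. z \<noteq> (\<lambda>_. 0) \<and> vmul n z g \<in> A}"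
  then have "coset n g \<in> Ev n A" by (simp add: coset_Ev)
  moreover have "g \<in> coset n g" using g coset_refl by blast
  ultimately show "g \<in> \<Union>(Ev n A)" by blast
qed

lemma openin_Ev:
  assumes "open A"
  shows "openin (Xtop n) (Ev n A)"
proof -
  define V where "V = (\<Union>z\<in>zvecs n - {\<lambda>_. 0}. (\<lambda>g. vmul n z g) -` A)"
  have "open ((\<lambda>g. vmul n z g) -` A)" for z
    by (rule open_vimage[OF assms]) (intro continuous_intros)
  then have "open V" unfolding V_def by blast
  moreover have "\<Union>(Ev n A) = SLR n \<inter> V" unfolding Union_Ev V_def by blast
  ultimately have "openin (top_of_set (SLR n)) (\<Union>(Ev n A))" by (simp only: openin_open_Int)
  then show ?thesis unfolding openin_Xtop using Ev_subset by blast
qed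

lemma Ev_sets: "open A \<Longrightarrow> Ev n A \<in> sets (Xborel n)"
  by (intro openin_Xborel openin_Ev)

lemma Ev_xact:
  assumes "x \<in> Xsp n" "h \<in> SLR n"
  shows "xact n x h \<in> Ev n A \<longleftrightarrow> x \<in> Ev n {v. vmul n v h \<in> A}"
proof -
  obtain g where g: "g \<in> SLR n" "x = coset n g" using Xsp_ex[OF assms(1)] by auto
  then show ?thesis using assms by (simp add: xact_coset coset_Ev vmul_mmul)
qed

lemma vmul_diff_right:
  "vmul n v (\<lambda>i j. A i j - B i j) = (\<lambda>j. vmul n v A j - vmul n v B j)"
  by (rule ext) (simp add: vmul_def right_diff_distrib sum_subtractf)

text \<open>If g' is close to g, then z g' and z g differ by a small multiple of the length of z g.
  Boundedness of \<open>D\<close> makes this uniform over all lattice vectors in \<open>D\<close>,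
  so a limit of lattices meeting \<open>D\<close> meets any thickening of \<open>D\<close>.\<close>

lemma closure_Ev:
  assumes bdd: "\<And>d. d \<in> D \<Longrightarrow> d \<in> vecs n \<Longrightarrow> l1 n d \<le> M"
    and eps: "\<epsilon> > 0"
    and thick: "\<And>d e. d \<in> D \<Longrightarrow> d \<in> vecs n \<Longrightarrow> e \<in> vecs n \<Longrightarrow> l1 n (\<lambda>i. d i - e i) < \<epsilon> \<Longrightarrow> e \<in> D'"
  shows "Xtop n closure_of Ev n D \<subseteq> Ev n D'"
proof
  fix x assume x: "x \<in> Xtop n closure_of Ev n D"
  then have "x \<in> Xsp n" by (simp add: in_closure_of)
  then obtain g where g: "g \<in> SLR n" "x = coset n g" "g \<in> x" using Xsp_ex by blast
  define M' where "M' = max M 0"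
  \<comment> \<open>The bound 1/2 yields |e| <= 2|d|, and the other bound then makes the
    displacement, at most 2 \<open>\<eta>\<close> M', smaller than
    \<open>\<epsilon>\<close>.\<close>
  define \<eta> where "\<eta> = min (1/2) (\<epsilon> / (2 * M' + 2))"
  have \<eta>: "0 < \<eta>" "\<eta> \<le> 1/2" "2 * \<eta> * M' < \<epsilon>"
  proof -
    show "\<eta> \<le> 1/2" unfolding \<eta>_def by (rule min.cobounded1)
    show "0 < \<eta>" using eps by (auto simp: \<eta>_def M'_def)
    have "2 * \<eta> * M' \<le> 2 * (\<epsilon> / (2 * M' + 2)) * M'"
      by (intro mult_right_mono mult_left_mono) (auto simp: \<eta>_def M'_def)
    also have "\<dots> = \<epsilon> * (M' / (M' + 1))" by (simp add: M'_def field_simps)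
    also have "\<dots> < \<epsilon> * 1" using eps by (intro mult_strict_left_mono) (auto simp: M'_def divide_less_eq)
    finally show "2 * \<eta> * M' < \<epsilon>" by simp
  qed
  define V where "V = {g'. mnorm n (\<lambda>i j. mmul n (minv n g) g' i j - idm n i j) < \<eta>}"
  have oV: "open V" unfolding V_def
  proof (intro open_Collect_less continuous_mnorm continuous_on_const
      continuous_on_coordinatewise_then_product continuous_on_diff)
    fix i j
    have "continuous_on UNIV (\<lambda>g'. mmul n (minv n g) g')" by (intro continuous_intros)
    from continuous_on_product_then_coordinatewise[OF continuous_on_product_then_coordinatewise[OF this]]
    show "continuous_on UNIV (\<lambda>g'. mmul n (minv n g) g' i j)" .
  qed
  have gV: "g \<in> V" using g \<eta> by (simp add: V_def minv mnorm_def)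
  define T where "T = {y \<in> Xsp n. \<exists>g'\<in>y. g' \<in> V}"
  \<comment> \<open>A neighbourhood in the quotient consists of the cosets meeting \<open>V\<close>;
    its preimage is the union of the translates of \<open>V\<close> by the discrete group, hence
    open.\<close>
  have "\<Union>T = SLR n \<inter> (\<Union>c\<in>SLZ n. (\<lambda>g'. mmul n c g') -` V)"
  proof (intro subset_antisym subsetI)
    fix a assume "a \<in> \<Union>T"
    then obtain y g' where y: "y \<in> Xsp n" "g' \<in> y" "g' \<in> V" "a \<in> y" by (auto simp: T_def)
    then have a: "a \<in> SLR n" "y = coset n a" using Xsp_mem[OF y(1) y(4)] by simp_all
    with y obtain c where "c \<in> SLZ n" "g' = mmul n c a" by (auto simp: coset_def)
    with a y show "a \<in> SLR n \<inter> (\<Union>c\<in>SLZ n. (\<lambda>g'. mmul n c g') -` V)" by blast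
  next
    fix a assume "a \<in> SLR n \<inter> (\<Union>c\<in>SLZ n. (\<lambda>g'. mmul n c g') -` V)"
    then obtain c where c: "a \<in> SLR n" "c \<in> SLZ n" "mmul n c a \<in> V" by blast
    then have "mmul n c a \<in> coset n a" by (auto simp: coset_def)
    with c have "coset n a \<in> T" by (auto simp: T_def)
    then show "a \<in> \<Union>T" using coset_refl[OF c(1)] by (rule UnionI)
  qed
  moreover have "open ((\<lambda>g'. mmul n c g') -` V)" for c
    by (rule open_vimage[OF oV]) (intro continuous_intros)
  ultimately have "openin (top_of_set (SLR n)) (\<Union>T)"
    using openin_open_Int[OF open_UN] by (simp only:) blast
  then have "openin (Xtop n) T" unfolding openin_Xtop by (simp add: T_def)
  moreover have "x \<in> T" using g gV \<open>x \<in> Xsp n\<close> by (auto simp: T_def)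
  ultimately obtain y where y: "y \<in> Ev n D" "y \<in> T" using x unfolding in_closure_of by blast
  then obtain g' where g': "g' \<in> y" "g' \<in> V" "y \<in> Xsp n" by (auto simp: T_def)
  then have "g' \<in> SLR n" "y = coset n g'" using Xsp_mem[OF g'(3) g'(1)] by simp_all
  with y(1) obtain z where z: "z \<in> zvecs n" "z \<noteq> (\<lambda>_. 0)" "vmul n z g' \<in> D" by (auto simp: coset_Ev)
  define d where "d = vmul n z g'"
  define e where "e = vmul n z g"
  have ed: "d \<in> vecs n" "e \<in> vecs n" "d \<in> D" using z by (simp_all add: d_def e_def)
  have zv: "z \<in> vecs n" using z by (simp add: zvecs_def)
  have "d = vmul n e (mmul n (minv n g) g')"
    using zv g by (simp add: d_def e_def vmul_mmul[symmetric])
  then have "(\<lambda>i. d i - e i) = vmul n e (\<lambda>i j. mmul n (minv n g) g' i j - idm n i j)"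
    using ed by (simp add: vmul_diff_right)
  then have "l1 n (\<lambda>i. d i - e i) \<le> mnorm n (\<lambda>i j. mmul n (minv n g) g' i j - idm n i j) * l1 n e"
    by (simp add: l1_vmul)
  also have "\<dots> \<le> \<eta> * l1 n e" using g'(2) by (intro mult_right_mono) (auto simp: V_def)
  finally have de: "l1 n (\<lambda>i. d i - e i) \<le> \<eta> * l1 n e" .
  have "l1 n e \<le> l1 n d + l1 n (\<lambda>i. d i - e i)"
    using l1_triangle_diff[of n e d] by (simp add: l1_minus_commute[of n e d])
  also have "\<dots> \<le> l1 n d + 1/2 * l1 n e"
    using de mult_right_mono[OF \<eta>(2) l1_nonneg[of n e]] by linarith
  finally have "l1 n e \<le> 2 * l1 n d" by simp
  also have "\<dots> \<le> 2 * M'" using bdd[OF ed(3,1)] by (simp add: M'_def)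
  finally have "\<eta> * l1 n e \<le> \<eta> * (2 * M')" using \<eta> by (intro mult_left_mono) auto
  then have "l1 n (\<lambda>i. d i - e i) < \<epsilon>" using de \<eta>(3) by (simp add: mult.commute mult.left_commute)
  then have "e \<in> D'" using thick ed by blast
  then show "x \<in> Ev n D'" using g z by (auto simp: coset_Ev e_def)
qed

lemma SLR_upper_triangular:
  assumes "A \<in> mats n" "\<And>i j. j < i \<Longrightarrow> i < n \<Longrightarrow> A i j = 0" "(\<Prod>i<n. A i i) = 1"
  shows "A \<in> SLR n"
proof -
  have "Determinant.det (to_mat n A) = prod_list (diag_mat (to_mat n A))"
    by (rule det_upper_triangular[of _ n]) (auto simp: assms to_mat_def upper_triangular_def)
  also have "\<dots> = (\<Prod>i<n. A i i)"
    by (simp add: prod_list_diag_prod to_mat_def lessThan_atLeast0)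
  finally show ?thesis
    using assms by (simp add: SLR_def mdet_eq_det)
qed

lemma xact_measurable:
  assumes "h \<in> SLR n"
  shows "(\<lambda>x. xact n x h) \<in> measurable (Xborel n) (Xborel n)"
proof -
  have "(\<lambda>x. xact n x h) \<in> measurable (Xborel n) (measure_of (Xsp n) {U. openin (Xtop n) U} (\<lambda>_. 0))"
  proof (rule measurable_measure_of)
    show "{U. openin (Xtop n) U} \<subseteq> Pow (Xsp n)" by (auto simp: openin_Xtop)
    show "(\<lambda>x. xact n x h) \<in> space (Xborel n) \<rightarrow> Xsp n" using assms by simp
    fix U assume "U \<in> {U. openin (Xtop n) U}"
    then have U: "U \<subseteq> Xsp n" "openin (top_of_set (SLR n)) (\<Union>U)" by (auto simp: openin_Xtop)
    then obtain T where T: "open T" "\<Union>U = SLR n \<inter> T" by (auto simp: openin_open)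
    let ?P = "(\<lambda>x. xact n x h) -` U \<inter> space (Xborel n)"
    have mem: "coset n g \<in> ?P \<longleftrightarrow> mmul n g h \<in> T" if g: "g \<in> SLR n" for g
    proof -
      have gh: "mmul n g h \<in> SLR n" using g assms by simp
      have "coset n (mmul n g h) \<in> U \<longleftrightarrow> mmul n g h \<in> \<Union>U"
      proof
        assume "mmul n g h \<in> \<Union>U"
        then obtain y where y: "y \<in> U" "mmul n g h \<in> y" by blast
        then have "y \<in> Xsp n" using U by blast
        from Xsp_mem(2)[OF this y(2)] y(1) show "coset n (mmul n g h) \<in> U" by simp
      next
        assume "coset n (mmul n g h) \<in> U"
        then show "mmul n g h \<in> \<Union>U" using coset_refl[OF gh] by (rule UnionI)
      qed
      then show ?thesis using g gh T by (simp add: xact_coset)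
    qed
    have "\<Union>?P = SLR n \<inter> (\<lambda>g. mmul n g h) -` T"
    proof (intro subset_antisym subsetI)
      fix g assume "g \<in> \<Union>?P"
      then obtain x where x: "x \<in> ?P" "g \<in> x" by blast
      then have "x \<in> Xsp n" by simp
      from Xsp_mem[OF this x(2)] x(1) mem show "g \<in> SLR n \<inter> (\<lambda>g. mmul n g h) -` T" by simp
    next
      fix g assume g: "g \<in> SLR n \<inter> (\<lambda>g. mmul n g h) -` T"
      then have "coset n g \<in> ?P" by (intro mem[THEN iffD2]) auto
      then show "g \<in> \<Union>?P" by (rule UnionI) (use g coset_refl in simp)
    qed
    moreover have "open ((\<lambda>g. mmul n g h) -` T)"
      by (rule open_vimage[OF T(1)]) (intro continuous_mmul continuous_on_id continuous_on_const)
    ultimately have "openin (top_of_set (SLR n)) (\<Union>?P)" by (simp only: openin_open_Int)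
    then have "openin (Xtop n) ?P" unfolding openin_Xtop by simp
    then show "?P \<in> sets (Xborel n)" by (rule openin_Xborel)
  qed
  then show ?thesis by (simp add: Xborel_def)
qed

subsection \<open>Minima over lattice points and null events\<close>

text \<open>The value is infinite when no nonzero lattice point lies in \<open>A\<close>.\<close>

definition lmin :: "nat \<Rightarrow> (nat \<Rightarrow> real) set \<Rightarrow> ((nat \<Rightarrow> real) \<Rightarrow> real) \<Rightarrow> (nat \<Rightarrow> nat \<Rightarrow> real) set \<Rightarrow> ennreal" where
  "lmin n A q x = (INF v\<in>{v \<in> latt n x. v \<noteq> (\<lambda>_. 0) \<and> v \<in> A}. ennreal (q v))"

lemma lmin_less_iff:
  "lmin n A q x < c \<longleftrightarrow> (\<exists>v\<in>latt n x. v \<noteq> (\<lambda>_. 0) \<and> v \<in> A \<and> ennreal (q v) < c)"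
  unfolding lmin_def INF_less_iff by blast

lemma lmin_less_iff_Ev:
  "x \<in> Xsp n \<Longrightarrow> lmin n A q x < c \<longleftrightarrow> x \<in> Ev n {v \<in> A. ennreal (q v) < c}"
  unfolding lmin_less_iff Ev_def by blast

text \<open>Only vectors with value at most that of one given candidate compete; they are bounded by
  hypothesis and therefore finite in number.\<close>

lemma lmin_attained:
  assumes x: "x \<in> Xsp n" and fin: "lmin n A q x < \<infinity>"
    and nonneg: "\<And>v. v \<in> A \<Longrightarrow> 0 \<le> q v"
    and bdd: "\<And>c. \<exists>M. \<forall>v\<in>vecs n. v \<in> A \<longrightarrow> q v \<le> c \<longrightarrow> l1 n v \<le> M"
  shows "\<exists>v\<in>latt n x. v \<noteq> (\<lambda>_. 0) \<and> v \<in> A \<and> lmin n A q x = ennreal (q v)"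
proof -
  let ?V = "{v \<in> latt n x. v \<noteq> (\<lambda>_. 0) \<and> v \<in> A}"
  obtain v0 where v0: "v0 \<in> ?V" using fin unfolding lmin_less_iff by blast
  obtain M where M: "\<And>v. v \<in> vecs n \<Longrightarrow> v \<in> A \<Longrightarrow> q v \<le> q v0 \<Longrightarrow> l1 n v \<le> M"
    using bdd[of "q v0"] by blast
  define S where "S = {v \<in> ?V. q v \<le> q v0}"
  have "S \<subseteq> {v \<in> latt n x. l1 n v \<le> M}" using M latt_vecs by (auto simp: S_def)
  then have "finite S" using finite_latt_bounded[OF x] by (rule finite_subset)
  moreover have "v0 \<in> S" using v0 by (simp add: S_def)
  ultimately obtain w where w: "w \<in> S" "\<And>v. v \<in> S \<Longrightarrow> q w \<le> q v"
    using ex_is_arg_min_if_finite[of S q] unfolding is_arg_min_linorder by blast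
  have min: "q w \<le> q v" if "v \<in> ?V" for v
    using that w \<open>v0 \<in> S\<close> by (cases "q v \<le> q v0") (force simp: S_def)+
  have "lmin n A q x = ennreal (q w)"
  proof (rule antisym)
    show "lmin n A q x \<le> ennreal (q w)" unfolding lmin_def
      by (rule INF_lower) (use w in \<open>simp add: S_def\<close>)
    show "ennreal (q w) \<le> lmin n A q x" unfolding lmin_def
      by (rule INF_greatest) (rule ennreal_leI, erule min)
  qed
  then show ?thesis using w(1) by (auto simp: S_def)
qed

text \<open>Countable bases of both factors split \<open>U\<close> into countably many boxes, and
  each box yields a rectangle of an open set and an event. This gives membership in the product
  sigma algebra, which Fubini requires.\<close>

lemma sets_open_product:
  fixes U :: "(real \<times> (nat \<Rightarrow> real)) set"
  assumes "open U"
  shows "{p \<in> UNIV \<times> Xsp n. \<exists>v\<in>latt n (snd p). v \<noteq> (\<lambda>_. 0) \<and> (fst p, v) \<in> U} \<in> sets (borel \<Otimes>\<^sub>M Xborel n)"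
    (is "?L \<in> _")
proof -
  obtain B1 :: "real set set" where B1: "countable B1" "topological_basis B1"
    using ex_countable_basis by blast
  obtain B2 :: "(nat \<Rightarrow> real) set set" where B2: "countable B2" "topological_basis B2"
    using ex_countable_basis by blast
  define I where "I = {c \<in> B1 \<times> B2. fst c \<times> snd c \<subseteq> U}"
  have "countable I" using B1 B2 unfolding I_def by (intro countable_Collect) auto
  have "?L = (\<Union>c\<in>I. fst c \<times> Ev n (snd c))"
  proof (intro subset_antisym subsetI)
    fix p assume "p \<in> ?L"
    then obtain v where v: "snd p \<in> Xsp n" "v \<in> latt n (snd p)" "v \<noteq> (\<lambda>_. 0)" "(fst p, v) \<in> U"
      by (cases p) auto
    obtain X Y where XY: "open X" "open Y" "(fst p, v) \<in> X \<times> Y" "X \<times> Y \<subseteq> U"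
      using open_prod_elim[OF assms v(4)] by blast
    obtain a where a: "a \<in> B1" "fst p \<in> a" "a \<subseteq> X" using topological_basisE[OF B1(2) XY(1)] XY(3) by blast
    obtain b where b: "b \<in> B2" "v \<in> b" "b \<subseteq> Y" using topological_basisE[OF B2(2) XY(2)] XY(3) by blast
    have "(a, b) \<in> I" using a b XY(4) by (auto simp: I_def)
    moreover have "p \<in> a \<times> Ev n b" using a b v by (cases p) (auto simp: Ev_def)
    ultimately show "p \<in> (\<Union>c\<in>I. fst c \<times> Ev n (snd c))" by force
  next
    fix p assume "p \<in> (\<Union>c\<in>I. fst c \<times> Ev n (snd c))"
    then obtain a b where ab: "a \<times> b \<subseteq> U" "p \<in> a \<times> Ev n b" by (auto simp: I_def)
    then show "p \<in> ?L" by (cases p) (auto simp: Ev_def)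
  qed
  moreover have "fst c \<times> Ev n (snd c) \<in> sets (borel \<Otimes>\<^sub>M Xborel n)" if "c \<in> I" for c
  proof (rule pair_measureI)
    show "fst c \<in> sets borel" using that topological_basis_open[OF B1(2)] by (auto simp: I_def)
    show "Ev n (snd c) \<in> sets (Xborel n)"
      using that topological_basis_open[OF B2(2)] by (intro Ev_sets) (auto simp: I_def)
  qed
  then have "(\<Union>c\<in>I. fst c \<times> Ev n (snd c)) \<in> sets (borel \<Otimes>\<^sub>M Xborel n)"
    by (intro sets.countable_UN'[OF \<open>countable I\<close>]) blast
  ultimately show ?thesis by simp
qed

lemma lmin_measurable_joint:
  assumes A: "open A" and q: "continuous_on A q" and nonneg: "\<And>v. v \<in> A \<Longrightarrow> 0 \<le> q v"
    and h: "continuous_on UNIV h" "\<And>t :: real. h t \<in> SLR n"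
  shows "(\<lambda>p. lmin n A q (xact n (snd p) (h (fst p)))) \<in> borel_measurable (borel \<Otimes>\<^sub>M Xborel n)"
proof (rule borel_measurableI_less)
  fix y :: ennreal
  define G where "G = {v \<in> A. ennreal (q v) < y}"
  have "open G"
  proof (cases y)
    case top
    then have "G = A" by (auto simp: G_def)
    then show ?thesis using A by simp
  next
    case (real r)
    then have "G = q -` {..<r} \<inter> A" using nonneg by (auto simp: G_def ennreal_less_iff)
    then show ?thesis using continuous_open_preimage[OF q A, of "{..<r}"] by (simp add: Int_commute)
  qed
  \<comment> \<open>Moving the lattice by \<open>h t\<close> is the same as pulling the region back
    along v -> v h(t), jointly continuously in t and v.\<close>
  define U where "U = (\<lambda>p :: real \<times> (nat \<Rightarrow> real). vmul n (snd p) (h (fst p))) -` G"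
  have hf: "continuous_on UNIV (\<lambda>p :: real \<times> (nat \<Rightarrow> real). h (fst p))"
    by (rule continuous_on_compose2[OF h(1)]) (auto intro: continuous_on_fst continuous_on_id)
  have "open U"
    unfolding U_def by (rule open_vimage[OF \<open>open G\<close>]) (intro continuous_vmul continuous_on_snd continuous_on_id hf)
  have "{p \<in> space (borel \<Otimes>\<^sub>M Xborel n). lmin n A q (xact n (snd p) (h (fst p))) < y}
      = {p \<in> UNIV \<times> Xsp n. \<exists>v\<in>latt n (snd p). v \<noteq> (\<lambda>_. 0) \<and> (fst p, v) \<in> U}"
    by (rule Collect_cong)
      (auto simp: space_pair_measure lmin_less_iff_Ev Ev_xact h(2), auto simp: Ev_def U_def G_def)
  then show "{p \<in> space (borel \<Otimes>\<^sub>M Xborel n). lmin n A q (xact n (snd p) (h (fst p))) < y}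
      \<in> sets (borel \<Otimes>\<^sub>M Xborel n)"
    using sets_open_product[OF \<open>open U\<close>] by simp
qed

lemma lmin_measurable:
  assumes A: "open A" and q: "continuous_on A q" and nonneg: "\<And>v. v \<in> A \<Longrightarrow> 0 \<le> q v"
  shows "lmin n A q \<in> borel_measurable (Xborel n)"
proof -
  \<comment> \<open>The constant curve reduces the statement to the joint one; the time variable is
    then frozen at 0.\<close>
  have "(\<lambda>p. lmin n A q (xact n (snd p) (idm n))) \<in> borel_measurable ((borel :: real measure) \<Otimes>\<^sub>M Xborel n)"
    using lmin_measurable_joint[OF assms, where h = "\<lambda>_. idm n" and n = n] by simp
  from measurable_compose[OF measurable_Pair1'[of "0::real" borel "Xborel n"] this]
  have "(\<lambda>x. lmin n A q (xact n x (idm n))) \<in> borel_measurable (Xborel n)" by simp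
  then show ?thesis by (rule measurable_cong[THEN iffD1, rotated]) (simp add: xact_idm)
qed

section \<open>Null events for the invariant measure\<close>

context
  fixes n :: nat and \<mu> :: "(nat \<Rightarrow> nat \<Rightarrow> real) set measure"
  assumes mu: "invariant_prob n \<mu>"
begin

lemma mu_prob: "prob_space \<mu>" and mu_space: "space \<mu> = Xsp n" and mu_sets: "sets \<mu> = sets (Xborel n)"
  using mu by (simp_all add: invariant_prob_def)

lemma mu_invariant:
  assumes "h \<in> SLR n" "E \<in> sets \<mu>"
  shows "{x \<in> Xsp n. xact n x h \<in> E} \<in> sets \<mu>"
    "measure \<mu> {x \<in> Xsp n. xact n x h \<in> E} = measure \<mu> E"
proof -
  let ?P = "{x \<in> Xsp n. xact n x h \<in> E}"
  have "?P = (\<lambda>x. xact n x h) -` E \<inter> space (Xborel n)" by auto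
  then show P: "?P \<in> sets \<mu>"
    using measurable_sets[OF xact_measurable[OF assms(1)], of E] assms(2) by (simp add: mu_sets)
  have "E \<subseteq> Xsp n" using sets.sets_into_space[OF assms(2)] by (simp add: mu_space)
  then have "E \<subseteq> (\<lambda>x. xact n x h) ` ?P"
    using assms(1) by (intro subsetI, rule_tac x = "xact n x (minv n h)" in image_eqI) (auto simp: minv)
  then have "(\<lambda>x. xact n x h) ` ?P = E" by blast
  moreover have "measure \<mu> ((\<lambda>x. xact n x h) ` ?P) = measure \<mu> ?P"
    using mu assms(1) P by (simp only: invariant_prob_def)
  ultimately show "measure \<mu> ?P = measure \<mu> E" by simp
qed

text \<open>Averaging over \<open>t\<close> with Fubini: by invariance all slices of
  \<open>{(t, x). lmin (x h\<^sub>t) \<in> S}\<close> at fixed \<open>t\<close> have the same measure, while those at fixed \<open>x\<close>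
  are null because the lattice is countable.\<close>

lemma lmin_null:
  assumes A: "open A" and q: "continuous_on A q" and nonneg: "\<And>v. v \<in> A \<Longrightarrow> 0 \<le> q v"
    and h: "continuous_on UNIV h" "\<And>t :: real. h t \<in> SLR n"
    and bdd: "\<And>c. \<exists>M. \<forall>v\<in>vecs n. v \<in> A \<longrightarrow> q v \<le> c \<longrightarrow> l1 n v \<le> M"
    and S: "S \<in> sets borel" "\<infinity> \<notin> S"
    and null: "\<And>v. v \<in> vecs n \<Longrightarrow> v \<noteq> (\<lambda>_. 0) \<Longrightarrow>
      \<exists>N\<in>null_sets lborel. {t. vmul n v (h t) \<in> A \<and> ennreal (q (vmul n v (h t))) \<in> S} \<subseteq> N"
  shows "{x \<in> Xsp n. lmin n A q x \<in> S} \<in> null_sets \<mu>"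
proof -
  interpret prob_space \<mu> by (rule mu_prob)
  interpret P: pair_sigma_finite "lborel :: real measure" \<mu> ..
  define E where "E = {x \<in> Xsp n. lmin n A q x \<in> S}"
  have "E = lmin n A q -` S \<inter> space (Xborel n)" by (auto simp: E_def)
  then have E: "E \<in> sets \<mu>"
    using measurable_sets[OF lmin_measurable[OF A q nonneg] S(1)] by (simp add: mu_sets)
  define D where "D = {p \<in> UNIV \<times> Xsp n. lmin n A q (xact n (snd p) (h (fst p))) \<in> S}"
  have sets_eq: "sets (lborel \<Otimes>\<^sub>M \<mu>) = sets (borel \<Otimes>\<^sub>M Xborel n)"
    by (rule sets_pair_measure_cong) (simp_all add: mu_sets)
  have "D = (\<lambda>p. lmin n A q (xact n (snd p) (h (fst p)))) -` S \<inter> space (borel \<Otimes>\<^sub>M Xborel n)"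
    by (auto simp: D_def space_pair_measure)
  then have D: "D \<in> sets (lborel \<Otimes>\<^sub>M \<mu>)"
    using measurable_sets[OF lmin_measurable_joint[OF A q nonneg h] S(1)] unfolding sets_eq by simp
  have slice_x: "emeasure lborel ((\<lambda>t. (t, x)) -` D) = 0" if x: "x \<in> space \<mu>" for x
  proof -
    have xX: "x \<in> Xsp n" using x by (simp add: mu_space)
    define L where "L = latt n x - {\<lambda>_. 0}"
    have L: "v \<in> vecs n" "v \<noteq> (\<lambda>_. 0)" if "v \<in> L" for v using that latt_vecs by (auto simp: L_def)
    have "\<forall>v\<in>L. \<exists>N. N \<in> null_sets lborel \<and>
        {t. vmul n v (h t) \<in> A \<and> ennreal (q (vmul n v (h t))) \<in> S} \<subseteq> N"
      using null[OF L] by (simp only: Bex_def) blast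
    from bchoice[OF this] obtain NN where NN: "\<And>v. v \<in> L \<Longrightarrow> NN v \<in> null_sets lborel"
      "\<And>v. v \<in> L \<Longrightarrow> {t. vmul n v (h t) \<in> A \<and> ennreal (q (vmul n v (h t))) \<in> S} \<subseteq> NN v"
      by blast
    have "countable L" using countable_latt[OF xX] by (simp add: L_def)
    then have N: "(\<Union>v\<in>L. NN v) \<in> null_sets lborel" using NN(1) by (intro null_sets_UN')
    have "(\<lambda>t. (t, x)) -` D \<subseteq> (\<Union>v\<in>L. NN v)"
    proof
      fix t assume "t \<in> (\<lambda>t. (t, x)) -` D"
      then have t: "lmin n A q (xact n x (h t)) \<in> S" by (simp add: D_def)
      \<comment> \<open>Excluding infinity from \<open>S\<close> guarantees that the minimum is
        attained, by a vector that comes from one in \<open>L\<close>.\<close>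
      then have "lmin n A q (xact n x (h t)) < \<infinity>" using S(2) by (metis less_top infinity_ennreal_def)
      from lmin_attained[OF xact_Xsp[OF xX h(2)] this nonneg bdd] obtain w
        where w: "w \<in> latt n (xact n x (h t))" "w \<noteq> (\<lambda>_. 0)" "w \<in> A"
          "lmin n A q (xact n x (h t)) = ennreal (q w)" by blast
      from w(1) obtain v where v: "v \<in> latt n x" "w = vmul n v (h t)"
        unfolding latt_xact[OF xX h(2)] by blast
      with w(2) have "v \<in> L" by (auto simp: L_def)
      then show "t \<in> (\<Union>v\<in>L. NN v)" using NN(2)[of v] v w t by auto
    qed
    then have "emeasure lborel ((\<lambda>t. (t, x)) -` D) \<le> emeasure lborel (\<Union>v\<in>L. NN v)"
      using N by (intro emeasure_mono) auto
    then show ?thesis using N by (simp add: null_sets_def)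
  qed
  have "emeasure (lborel \<Otimes>\<^sub>M \<mu>) D = (\<integral>\<^sup>+x. emeasure lborel ((\<lambda>t. (t, x)) -` D) \<partial>\<mu>)"
    by (rule P.emeasure_pair_measure_alt2[OF D])
  also have "\<dots> = (\<integral>\<^sup>+x. 0 \<partial>\<mu>)" by (rule nn_integral_cong) (rule slice_x)
  finally have "emeasure (lborel \<Otimes>\<^sub>M \<mu>) D = 0" by simp
  moreover have "emeasure (lborel \<Otimes>\<^sub>M \<mu>) D = (\<integral>\<^sup>+t. emeasure \<mu> (Pair t -` D) \<partial>lborel)"
    by (rule emeasure_pair_measure_alt[OF D])
  moreover have "emeasure \<mu> (Pair t -` D) = emeasure \<mu> E" for t
  proof -
    have "Pair t -` D = {x \<in> Xsp n. xact n x (h t) \<in> E}" using h(2) by (auto simp: D_def E_def)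
    then show ?thesis using mu_invariant(2)[OF h(2) E, of t] by (simp add: emeasure_eq_measure)
  qed
  ultimately have "(\<integral>\<^sup>+t. emeasure \<mu> E \<partial>(lborel :: real measure)) = 0" by simp
  \<comment> \<open>The integrand is constant and the line has infinite measure.\<close>
  then have "emeasure \<mu> E = 0" by simp
  then show ?thesis using E by (simp add: E_def null_sets_def)
qed

text \<open>The shear adding t times coordinate j to the last coordinate sends a vector with nonzero
  coordinate j into the hyperplane for exactly one t. A nonzero vector of the hyperplane has such a
  j below n - 1.\<close>

lemma last_coordinate_null:
  "\<exists>N\<in>null_sets \<mu>. {x \<in> Xsp n. \<exists>v\<in>latt n x. v \<noteq> (\<lambda>_. 0) \<and> v (n - 1) = 0} \<subseteq> N"
proof -
  \<comment> \<open>The \<open>l1\<close> bound supplies the boundedness demanded by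
    \<open>lmin_null\<close>, since \<open>q\<close> controls one coordinate only; countably many
    pairs (j, M) cover everything.\<close>
  define A where "A = (\<lambda>j M. {v :: nat \<Rightarrow> real. v j \<noteq> 0 \<and> l1 n v < real M})"
  define q where "q = (\<lambda>v :: nat \<Rightarrow> real. \<bar>v (n - 1)\<bar>)"
  define N where "N = (\<lambda>j M. {x \<in> Xsp n. lmin n (A j M) q x \<in> {0}})"
  have null: "N j M \<in> null_sets \<mu>" if j: "j < n - 1" for j M
    unfolding N_def
  proof (rule lmin_null)
    define h where "h = (\<lambda>(t::real) i l. if i = j \<and> l = n - 1 then t else idm n i l)"
    show "open (A j M)" unfolding A_def
      by (intro open_Collect_conj open_Collect_neq open_Collect_less continuous_coordinate continuous_l1
          continuous_on_const continuous_on_id)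
    show "continuous_on (A j M) q" unfolding q_def
      by (intro continuous_on_rabs continuous_coordinate)
    show "continuous_on UNIV h"
    proof (intro continuous_on_coordinatewise_then_product)
      fix i l show "continuous_on UNIV (\<lambda>t. h t i l)"
        by (cases "i = j \<and> l = n - 1") (auto simp: h_def continuous_on_id)
    qed
    show "h t \<in> SLR n" for t
    proof (rule SLR_upper_triangular)
      show "(\<Prod>i<n. h t i i) = 1"
        using j by (intro prod.neutral) (auto simp: h_def idm_def)
    qed (use j in \<open>auto simp: h_def mats_def idm_def\<close>)
    show "\<exists>K. \<forall>v\<in>vecs n. v \<in> A j M \<longrightarrow> q v \<le> c \<longrightarrow> l1 n v \<le> K" for c
      by (rule exI[of _ "real M"]) (auto simp: A_def)
    fix v :: "nat \<Rightarrow> real" assume v: "v \<in> vecs n" "v \<noteq> (\<lambda>_. 0)"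
    have hj: "vmul n v (h t) j = v j" for t
    proof -
      have "vmul n v (h t) j = vmul n v (idm n) j"
        unfolding vmul_def using j by (intro if_cong sum.cong) (auto simp: h_def)
      then show ?thesis using v by simp
    qed
    have hn: "vmul n v (h t) (n - 1) = v (n - 1) + t * v j" for t
    proof -
      have "h t = (\<lambda>i l. idm n i l - (if i = j \<and> l = n - 1 then - t else 0))"
        using j by (intro ext) (auto simp: h_def idm_def)
      then have "vmul n v (h t) (n - 1) = v (n - 1) - vmul n v (\<lambda>i l. if i = j \<and> l = n - 1 then - t else 0) (n - 1)"
        using v by (simp only: vmul_diff_right vmul_idm)
      also have "vmul n v (\<lambda>i l. if i = j \<and> l = n - 1 then - t else 0) (n - 1)
          = (\<Sum>i<n. v i * (if i = j then - t else 0))"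
        unfolding vmul_def using j by simp
      also have "\<dots> = (\<Sum>i<n. if i = j then v j * - t else 0)" by (rule sum.cong) auto
      also have "\<dots> = - (t * v j)" using j by simp
      finally show ?thesis by simp
    qed
    show "\<exists>N\<in>null_sets lborel. {t. vmul n v (h t) \<in> A j M \<and> ennreal (q (vmul n v (h t))) \<in> {0}} \<subseteq> N"
    proof (rule bexI)
      show "{t. vmul n v (h t) \<in> A j M \<and> ennreal (q (vmul n v (h t))) \<in> {0}} \<subseteq> {- v (n - 1) / v j}"
        using hn by (auto simp: A_def q_def hj ennreal_eq_0_iff field_simps)
      show "{- v (n - 1) / v j} \<in> null_sets lborel" by (simp add: null_sets_def)
    qed
  qed (auto simp: q_def)
  have "(\<Union>j\<in>{..<n-1}. \<Union>M. N j M) \<in> null_sets \<mu>"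
    using null by (intro null_sets_UN' null_sets_UN) auto
  moreover have "{x \<in> Xsp n. \<exists>v\<in>latt n x. v \<noteq> (\<lambda>_. 0) \<and> v (n - 1) = 0} \<subseteq> (\<Union>j\<in>{..<n-1}. \<Union>M. N j M)"
  proof clarify
    fix x v assume v: "x \<in> Xsp n" "v \<in> latt n x" "v \<noteq> (\<lambda>_. 0)" "v (n - 1) = 0"
    then obtain j where j: "v j \<noteq> 0" by blast
    have "j < n" using j latt_vecs[OF v(2)] unfolding vecs_def by (metis (mono_tags) linorder_not_le mem_Collect_eq)
    moreover have "j \<noteq> n - 1" using j v(4) by blast
    ultimately have jn: "j < n - 1" by linarith
    obtain M where M: "l1 n v < real M" using reals_Archimedean2 by blast
    have "lmin n (A j M) q x \<le> ennreal (q v)" unfolding lmin_def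
      by (rule INF_lower) (use v j M in \<open>simp add: A_def\<close>)
    then have "x \<in> N j M" using v by (simp add: N_def q_def)
    then show "x \<in> (\<Union>j\<in>{..<n-1}. \<Union>M. N j M)" using jn by blast
  qed
  ultimately show ?thesis by blast
qed

end

text \<open>Meant for functions outside \<open>vecs n\<close>, which multiplication by the identity
  truncates without changing \<open>l1 n\<close>.\<close>

lemma l1_vmul_idm: "l1 n (vmul n v (idm n)) = l1 n v"
proof -
  have "(\<Sum>i<n. v i * idm n i j) = (\<Sum>i<n. if i = j then v i else 0)" for j
    by (intro sum.cong) (auto simp: idm_def)
  then have "vmul n v (idm n) j = v j" if "j < n" for j using that by (simp add: vmul_def)
  then show ?thesis by (simp add: l1_def)
qed

lemma yfst_vecs [simp]: "yfst k v \<in> vecs k"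
  by (simp add: yfst_def vecs_def)

lemma l1_yfst: "k \<le> n \<Longrightarrow> l1 k (yfst k v) \<le> l1 n v"
  unfolding l1_def by (rule order_trans[OF eq_refl sum_mono2[of "{..<n}" "{..<k}"]]) (auto simp: yfst_def)

subsection \<open>The setting of the theorem\<close>

locale flow_setting =
  fixes k m :: nat and g0 :: "nat \<Rightarrow> nat \<Rightarrow> real" and Nk Nn :: "(nat \<Rightarrow> real) \<Rightarrow> real"
  assumes k1: "k \<ge> 1" and Nk: "is_norm_on k Nk" and Nn: "is_norm_on (k + m + 1) Nn"
    and g0: "g0 \<in> SLR (k + m + 1)"
begin

definition n :: nat where "n = k + m + 1"

lemma n_pos [simp]: "0 < n" and k_less_n [simp]: "k < n" and k_le_n [simp]: "k \<le> n"
  and n_minus_1: "n - 1 = k + m" and last_less_n [simp]: "k + m < n" and n_minus_k: "n - k = m + 1"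
  and k_pos [simp]: "0 < k"
  using k1 by (simp_all add: n_def)

lemma Nn': "is_norm_on n Nn" and g0' [simp]: "g0 \<in> SLR n"
  using Nn g0 by (simp_all add: n_def)

text \<open>The norm whose unit ball is the given ball translated by \<open>g0\<close>. It looks at
  the first n coordinates only, so its estimates hold for arbitrary functions.\<close>

definition Ng :: "(nat \<Rightarrow> real) \<Rightarrow> real" where
  "Ng v = Nn (vmul n v (minv n g0))"

text \<open>The quotient seminorm whose open unit ball is the preimage of the projected ball; the first
  \<open>k\<close> coordinates are free because \<open>vecs k \<subseteq> vecs n\<close>.\<close>

definition pq :: "(nat \<Rightarrow> real) \<Rightarrow> real" where
  "pq v = (INF u\<in>vecs k. Ng (\<lambda>i. v i + u i))"

definition Nh :: "(nat \<Rightarrow> real) \<Rightarrow> real" where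
  "Nh v = Nk (yfst k v)"

lemma Ng_ge0: "0 \<le> Ng v"
  unfolding Ng_def by (rule norm_ge0[OF Nn']) simp

lemma Ng_scale: "Ng (\<lambda>i. c * v i) = \<bar>c\<bar> * Ng v"
  unfolding Ng_def vmul_scale by (rule norm_scale[OF Nn']) simp

lemma Ng_add: "Ng (\<lambda>i. v i + w i) \<le> Ng v + Ng w"
  unfolding Ng_def vmul_add by (rule norm_add[OF Nn']) simp_all

lemma Ng_upper: "\<exists>C>0. \<forall>v. Ng v \<le> C * l1 n v"
proof -
  obtain C where C: "C > 0" "\<And>x. x \<in> vecs n \<Longrightarrow> Nn x \<le> C * l1 n x" using norm_upper[OF Nn'] by blast
  have "Ng v \<le> (C * (mnorm n (minv n g0) + 1)) * l1 n v" for v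
  proof -
    have "Ng v \<le> C * l1 n (vmul n v (minv n g0))" unfolding Ng_def by (rule C(2)) simp
    also have "\<dots> \<le> C * ((mnorm n (minv n g0) + 1) * l1 n v)"
      using C(1) l1_vmul[of n v "minv n g0"] by (intro mult_left_mono) (auto simp: algebra_simps intro: order_trans)
    finally show ?thesis by simp
  qed
  moreover have "C * (mnorm n (minv n g0) + 1) > 0" using C(1) mnorm_nonneg[of n "minv n g0"]
    by (intro mult_pos_pos) linarith+
  ultimately show ?thesis by blast
qed

lemma Ng_lower: "\<exists>c>0. \<forall>v. c * l1 n v \<le> Ng v"
proof -
  obtain c where c: "c > 0" "\<And>x. x \<in> vecs n \<Longrightarrow> c * l1 n x \<le> Nn x" using norm_lower[OF Nn'] by blast
  define R where "R = mnorm n g0 + 1"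
  have R: "R > 0" unfolding R_def using mnorm_nonneg[of n g0] by linarith
  have "c / R * l1 n v \<le> Ng v" for v
  proof -
    have "l1 n v = l1 n (vmul n (vmul n v (minv n g0)) g0)"
      by (simp add: vmul_mmul minv l1_vmul_idm)
    also have "\<dots> \<le> mnorm n g0 * l1 n (vmul n v (minv n g0))" by (rule l1_vmul)
    also have "\<dots> \<le> R * l1 n (vmul n v (minv n g0))" by (intro mult_right_mono) (auto simp: R_def)
    finally have "c / R * l1 n v \<le> c / R * (R * l1 n (vmul n v (minv n g0)))"
      using c R by (intro mult_left_mono) auto
    also have "\<dots> = c * l1 n (vmul n v (minv n g0))" using R by simp
    also have "\<dots> \<le> Ng v" unfolding Ng_def by (rule c(2)) simp
    finally show ?thesis .
  qed
  moreover have "c / R > 0" using c R by simp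
  ultimately show ?thesis by blast
qed

definition "Cg = (SOME C. C > 0 \<and> (\<forall>v. Ng v \<le> C * l1 n v))"
definition "cg = (SOME c. c > 0 \<and> (\<forall>v. c * l1 n v \<le> Ng v))"

lemma Cg: "Cg > 0" "Ng v \<le> Cg * l1 n v"
  using someI_ex[OF Ng_upper] by (auto simp: Cg_def)

lemma cg: "cg > 0" "cg * l1 n v \<le> Ng v"
  using someI_ex[OF Ng_lower] by (auto simp: cg_def)

lemma Nh_ge0: "0 \<le> Nh v"
  unfolding Nh_def by (rule norm_ge0[OF Nk]) simp

lemma yfst_scale: "yfst k (\<lambda>i. c * v i) = (\<lambda>i. c * yfst k v i)"
  and yfst_add: "yfst k (\<lambda>i. v i + w i) = (\<lambda>i. yfst k v i + yfst k w i)"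
  by (auto simp: yfst_def)

lemma Nh_scale: "Nh (\<lambda>i. c * v i) = \<bar>c\<bar> * Nh v"
  unfolding Nh_def yfst_scale by (rule norm_scale[OF Nk]) simp

lemma Nh_add: "Nh (\<lambda>i. v i + w i) \<le> Nh v + Nh w"
  unfolding Nh_def yfst_add by (rule norm_add[OF Nk]) simp_all

definition "Ch = (SOME C. C > 0 \<and> (\<forall>x\<in>vecs k. Nk x \<le> C * l1 k x))"
definition "ch = (SOME c. c > 0 \<and> (\<forall>x\<in>vecs k. c * l1 k x \<le> Nk x))"

lemma Ch: "Ch > 0" "Nh v \<le> Ch * l1 n v"
proof -
  have *: "Ch > 0 \<and> (\<forall>x\<in>vecs k. Nk x \<le> Ch * l1 k x)" unfolding Ch_def by (rule someI_ex[OF norm_upper[OF Nk]])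
  then show "Ch > 0" by blast
  then have "Ch * l1 k (yfst k v) \<le> Ch * l1 n v" by (intro mult_left_mono l1_yfst) auto
  with * show "Nh v \<le> Ch * l1 n v" unfolding Nh_def by (meson order_trans yfst_vecs)
qed

lemma l1_yfst_self: "l1 k (yfst k v) = l1 k v"
  by (simp add: l1_def yfst_def)

lemma ch: "ch > 0" "ch * l1 k v \<le> Nh v"
proof -
  have *: "ch > 0 \<and> (\<forall>x\<in>vecs k. ch * l1 k x \<le> Nk x)" unfolding ch_def by (rule someI_ex[OF norm_lower[OF Nk]])
  then show "ch > 0" by blast
  from * show "ch * l1 k v \<le> Nh v" unfolding Nh_def using l1_yfst_self by (metis yfst_vecs)
qed

lemma Nh_lipschitz: "Nh v \<le> Nh w + Ch * l1 n (\<lambda>i. v i - w i)"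
  using Nh_add[of w "\<lambda>i. v i - w i"] Ch(2)[of "\<lambda>i. v i - w i"] by simp

lemma Ng_lipschitz: "Ng v \<le> Ng w + Cg * l1 n (\<lambda>i. v i - w i)"
  using Ng_add[of w "\<lambda>i. v i - w i"] Cg(2)[of "\<lambda>i. v i - w i"] by simp

lemma pq_bdd: "bdd_below ((\<lambda>u. Ng (\<lambda>i. v i + u i)) ` vecs k)"
  using Ng_ge0 by (intro bdd_belowI2[of _ 0])

lemma vecs_ne: "vecs k \<noteq> {}"
  using vecs_zero by blast

lemma pq_less_iff: "pq v < r \<longleftrightarrow> (\<exists>u\<in>vecs k. Ng (\<lambda>i. v i + u i) < r)"
  unfolding pq_def by (rule cINF_less_iff[OF vecs_ne pq_bdd])

lemma pq_le: "u \<in> vecs k \<Longrightarrow> pq v \<le> Ng (\<lambda>i. v i + u i)"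
  unfolding pq_def by (rule cINF_lower[OF pq_bdd])

lemma pq_greatest: "(\<And>u. u \<in> vecs k \<Longrightarrow> r \<le> Ng (\<lambda>i. v i + u i)) \<Longrightarrow> r \<le> pq v"
  unfolding pq_def by (rule cINF_greatest[OF vecs_ne])

lemma pq_ge0: "0 \<le> pq v"
  by (rule pq_greatest) (rule Ng_ge0)

lemma pq_scale_le: "c \<noteq> 0 \<Longrightarrow> pq (\<lambda>i. c * v i) \<le> \<bar>c\<bar> * pq v"
proof -
  assume c: "c \<noteq> 0"
  have "pq (\<lambda>i. c * v i) / \<bar>c\<bar> \<le> pq v"
  proof (rule pq_greatest)
    fix u assume u: "u \<in> vecs k"
    have "pq (\<lambda>i. c * v i) \<le> Ng (\<lambda>i. c * v i + c * u i)" using u by (intro pq_le vecs_closed_scale)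
    also have "\<dots> = \<bar>c\<bar> * Ng (\<lambda>i. v i + u i)" using Ng_scale[of c "\<lambda>i. v i + u i"] by (simp add: distrib_left)
    finally show "pq (\<lambda>i. c * v i) / \<bar>c\<bar> \<le> Ng (\<lambda>i. v i + u i)" using c by (simp add: field_simps)
  qed
  then show ?thesis using c by (simp add: field_simps)
qed

lemma pq_scale: "c \<noteq> 0 \<Longrightarrow> pq (\<lambda>i. c * v i) = \<bar>c\<bar> * pq v"
proof (rule antisym)
  assume c: "c \<noteq> 0"
  have "pq v \<le> \<bar>inverse c\<bar> * pq (\<lambda>i. c * v i)"
    using pq_scale_le[of "inverse c" "\<lambda>i. c * v i"] c by (simp add: mult.assoc[symmetric])
  then show "\<bar>c\<bar> * pq v \<le> pq (\<lambda>i. c * v i)" using c by (simp add: field_simps abs_inverse)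
qed (rule pq_scale_le)

lemma pq_shift_le: "u \<in> vecs k \<Longrightarrow> pq (\<lambda>i. v i + u i) \<le> pq v"
proof (rule pq_greatest)
  fix u' assume "u \<in> vecs k" "u' \<in> vecs k"
  then have "pq (\<lambda>i. v i + u i) \<le> Ng (\<lambda>i. (v i + u i) + (u' i - u i))" by (intro pq_le vecs_closed_diff)
  then show "pq (\<lambda>i. v i + u i) \<le> Ng (\<lambda>i. v i + u' i)" by simp
qed

lemma pq_shift: "u \<in> vecs k \<Longrightarrow> pq (\<lambda>i. v i + u i) = pq v"
proof (rule antisym)
  assume "u \<in> vecs k"
  then have "(\<lambda>i. - u i) \<in> vecs k" by (simp add: vecs_def)
  from pq_shift_le[OF this, of "\<lambda>i. v i + u i"] show "pq v \<le> pq (\<lambda>i. v i + u i)" by simp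
qed (rule pq_shift_le)

text \<open>Shifts by \<open>vecs k\<close> leave the coordinates from \<open>k\<close> on alone, so
  \<open>Ng\<close> of every shifted vector dominates them.\<close>

lemma pq_lower:
  assumes "k \<le> i" "i < n"
  shows "cg * \<bar>v i\<bar> \<le> pq v"
proof (rule pq_greatest)
  fix u assume "u \<in> vecs k"
  then have "\<bar>v i\<bar> = \<bar>v i + u i\<bar>" using assms by (simp add: vecs_def)
  also have "\<dots> \<le> l1 n (\<lambda>i. v i + u i)" using abs_le_l1[of i n "\<lambda>i. v i + u i"] assms by simp
  finally have "cg * \<bar>v i\<bar> \<le> cg * l1 n (\<lambda>i. v i + u i)" using cg(1) by (intro mult_left_mono) auto
  also have "\<dots> \<le> Ng (\<lambda>i. v i + u i)" by (rule cg)
  finally show "cg * \<bar>v i\<bar> \<le> Ng (\<lambda>i. v i + u i)" .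
qed

lemma pq_lipschitz: "pq v \<le> pq w + Cg * l1 n (\<lambda>i. v i - w i)"
proof -
  have "pq v - Cg * l1 n (\<lambda>i. v i - w i) \<le> pq w"
  proof (rule pq_greatest)
    fix u assume u: "u \<in> vecs k"
    have "pq v \<le> Ng (\<lambda>i. v i + u i)" by (rule pq_le[OF u])
    also have "\<dots> \<le> Ng (\<lambda>i. w i + u i) + Cg * l1 n (\<lambda>i. v i - w i)"
      using Ng_lipschitz[of "\<lambda>i. v i + u i" "\<lambda>i. w i + u i"] by simp
    finally show "pq v - Cg * l1 n (\<lambda>i. v i - w i) \<le> Ng (\<lambda>i. w i + u i)" by simp
  qed
  then show ?thesis by simp
qed

lemma continuous_on_lipschitz_l1:
  assumes "\<And>v w. f v \<le> f w + C * l1 n (\<lambda>i. v i - w i)"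
  shows "continuous_on S (f :: (nat \<Rightarrow> real) \<Rightarrow> real)"
  unfolding continuous_on_def
proof (intro ballI)
  fix x :: "nat \<Rightarrow> real" assume "x \<in> S"
  have "continuous_on UNIV (\<lambda>y. C * l1 n (\<lambda>i. y i - x i))"
    by (intro continuous_on_mult continuous_l1 continuous_on_const continuous_on_coordinatewise_then_product
        continuous_on_diff continuous_coordinate)
  then have "((\<lambda>y. C * l1 n (\<lambda>i. y i - x i)) \<longlongrightarrow> C * l1 n (\<lambda>i. x i - x i)) (at x within S)"
    by (meson UNIV_I continuous_on_def tendsto_within_subset subset_UNIV)
  then have lim: "((\<lambda>y. C * l1 n (\<lambda>i. y i - x i)) \<longlongrightarrow> 0) (at x within S)" by (simp add: l1_def)
  have "\<forall>\<^sub>F y in at x within S. norm (f y - f x) \<le> C * l1 n (\<lambda>i. y i - x i)"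
  proof (rule always_eventually, rule allI)
    fix y
    show "norm (f y - f x) \<le> C * l1 n (\<lambda>i. y i - x i)"
      using assms[of y x] assms[of x y] by (simp add: l1_minus_commute[of n x y] abs_le_iff)
  qed
  from Lim_null_comparison[OF this lim] show "(f \<longlongrightarrow> f x) (at x within S)" by (simp add: LIM_zero_iff)
qed

lemma continuous_pq: "continuous_on S pq"
  by (rule continuous_on_lipschitz_l1[OF pq_lipschitz])

lemma continuous_Nh: "continuous_on S Nh"
  by (rule continuous_on_lipschitz_l1[OF Nh_lipschitz])

lemma continuous_Ng: "continuous_on S Ng"
  by (rule continuous_on_lipschitz_l1[OF Ng_lipschitz])

text \<open>Attainment is what makes \<open>pq v \<le> 1\<close> describe the projection of the
  closed ball itself and not just of its neighbourhoods.\<close>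

lemma pq_attained: "\<exists>u\<in>vecs k. pq v = Ng (\<lambda>i. v i + u i)"
proof -
  \<comment> \<open>Beyond this size, v + u has larger \<open>Ng\<close> than v, that is, than the
    choice u = 0; the infimum may be taken over a compact set.\<close>
  define M where "M = l1 n v + Ng v / cg"
  define K where "K = {u \<in> vecs k. l1 k u \<le> M}"
  have K0: "(\<lambda>_. 0) \<in> K" using cg(1) Ng_ge0[of v] l1_nonneg[of n v] by (simp add: K_def l1_def[of k] M_def)
  have "continuous_on K (\<lambda>u. Ng (\<lambda>i. v i + u i))"
  proof (rule continuous_on_compose2[OF continuous_Ng[of UNIV]])
    show "continuous_on K (\<lambda>u i. v i + u i)"
      by (intro continuous_on_coordinatewise_then_product continuous_on_add continuous_on_const continuous_coordinate)
  qed simp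
  moreover have "compact K" unfolding K_def by (rule compact_l1_ball)
  ultimately obtain u0 where u0: "u0 \<in> K" "\<And>u. u \<in> K \<Longrightarrow> Ng (\<lambda>i. v i + u0 i) \<le> Ng (\<lambda>i. v i + u i)"
    using continuous_attains_inf[of K "\<lambda>u. Ng (\<lambda>i. v i + u i)"] K0 by blast
  have "Ng (\<lambda>i. v i + u0 i) \<le> Ng (\<lambda>i. v i + u i)" if u: "u \<in> vecs k" for u
  proof (cases "u \<in> K")
    case False
    then have "M < l1 k u" using u by (simp add: K_def)
    also have "\<dots> \<le> l1 n u" unfolding l1_def by (intro sum_mono2) auto
    also have "\<dots> \<le> l1 n (\<lambda>i. v i + u i) + l1 n v"
      using l1_triangle[of n "\<lambda>i. v i + u i" "\<lambda>i. - v i"] by (simp add: l1_def[of n "\<lambda>i. - v i"] l1_def[of n v])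
    finally have "Ng v / cg < l1 n (\<lambda>i. v i + u i)" by (simp add: M_def)
    then have "Ng v < cg * l1 n (\<lambda>i. v i + u i)" using cg(1) by (simp add: field_simps)
    also have "\<dots> \<le> Ng (\<lambda>i. v i + u i)" by (rule cg)
    finally show ?thesis using u0(2)[OF K0] by simp
  qed (rule u0)
  then have "Ng (\<lambda>i. v i + u0 i) \<le> pq v" by (rule pq_greatest)
  moreover have "u0 \<in> vecs k" using u0 by (simp add: K_def)
  moreover from pq_le[OF this] have "pq v \<le> Ng (\<lambda>i. v i + u0 i)" .
  ultimately show ?thesis by (metis antisym)
qed

text \<open>\<open>Nh\<close> controls the first \<open>k\<close> coordinates and \<open>pq\<close>
  each of the other m + 1. All cone regions below are bounded for this reason.\<close>

lemma l1_bound: "l1 n v \<le> Nh v / ch + real (m + 1) * (pq v / cg)"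
proof -
  have "l1 n v = l1 k v + (\<Sum>i=k..<n. \<bar>v i\<bar>)"
    unfolding l1_def lessThan_atLeast0 by (simp add: sum.atLeastLessThan_concat)
  moreover have "l1 k v \<le> Nh v / ch" using ch(1) ch(2)[of v] by (simp add: field_simps)
  moreover have "(\<Sum>i=k..<n. \<bar>v i\<bar>) \<le> (\<Sum>i=k..<n. pq v / cg)"
    using pq_lower[of _ v] cg(1) by (intro sum_mono) (simp add: field_simps)
  moreover have "(\<Sum>i=k..<n. pq v / cg) = real (m + 1) * (pq v / cg)"
    by (simp only: sum_constant card_atLeastLessThan n_minus_k)
  ultimately show ?thesis by linarith
qed

lemma pq_pos: "v (k + m) \<noteq> 0 \<Longrightarrow> 0 < pq v"
  using pq_lower[of "k + m" v] cg(1) by (smt (verit) last_less_n le_add1 mult_pos_pos zero_less_abs_iff)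

subsection \<open>The diagonal flow\<close>

abbreviation "Phi \<equiv> Phimat k m"

lemma Phi_SLR [simp]: "Phi t \<in> SLR n"
proof (rule SLR_lower_triangular)
  show "Phi t \<in> mats n" by (auto simp: Phimat_def mats_def n_def)
  have "(\<Prod>i<n. Phi t i i) = (\<Prod>i=0..<k. Phi t i i) * (\<Prod>i=k..<n. Phi t i i)"
    unfolding lessThan_atLeast0 by (simp add: prod.atLeastLessThan_concat)
  also have "(\<Prod>i=0..<k. Phi t i i) = (\<Prod>i=0..<k. exp (real (m + 1) * t))"
    by (rule prod.cong) (auto simp: Phimat_def)
  also have "(\<Prod>i=k..<n. Phi t i i) = (\<Prod>i=k..<n. exp (- real k * t))"
    by (rule prod.cong) (auto simp: Phimat_def n_def)
  also have "(\<Prod>i=0..<k. exp (real (m + 1) * t)) * (\<Prod>i=k..<n. exp (- real k * t))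
      = exp (real k * (real (m + 1) * t)) * exp (real (m + 1) * (- real k * t))"
    by (simp only: prod_constant card_atLeastLessThan n_minus_k exp_of_nat_mult diff_zero)
  also have "\<dots> = 1" by (simp add: exp_add[symmetric] algebra_simps)
  finally show "(\<Prod>i<n. Phi t i i) = 1" .
qed (auto simp: Phimat_def)

lemma vmul_Phi:
  "vmul n v (Phi t) = (\<lambda>i. if i < k then exp (real (m + 1) * t) * v i else if i < n then exp (- real k * t) * v i else 0)"
proof
  fix j
  have "(\<Sum>i<n. v i * Phi t i j) = (\<Sum>i<n. if i = j then v j * Phi t j j else 0)"
    by (intro sum.cong) (auto simp: Phimat_def)
  then have "(\<Sum>i<n. v i * Phi t i j) = v j * Phi t j j" if "j < n" using that by simp
  then show "vmul n v (Phi t) j = (if j < k then exp (real (m + 1) * t) * v j else if j < n then exp (- real k * t) * v j else 0)"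
    using k_less_n by (auto simp: vmul_def Phimat_def n_def simp del: k_less_n)
qed

lemma Phi_last: "vmul n v (Phi t) (k + m) = exp (- real k * t) * v (k + m)"
  by (simp add: vmul_Phi)

lemma Phi_Nh: "Nh (vmul n v (Phi t)) = exp (real (m + 1) * t) * Nh v"
proof -
  have "yfst k (vmul n v (Phi t)) = yfst k (\<lambda>i. exp (real (m + 1) * t) * v i)"
    by (rule ext) (simp add: yfst_def vmul_Phi)
  then have "Nh (vmul n v (Phi t)) = Nh (\<lambda>i. exp (real (m + 1) * t) * v i)" by (simp add: Nh_def)
  then show ?thesis by (simp only: Nh_scale abs_exp_cancel)
qed

text \<open>\<open>Phi\<close> differs from scaling by e^(-kt) only in the first \<open>k\<close>
  coordinates, which \<open>pq\<close> does not see.\<close>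

lemma Phi_pq: "v \<in> vecs n \<Longrightarrow> pq (vmul n v (Phi t)) = exp (- real k * t) * pq v"
proof -
  assume v: "v \<in> vecs n"
  define u where "u = (\<lambda>i. if i < k then (exp (real (m + 1) * t) - exp (- real k * t)) * v i else 0)"
  have u: "u \<in> vecs k" by (simp add: u_def vecs_def)
  have "vmul n v (Phi t) = (\<lambda>i. exp (- real k * t) * v i + u i)"
    using v by (intro ext) (simp add: vmul_Phi u_def vecs_def algebra_simps)
  then have "pq (vmul n v (Phi t)) = pq (\<lambda>i. exp (- real k * t) * v i)" using pq_shift[OF u] by simp
  then show ?thesis by (simp only: pq_scale[OF exp_not_eq_zero] abs_exp_cancel)
qed

lemma Phi_add: "mmul n (Phi s) (Phi t) = Phi (s + t)"
proof (intro ext)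
  fix i j
  have "(\<Sum>l<n. Phi s i l * Phi t l j) = (\<Sum>l<n. if l = i then Phi s i i * Phi t i j else 0)"
    by (intro sum.cong) (auto simp: Phimat_def)
  moreover have "(\<Sum>l<n. if l = i then Phi s i i * Phi t i j else 0) = Phi s i i * Phi t i j" if "i < n"
    using that by simp
  ultimately have sum: "(\<Sum>l<n. Phi s i l * Phi t l j) = Phi s i i * Phi t i j" if "i < n" using that by simp
  show "mmul n (Phi s) (Phi t) i j = Phi (s + t) i j"
  proof (cases "i < n \<and> j < n")
    case True
    then have "mmul n (Phi s) (Phi t) i j = Phi s i i * Phi t i j" using sum by (simp add: mmul_def)
    also have "\<dots> = Phi (s + t) i j" by (auto simp: Phimat_def exp_add[symmetric] algebra_simps)
    finally show ?thesis .
  next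
    case False
    then show ?thesis by (auto simp: mmul_def Phimat_def n_def)
  qed
qed

lemma Phi_0: "Phi 0 = idm n"
  by (intro ext) (auto simp: Phimat_def idm_def n_def)

lemma continuous_Phi: "continuous_on UNIV Phi"
proof (intro continuous_on_coordinatewise_then_product)
  fix i j
  consider "i < n \<and> i = j \<and> i < k" | "i < n \<and> i = j \<and> \<not> i < k" | "\<not> (i < n \<and> i = j)" by blast
  then show "continuous_on UNIV (\<lambda>t. Phi t i j)"
    by cases (auto simp: Phimat_def n_def intro!: continuous_intros)
qed

lemma real_n: "real n = real k + real (m + 1)"
  by (simp add: n_def)

end

subsection \<open>Densities and primitive vectors\<close>

text \<open>The preimage is the image of the positive part of \<open>A\<close> under an affine
  function of the logarithm, and differentiable maps of the line preserve negligible sets.\<close>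

lemma null_sets_exp_preimage:
  fixes A :: "real set"
  assumes A: "A \<in> null_sets lborel" and B: "B > 0" and c: "c \<noteq> 0"
  shows "{t. B * exp (c * t) \<in> A} \<in> null_sets lborel"
proof -
  let ?f = "\<lambda>a. (ln a - ln B) / c" and ?S = "A \<inter> {0<..}"
  have "negligible A" using A by (simp add: negligible_iff_null_sets null_sets_completionI)
  then have neg: "negligible ?S" by (rule negligible_subset) blast
  have diff: "?f differentiable_on ?S"
    unfolding differentiable_on_def
  proof
    fix a assume "a \<in> ?S"
    then have "((\<lambda>a. ln a - ln B) has_real_derivative (1 / a - 0)) (at a)"
      by (intro DERIV_diff DERIV_const DERIV_ln_divide) simp
    from DERIV_cdivide[OF this, of c]
    have "(\<lambda>a. (ln a - ln B) / c) differentiable (at a)"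
      unfolding real_differentiable_def by (rule exI)
    then show "?f differentiable (at a within ?S)" by (rule differentiable_at_withinI)
  qed
  have img: "negligible (?f ` ?S)"
    by (rule negligible_differentiable_image_negligible[OF _ neg diff]) simp
  have sub: "{t. B * exp (c * t) \<in> A} \<subseteq> ?f ` ?S"
  proof
    fix t assume "t \<in> {t. B * exp (c * t) \<in> A}"
    then have "B * exp (c * t) \<in> ?S" "?f (B * exp (c * t)) = t" using B c by (auto simp: ln_mult)
    then show "t \<in> ?f ` ?S" by (intro image_eqI[of t ?f "B * exp (c * t)"]) (simp_all only:)
  qed
  from negligible_subset[OF img sub] have "{t. B * exp (c * t) \<in> A} \<in> null_sets (completion lborel)"
    by (simp add: negligible_iff_null_sets)
  \<comment> \<open>Negligibility concerns the completed measure; Borel measurability brings the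
    result back to \<open>lborel\<close>.\<close>
  moreover have "{t. B * exp (c * t) \<in> A} \<in> sets lborel"
  proof -
    have "(\<lambda>t. B * exp (c * t)) \<in> borel_measurable borel" by measurable
    moreover have "A \<in> sets borel" using A by (simp add: null_sets_def)
    ultimately have "(\<lambda>t. B * exp (c * t)) -` A \<inter> space borel \<in> sets borel" by (rule measurable_sets)
    then show ?thesis by (simp add: vimage_def)
  qed
  ultimately show ?thesis by (simp add: null_sets_completion_iff)
qed

text \<open>Radon-Nikodym for the law of \<open>r\<close>, with a version that is finite and
  nonnegative everywhere.\<close>

lemma (in prob_space) ex_real_density:
  fixes r :: "'a \<Rightarrow> real"
  assumes r: "r \<in> borel_measurable M"
    and ac: "\<And>A. A \<in> null_sets lborel \<Longrightarrow> prob {x \<in> space M. r x \<in> A} = 0"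
  shows "\<exists>D. (\<forall>y. 0 \<le> D y) \<and> (\<forall>A\<in>sets borel. set_integrable lborel A D \<and>
    (LINT y:A|lborel. D y) = prob {x \<in> space M. r x \<in> A})"
proof -
  define \<nu> where "\<nu> = distr M borel r"
  interpret nu: prob_space \<nu> unfolding \<nu>_def by (rule prob_space_distr) (use r in simp)
  have nuA: "measure \<nu> A = prob {x \<in> space M. r x \<in> A}" if "A \<in> sets borel" for A
    using that r by (simp add: \<nu>_def measure_distr vimage_def Int_def conj_commute)
  have sets_nu: "sets \<nu> = sets lborel" by (simp add: \<nu>_def)
  have "absolutely_continuous lborel \<nu>"
    unfolding absolutely_continuous_def
  proof
    fix A :: "real set" assume A: "A \<in> null_sets lborel"
    then have "A \<in> sets borel" by auto
    then have "measure \<nu> A = 0" using nuA ac[OF A] by simp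
    then show "A \<in> null_sets \<nu>" using \<open>A \<in> sets borel\<close> sets_nu
      by (simp add: null_sets_def nu.emeasure_eq_measure)
  qed
  note ac' = this
  obtain D where D: "D \<in> borel_measurable lborel" "AE x in lborel. RN_deriv lborel \<nu> x = ennreal (D x)"
    "\<And>x. 0 \<le> D x"
    using sigma_finite_measure.real_RN_deriv[OF lborel.sigma_finite_measure_axioms nu.finite_measure_axioms ac' sets_nu] by blast
  have dens: "density lborel (\<lambda>x. ennreal (D x)) = \<nu>"
  proof -
    have "density lborel (\<lambda>x. ennreal (D x)) = density lborel (RN_deriv lborel \<nu>)"
      using D by (intro density_cong) auto
    also have "\<dots> = \<nu>" using sigma_finite_measure.density_RN_deriv[OF lborel.sigma_finite_measure_axioms ac' sets_nu] .
    finally show ?thesis .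
  qed
  have "set_integrable lborel A D \<and> (LINT y:A|lborel. D y) = prob {x \<in> space M. r x \<in> A}"
    if A: "A \<in> sets borel" for A
  proof -
    have "emeasure \<nu> A = (\<integral>\<^sup>+x. ennreal (D x) * indicator A x \<partial>lborel)"
      using A D(1) by (subst dens[symmetric], subst emeasure_density) auto
    also have "\<dots> = (\<integral>\<^sup>+x. ennreal (indicator A x * D x) \<partial>lborel)"
      by (rule nn_integral_cong) (simp split: split_indicator)
    finally have nn: "(\<integral>\<^sup>+x. ennreal (indicator A x * D x) \<partial>lborel) = ennreal (measure \<nu> A)"
      by (simp add: nu.emeasure_eq_measure)
    have meas: "(\<lambda>x. indicator A x * D x) \<in> borel_measurable lborel" using A D(1) by measurable
    have int: "integrable lborel (\<lambda>x. indicator A x * D x)"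
      using meas D(3) nn by (intro integrableI_nonneg) (auto simp: indicator_def)
    have "integral\<^sup>L lborel (\<lambda>x. indicator A x * D x) = enn2real (ennreal (measure \<nu> A))"
      unfolding nn[symmetric] using meas D(3) by (intro integral_eq_nn_integral) (auto simp: indicator_def)
    then show ?thesis using int nuA[OF A]
      by (simp add: set_integrable_def set_lebesgue_integral_def)
  qed
  then show ?thesis using D(3) by blast
qed

text \<open>Dividing by the largest integer that keeps \<open>z\<close> integral leaves a primitive
  vector; such divisors are bounded by any nonzero coordinate of \<open>z\<close>.\<close>

lemma prim_multiple_ex:
  assumes z: "z \<in> zvecs n" "z \<noteq> (\<lambda>_. 0)"
  shows "\<exists>c\<ge>1. \<exists>w\<in>prim n. z = (\<lambda>i. real_of_int c * w i)"
proof -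
  define K where "K = {c::int. c \<ge> 1 \<and> (\<lambda>i. z i / of_int c) \<in> zvecs n}"
  obtain i where i: "z i \<noteq> 0" using z(2) by blast
  have "K \<subseteq> {1..\<lceil>\<bar>z i\<bar>\<rceil>}"
  proof
    fix c assume c: "c \<in> K"
    then have "z i / of_int c \<in> \<int>" "z i / of_int c \<noteq> 0" using i by (auto simp: K_def zvecs_def)
    then have "1 \<le> \<bar>z i / of_int c\<bar>" by (rule Ints_nonzero_abs_ge1)
    then have "of_int c \<le> \<bar>z i\<bar>" using c by (simp add: K_def field_simps)
    then show "c \<in> {1..\<lceil>\<bar>z i\<bar>\<rceil>}" using c by (simp add: K_def) linarith
  qed
  then have fin: "finite K" by (rule finite_subset) simp
  moreover have "1 \<in> K" using z by (simp add: K_def)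
  ultimately have M: "Max K \<in> K" "\<And>c. c \<in> K \<Longrightarrow> c \<le> Max K" using Max_in by auto
  define w where "w = (\<lambda>i. z i / of_int (Max K))"
  have cpos: "Max K \<ge> 1" using M(1) by (simp add: K_def)
  have "w \<in> prim n" unfolding prim_def
  proof (intro CollectI conjI allI impI)
    show "w \<in> zvecs n" using M(1) by (simp add: K_def w_def)
    show "w \<noteq> (\<lambda>_. 0)" using i cpos by (auto simp: w_def fun_eq_iff)
    fix c :: int assume c: "c \<ge> 2"
    show "(\<lambda>i. w i / of_int c) \<notin> zvecs n"
    proof
      assume "(\<lambda>i. w i / of_int c) \<in> zvecs n"
      moreover have "2 * 1 \<le> c * Max K" using c cpos by (intro mult_mono) auto
      ultimately have "Max K * c \<in> K" by (simp add: K_def w_def mult.commute)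
      then have "Max K * c \<le> Max K" by (rule M(2))
      moreover have "Max K * 2 \<le> Max K * c" using c cpos by (intro mult_left_mono) auto
      ultimately show False using cpos by linarith
    qed
  qed
  moreover have "z = (\<lambda>i. real_of_int (Max K) * w i)" using cpos by (auto simp: w_def)
  ultimately show ?thesis using cpos by blast
qed

subsection \<open>The limiting events\<close>

context flow_setting
begin

definition "scone = {v :: nat \<Rightarrow> real. 0 < v (k + m) \<and> Nh v < v (k + m)}"

definition "E0 \<rho> = Ev n {v. Nh v < \<bar>v (k + m)\<bar> \<and> pq v < \<rho>}"

definition "E1 \<rho> = Ev n {v. Nh v \<le> \<bar>v (k + m)\<bar> \<and> pq v \<le> \<rho>}"

text \<open>Up to the diagonal flow, the event that the cone of the theorem contains a lattice
  point. It lies between \<open>E0\<close> and \<open>E1\<close> and, unlike \<open>E1\<close>,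
  excludes a vanishing last coordinate.\<close>

definition "Ec \<rho> = Ev n {v. 0 < v (k + m) \<and> Nh v \<le> v (k + m) \<and> pq v \<le> \<rho>}"

lemma Nh_uminus: "Nh (\<lambda>i. - v i) = Nh v"
  using Nh_scale[of "-1" v] by simp

lemma pq_uminus: "pq (\<lambda>i. - v i) = pq v"
  using pq_scale[of "-1" v] by simp

text \<open>Lattices and both seminorms are symmetric under negation, which identifies two-sided and
  one-sided cone conditions.\<close>

lemma latt_pos_last:
  assumes "x \<in> Xsp n" "v \<in> latt n x" "v (k + m) \<noteq> 0"
  obtains w where "w \<in> latt n x" "w (k + m) = \<bar>v (k + m)\<bar>" "Nh w = Nh v" "pq w = pq v"
proof (cases "v (k + m) > 0")
  case True
  then show thesis using that[of v] assms by simp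
next
  case False
  then show thesis using that[of "\<lambda>i. - v i"] assms latt_uminus[OF assms(1,2)] by (simp add: Nh_uminus pq_uminus)
qed

lemma E0_eq_lmin: "E0 \<rho> = {x \<in> Xsp n. lmin n scone pq x < ennreal \<rho>}"
proof (intro subset_antisym subsetI)
  fix x assume "x \<in> E0 \<rho>"
  then obtain v where v: "x \<in> Xsp n" "v \<in> latt n x" "Nh v < \<bar>v (k + m)\<bar>" "pq v < \<rho>"
    by (auto simp: E0_def Ev_def)
  then have "v (k + m) \<noteq> 0" using Nh_ge0[of v] by auto
  from latt_pos_last[OF v(1,2) this] obtain w
    where w: "w \<in> latt n x" "w (k + m) = \<bar>v (k + m)\<bar>" "Nh w = Nh v" "pq w = pq v" .
  have "w \<in> scone" using w v \<open>v (k + m) \<noteq> 0\<close> by (simp add: scone_def)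
  moreover have "w \<noteq> (\<lambda>_. 0)" using w(2) \<open>v (k + m) \<noteq> 0\<close> by auto
  moreover have "ennreal (pq w) < ennreal \<rho>" using w v pq_ge0[of w] by (simp add: ennreal_less_iff)
  ultimately show "x \<in> {x \<in> Xsp n. lmin n scone pq x < ennreal \<rho>}" using w(1) v(1) by (auto simp: lmin_less_iff)
next
  fix x assume "x \<in> {x \<in> Xsp n. lmin n scone pq x < ennreal \<rho>}"
  then obtain v where v: "x \<in> Xsp n" "v \<in> latt n x" "v \<noteq> (\<lambda>_. 0)" "v \<in> scone" "ennreal (pq v) < ennreal \<rho>"
    by (auto simp: lmin_less_iff)
  then have "pq v < \<rho>" using pq_ge0[of v] by (simp add: ennreal_less_iff)
  with v show "x \<in> E0 \<rho>" by (auto simp: E0_def Ev_def scone_def)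
qed

lemma open_scone: "open scone"
  unfolding scone_def
  by (intro open_Collect_conj open_Collect_less continuous_Nh continuous_coordinate continuous_on_const)

lemma scone_bdd: "\<exists>M. \<forall>v\<in>vecs n. v \<in> scone \<longrightarrow> pq v \<le> c \<longrightarrow> l1 n v \<le> M"
proof (intro exI ballI impI)
  fix v assume v: "v \<in> scone" "pq v \<le> c"
  have "\<bar>v (k + m)\<bar> \<le> pq v / cg" using pq_lower[of "k + m" v] cg(1) by (simp add: field_simps)
  also have "\<dots> \<le> c / cg" using v cg(1) by (simp add: divide_right_mono)
  finally have "Nh v \<le> c / cg" using v by (simp add: scone_def)
  then have "Nh v / ch \<le> (c / cg) / ch" using ch(1) by (intro divide_right_mono) auto
  moreover have "real (m + 1) * (pq v / cg) \<le> real (m + 1) * (c / cg)"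
    using v cg(1) by (intro mult_left_mono divide_right_mono) auto
  ultimately show "l1 n v \<le> (c / cg) / ch + real (m + 1) * (c / cg)" using l1_bound[of v] by linarith
qed

text \<open>The open cone contains arbitrarily large balls, so it meets every lattice: take a point
  far out on its axis and round its coordinates with respect to the basis g.\<close>

lemma lmin_scone_finite:
  assumes "x \<in> Xsp n"
  shows "lmin n scone pq x < \<infinity>"
proof -
  obtain g where g: "g \<in> SLR n" "x = coset n g" using Xsp_ex[OF assms] by auto
  \<comment> \<open>\<open>R\<close> bounds the rounding error after applying g. The height
    \<open>L\<close> leaves a last coordinate above \<open>Ch * R\<close>, which in turn bounds
    \<open>Nh\<close> of the rounded point.\<close>
  define R where "R = mnorm n g * real n"
  define L where "L = R + Ch * R + 1"
  define e where "e = (\<lambda>i. if i = k + m then L else (0::real))"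
  define y where "y = vmul n e (minv n g)"
  define z where "z = (\<lambda>i. if i < n then real_of_int \<lfloor>y i\<rfloor> else 0)"
  define v where "v = vmul n z g"
  have R: "0 \<le> R" by (simp add: R_def)
  have e: "e \<in> vecs n" by (auto simp: e_def vecs_def n_def)
  have z: "z \<in> zvecs n" by (auto simp: z_def zvecs_def vecs_def)
  have "l1 n (\<lambda>i. z i - y i) \<le> (\<Sum>i<n. 1)"
    unfolding l1_def
  proof (intro sum_mono)
    fix i assume "i \<in> {..<n}"
    then show "\<bar>z i - y i\<bar> \<le> 1" by (simp add: z_def abs_le_iff) linarith
  qed
  then have zy: "l1 n (\<lambda>i. z i - y i) \<le> real n" by simp
  have "vmul n (\<lambda>i. z i - y i) g = (\<lambda>i. v i - e i)"
    using vmul_lincomb[of n 1 z "-1" y g] e g by (simp add: v_def y_def)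
  then have "l1 n (\<lambda>i. v i - e i) \<le> mnorm n g * l1 n (\<lambda>i. z i - y i)" by (metis l1_vmul)
  also have "\<dots> \<le> R" unfolding R_def using zy by (intro mult_left_mono) auto
  finally have ve: "l1 n (\<lambda>i. v i - e i) \<le> R" .
  have "\<bar>v (k + m) - e (k + m)\<bar> \<le> R" using abs_le_l1[of "k + m" n "\<lambda>i. v i - e i"] ve by simp
  then have last: "Ch * R < v (k + m)" by (simp add: e_def L_def)
  have "yfst k e = (\<lambda>_. 0)" by (auto simp: yfst_def e_def)
  then have "Nh e = 0" using norm_eq0[OF Nk, of "\<lambda>_. 0"] by (simp add: Nh_def)
  then have "Nh v \<le> Ch * l1 n (\<lambda>i. v i - e i)" using Nh_lipschitz[of v e] by simp
  also have "\<dots> \<le> Ch * R" using ve Ch(1) by (intro mult_left_mono) auto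
  finally have Nhv: "Nh v < v (k + m)" using last by simp
  then have "v \<in> scone" using Nh_ge0[of v] by (simp add: scone_def)
  moreover have "v \<noteq> (\<lambda>_. 0)" using Nhv Nh_ge0[of v] by auto
  moreover have "v \<in> latt n x" using z g by (simp add: latt_coset v_def)
  ultimately show ?thesis unfolding lmin_less_iff by auto
qed

text \<open>By the diagonal flow, \<open>hit\<close> has the distribution of the smallest \<open>X\<close> for which the cone over
  the ball of radius \<open>X\<close> contains a lattice point; unlike the latter it is finite and positive everywhere.\<close>

definition "hit x = enn2real (lmin n scone pq x) powr (real n / real k)"

lemma lmin_scone_real:
  assumes "x \<in> Xsp n"
  obtains b where "b > 0" "lmin n scone pq x = ennreal b"
proof -
  obtain v where "v \<in> scone" "lmin n scone pq x = ennreal (pq v)"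
    using lmin_attained[OF assms lmin_scone_finite[OF assms] pq_ge0 scone_bdd] by blast
  moreover have "pq v > 0" using \<open>v \<in> scone\<close> by (intro pq_pos) (simp add: scone_def)
  ultimately show thesis using that by blast
qed

lemma hit_pos: "x \<in> Xsp n \<Longrightarrow> 0 < hit x"
  by (rule lmin_scone_real[of x]) (auto simp: hit_def)

lemma hit_less_iff:
  assumes x: "x \<in> Xsp n" and X: "X > 0"
  shows "hit x < X \<longleftrightarrow> x \<in> E0 (X powr (real k / real n))"
proof -
  obtain b where b: "b > 0" "lmin n scone pq x = ennreal b" by (rule lmin_scone_real[OF x])
  have "hit x < X \<longleftrightarrow> b powr (real n / real k) < (X powr (real k / real n)) powr (real n / real k)"
    using b X k1 by (simp add: hit_def powr_powr)
  also have "\<dots> \<longleftrightarrow> b < X powr (real k / real n)"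
    using b X powr_less_mono2[of "real n / real k" b "X powr (real k / real n)"]
      powr_less_cancel2[of "real n / real k" b "X powr (real k / real n)"] by auto
  also have "\<dots> \<longleftrightarrow> x \<in> E0 (X powr (real k / real n))"
    using b x by (simp add: E0_eq_lmin ennreal_less_iff)
  finally show ?thesis .
qed

end

section \<open>The closed half cone and its gauge\<close>

context flow_setting
begin

definition "half = {v :: nat \<Rightarrow> real. 0 < v (k + m)}"

text \<open>One gauge for two inequalities: inside \<open>half\<close> both hold exactly when
  \<open>qmax\<close> is at most 1, so the boundary event becomes a level set of one lattice
  minimum.\<close>

definition "qmax \<rho> v = max (Nh v / v (k + m)) (pq v / \<rho>)"

lemma open_half: "open half"
  unfolding half_def by (intro open_Collect_less continuous_coordinate continuous_on_const)

lemma continuous_qmax: "\<rho> > 0 \<Longrightarrow> continuous_on half (qmax \<rho>)"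
  unfolding qmax_def
  by (intro continuous_on_max continuous_on_divide continuous_Nh continuous_pq continuous_coordinate continuous_on_const)
    (auto simp: half_def)

lemma qmax_ge0: "v \<in> half \<Longrightarrow> 0 \<le> qmax \<rho> v"
  using Nh_ge0[of v] by (auto simp: qmax_def half_def le_max_iff_disj)

lemma qmax_bdd:
  assumes "\<rho> > 0"
  shows "\<exists>M. \<forall>v\<in>vecs n. v \<in> half \<longrightarrow> qmax \<rho> v \<le> c \<longrightarrow> l1 n v \<le> M"
proof (intro exI ballI impI)
  fix v assume v: "v \<in> half" "qmax \<rho> v \<le> c"
  have "0 \<le> c" using qmax_ge0[OF v(1)] v(2) by (rule order_trans)
  have vl: "0 < v (k + m)" using v by (simp add: half_def)
  have p: "pq v \<le> c * \<rho>" using v(2) assms by (simp add: qmax_def field_simps)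
  have "v (k + m) \<le> pq v / cg" using pq_lower[of "k + m" v] cg(1) vl by (simp add: field_simps)
  also have "\<dots> \<le> c * \<rho> / cg" using p cg(1) by (intro divide_right_mono) auto
  finally have "c * v (k + m) \<le> c * (c * \<rho> / cg)" using \<open>0 \<le> c\<close> by (rule mult_left_mono)
  moreover have "Nh v \<le> c * v (k + m)" using v(2) vl by (simp add: qmax_def field_simps)
  ultimately have "Nh v / ch \<le> (c * (c * \<rho> / cg)) / ch" using ch(1) by (intro divide_right_mono) auto
  moreover have "real (m + 1) * (pq v / cg) \<le> real (m + 1) * (c * \<rho> / cg)"
    using p cg(1) by (intro mult_left_mono divide_right_mono) auto
  ultimately show "l1 n v \<le> (c * (c * \<rho> / cg)) / ch + real (m + 1) * (c * \<rho> / cg)"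
    using l1_bound[of v] by linarith
qed

lemma qmax_less1: "\<rho> > 0 \<Longrightarrow> v \<in> half \<Longrightarrow> qmax \<rho> v < 1 \<longleftrightarrow> Nh v < v (k + m) \<and> pq v < \<rho>"
  and qmax_le1: "\<rho> > 0 \<Longrightarrow> v \<in> half \<Longrightarrow> qmax \<rho> v \<le> 1 \<longleftrightarrow> Nh v \<le> v (k + m) \<and> pq v \<le> \<rho>"
  by (simp_all add: qmax_def half_def)

text \<open>For nonstrict inequalities the infimum has to be attained, which is where
  \<open>qmax_bdd\<close> enters.\<close>

lemma Ec_eq_lmin:
  assumes "\<rho> > 0"
  shows "Ec \<rho> = {x \<in> Xsp n. lmin n half (qmax \<rho>) x \<le> 1}"
proof (intro subset_antisym subsetI)
  fix x assume "x \<in> Ec \<rho>"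
  then obtain v where v: "x \<in> Xsp n" "v \<in> latt n x" "v \<noteq> (\<lambda>_. 0)" "v \<in> half" "Nh v \<le> v (k + m)" "pq v \<le> \<rho>"
    by (auto simp: Ec_def Ev_def half_def)
  then have q: "qmax \<rho> v \<le> 1" using assms by (simp add: qmax_le1)
  have "lmin n half (qmax \<rho>) x \<le> ennreal (qmax \<rho> v)" unfolding lmin_def
    by (rule INF_lower) (use v in simp)
  also have "\<dots> \<le> 1" using q by (simp add: ennreal_le_1)
  finally show "x \<in> {x \<in> Xsp n. lmin n half (qmax \<rho>) x \<le> 1}" using v by simp
next
  fix x assume x: "x \<in> {x \<in> Xsp n. lmin n half (qmax \<rho>) x \<le> 1}"
  then have "lmin n half (qmax \<rho>) x < \<infinity>" using ennreal_one_less_top by (auto intro: le_less_trans)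
  with x obtain v where v: "v \<in> latt n x" "v \<noteq> (\<lambda>_. 0)" "v \<in> half" "lmin n half (qmax \<rho>) x = ennreal (qmax \<rho> v)"
    using lmin_attained[OF _ _ qmax_ge0 qmax_bdd[OF assms]] by blast
  then have "qmax \<rho> v \<le> 1" using x by (simp add: ennreal_le_1)
  with v x assms show "x \<in> Ec \<rho>" by (auto simp: Ec_def Ev_def qmax_le1) (auto simp: half_def)
qed

lemma E0_subset_Ec: "E0 \<rho> \<subseteq> Ec \<rho>"
proof
  fix x assume "x \<in> E0 \<rho>"
  then obtain v where v: "x \<in> Xsp n" "v \<in> latt n x" "Nh v < \<bar>v (k + m)\<bar>" "pq v < \<rho>"
    by (auto simp: E0_def Ev_def)
  then have ne: "v (k + m) \<noteq> 0" using Nh_ge0[of v] by auto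
  from latt_pos_last[OF v(1,2) this] obtain w
    where w: "w \<in> latt n x" "w (k + m) = \<bar>v (k + m)\<bar>" "Nh w = Nh v" "pq w = pq v" .
  then have "w \<noteq> (\<lambda>_. 0)" using ne by auto
  with w v ne show "x \<in> Ec \<rho>" by (auto simp: Ec_def Ev_def intro!: bexI[of _ w])
qed

lemma Ec_subset_E1: "Ec \<rho> \<subseteq> E1 \<rho>"
  unfolding Ec_def E1_def by (rule Ev_mono) auto

text \<open>Along the flow one term of the maximum grows and the other decays exponentially, so each
  positive level is met at most twice.\<close>

lemma vmul_Phi_qmax:
  assumes "v \<in> vecs n" "0 < v (k + m)"
  shows "qmax \<rho> (vmul n v (Phi t)) = max (Nh v / v (k + m) * exp (real n * t)) (pq v / \<rho> * exp (- real k * t))"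
proof -
  have "exp (real (m + 1) * t) / exp (- real k * t) = exp (real n * t)"
    unfolding exp_diff[symmetric] real_n by (simp add: algebra_simps)
  then have "exp (real (m + 1) * t) * Nh v / (exp (- real k * t) * v (k + m)) = Nh v / v (k + m) * exp (real n * t)"
    by (simp only: times_divide_times_eq[symmetric] mult.commute)
  then show ?thesis unfolding qmax_def Phi_last Phi_Nh Phi_pq[OF assms(1)] by (simp add: mult.commute)
qed

text \<open>The slope condition is homogeneous of degree one once the last coordinate is positive.
  The condition on the projection asks for a point of the closed ball with the same last m + 1
  coordinates, that is, for a minimiser of \<open>pq\<close> of size at most 1.\<close>

lemma Cset_iff:
  assumes v: "v \<in> vecs n"
  shows "v \<in> Cset k n {a \<in> vecs k. Nk a \<le> X}
      (prj k n ` ({vmul n u g0 | u. u \<in> vecs n \<and> Nn u \<le> 1} \<inter> {y. y (n - 1) > 0}))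
    \<longleftrightarrow> 0 < v (k + m) \<and> Nh v \<le> X * v (k + m) \<and> pq v \<le> 1"
    (is "_ \<in> Cset k n ?A ?W \<longleftrightarrow> _")
proof
  assume "v \<in> Cset k n ?A ?W"
  then obtain a u where a: "a \<in> vecs k" "Nk a \<le> X" "yfst k v = (\<lambda>i. v (k + m) * a i)"
    and u: "u \<in> vecs n" "Nn u \<le> 1" "vmul n u g0 (k + m) > 0" "prj k n v = prj k n (vmul n u g0)"
    by (auto simp: Cset_def n_minus_1[simplified])
  define y where "y = vmul n u g0"
  have vy: "v i = y i" if "k \<le> i" for i
  proof (cases "i < n")
    case True
    then have "i - k < n - k" using that by simp
    then show ?thesis using fun_cong[OF u(4), of "i - k"] that by (simp add: prj_def y_def)
  next
    case False
    then show ?thesis using v by (simp add: vecs_def y_def vmul_def)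
  qed
  have vl: "0 < v (k + m)" using vy[of "k + m"] u(3) by (simp add: y_def)
  have "Nh v = \<bar>v (k + m)\<bar> * Nk a" unfolding Nh_def a(3) by (rule norm_scale[OF Nk a(1)])
  also have "\<dots> \<le> v (k + m) * X" using vl a(2) by simp
  finally have 1: "Nh v \<le> X * v (k + m)" by (simp add: mult.commute)
  \<comment> \<open>Equal projections mean that \<open>y\<close> is an admissible shift of
    \<open>v\<close> in the infimum defining \<open>pq\<close>.\<close>
  have "(\<lambda>i. y i - v i) \<in> vecs k" using vy by (simp add: vecs_def)
  from pq_le[OF this, of v] have "pq v \<le> Ng y" by simp
  also have "Ng y = Nn u" using u(1) by (simp add: Ng_def y_def)
  finally show "0 < v (k + m) \<and> Nh v \<le> X * v (k + m) \<and> pq v \<le> 1" using vl 1 u(2) by simp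
next
  assume *: "0 < v (k + m) \<and> Nh v \<le> X * v (k + m) \<and> pq v \<le> 1"
  define a where "a = (\<lambda>i. inverse (v (k + m)) * yfst k v i)"
  have a: "a \<in> vecs k" unfolding a_def by (rule vecs_closed_scale) simp
  have "Nk a = \<bar>inverse (v (k + m))\<bar> * Nh v" unfolding a_def Nh_def by (rule norm_scale[OF Nk]) simp
  then have "Nk a * v (k + m) \<le> X * v (k + m)" using * by (simp add: field_simps)
  then have aX: "Nk a \<le> X" using * by (simp only: mult_le_cancel_right_pos)
  have av: "yfst k v = (\<lambda>i. v (k + m) * a i)" using * by (auto simp: a_def)
  obtain u where u: "u \<in> vecs k" "pq v = Ng (\<lambda>i. v i + u i)" using pq_attained by blast
  define y where "y = (\<lambda>i. v i + u i)"
  have y: "y \<in> vecs n" unfolding y_def using v vecs_mono[OF u(1) k_le_n] by (rule vecs_closed_add)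
  have yv: "y i = v i" if "k \<le> i" for i using u(1) that by (simp add: y_def vecs_def)
  define w where "w = vmul n y (minv n g0)"
  have w: "w \<in> vecs n" "vmul n w g0 = y" "Nn w \<le> 1"
    using y u * by (auto simp: w_def Ng_def y_def)
  have "prj k n v = prj k n y" by (rule ext) (simp add: prj_def yv)
  moreover have "y \<in> {vmul n u g0 | u. u \<in> vecs n \<and> Nn u \<le> 1} \<inter> {y. y (n - 1) > 0}"
    using w * yv[of "k + m"] n_minus_1 by auto
  ultimately have "prj k n v \<in> ?W" by blast
  moreover have "\<exists>a\<in>?A. yfst k v = (\<lambda>i. v (n - 1) * a i)"
    using a aX av n_minus_1 by (intro bexI[of _ a]) auto
  ultimately show "v \<in> Cset k n ?A ?W" unfolding Cset_def using v by blast
qed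

definition "Wset = prj k n ` ({vmul n u g0 | u. u \<in> vecs n \<and> Nn u \<le> 1} \<inter> {y. y (n - 1) > 0})"

definition "Fset X = {x \<in> Xsp n. primlatt n x \<inter> Cset k n {a \<in> vecs k. Nk a \<le> X} Wset = {}}"

text \<open>Passing from primitive to arbitrary nonzero lattice points is harmless because the cone
  is closed under shrinking.\<close>

lemma Fset_eq: "Fset X = Xsp n - Ev n {v. 0 < v (k + m) \<and> Nh v \<le> X * v (k + m) \<and> pq v \<le> 1}"
proof -
  let ?P = "\<lambda>v. 0 < v (k + m) \<and> Nh v \<le> X * v (k + m) \<and> pq v \<le> 1"
  have "primlatt n x \<inter> Cset k n {a \<in> vecs k. Nk a \<le> X} Wset \<noteq> {} \<longleftrightarrow> x \<in> Ev n {v. ?P v}"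
    if x: "x \<in> Xsp n" for x
  proof
    assume "primlatt n x \<inter> Cset k n {a \<in> vecs k. Nk a \<le> X} Wset \<noteq> {}"
    then obtain z g where zg: "z \<in> prim n" "g \<in> x" "vmul n z g \<in> Cset k n {a \<in> vecs k. Nk a \<le> X} Wset"
      by (auto simp: primlatt_def)
    then have P: "?P (vmul n z g)" using Cset_iff[of "vmul n z g" X] by (simp add: Wset_def)
    have "z \<in> zvecs n" using zg(1) by (simp add: prim_def)
    then have "vmul n z g \<in> latt n x" using zg(2) unfolding latt_def by blast
    moreover have "vmul n z g \<noteq> (\<lambda>_. 0)" using P by auto
    ultimately show "x \<in> Ev n {v. ?P v}" using P x by (auto simp: Ev_def)
  next
    assume "x \<in> Ev n {v. ?P v}"
    then obtain v where v: "v \<in> latt n x" "v \<noteq> (\<lambda>_. 0)" "?P v" by (auto simp: Ev_def)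
    then obtain z g where zg: "z \<in> zvecs n" "g \<in> x" "v = vmul n z g" by (auto simp: latt_def)
    then have "z \<noteq> (\<lambda>_. 0)" using v(2) by auto
    then obtain c w where c: "c \<ge> 1" "w \<in> prim n" "z = (\<lambda>i. real_of_int c * w i)"
      using prim_multiple_ex[OF zg(1)] by blast
    define u where "u = vmul n w g"
    have vu: "v = (\<lambda>i. real_of_int c * u i)" using c(3) zg(3) by (simp add: u_def vmul_scale)
    have c0: "real_of_int c \<ge> 1" using c(1) by simp
    have "?P u"
    proof (intro conjI)
      show 1: "0 < u (k + m)" using v(3) c0 unfolding vu by (simp add: zero_less_mult_iff)
      have "real_of_int c * Nh u \<le> real_of_int c * (X * u (k + m))"
        using v(3) c0 unfolding vu Nh_scale by (simp add: mult.left_commute)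
      then show "Nh u \<le> X * u (k + m)" using c0 by simp
      have "pq v = real_of_int c * pq u" unfolding vu using c0 by (subst pq_scale) auto
      moreover have "1 * pq u \<le> real_of_int c * pq u" using c0 pq_ge0[of u] by (rule mult_right_mono)
      ultimately show "pq u \<le> 1" using v(3) by simp
    qed
    then have "u \<in> Cset k n {a \<in> vecs k. Nk a \<le> X} Wset"
      using Cset_iff[of u X] by (simp add: Wset_def u_def)
    moreover have "u \<in> primlatt n x" using c(2) zg(2) unfolding primlatt_def u_def by blast
    ultimately show "primlatt n x \<inter> Cset k n {a \<in> vecs k. Nk a \<le> X} Wset \<noteq> {}" by blast
  qed
  then show ?thesis unfolding Fset_def using Ev_subset by blast
qed

text \<open>With e^(n \<open>\<tau>\<close>) = X, \<open>Phi (- \<tau>)\<close> divides the slope by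
  X and multiplies \<open>pq\<close> by e^(k \<open>\<tau>\<close>) = X^(k/n). The radius of the
  cone is thus traded for the size of the ball.\<close>

lemma Ev_Phi_Ec:
  assumes X: "X > 0" and \<tau>: "\<tau> = ln X / real n"
  shows "Ev n {v. 0 < v (k + m) \<and> Nh v \<le> X * v (k + m) \<and> pq v \<le> 1}
    = {x \<in> Xsp n. xact n x (Phi (- \<tau>)) \<in> Ec (X powr (real k / real n))}"
proof -
  have ex: "exp (real n * \<tau>) = X" using X by (simp add: \<tau>)
  have ek: "exp (real k * \<tau>) = X powr (real k / real n)" using X by (simp add: \<tau> powr_def mult.commute)
  have e1: "exp (real (m + 1) * \<tau>) * exp (real (m + 1) * (- \<tau>)) = 1"
    unfolding exp_add[symmetric] by simp
  have e2: "exp (real (m + 1) * \<tau>) * exp (- real k * (- \<tau>)) = X"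
    unfolding ex[symmetric] real_n exp_add[symmetric] by (simp add: algebra_simps)
  have P: "(0 < v (k + m) \<and> Nh v \<le> X * v (k + m) \<and> pq v \<le> 1) \<longleftrightarrow>
     vmul n v (Phi (- \<tau>)) \<in> {v. 0 < v (k + m) \<and> Nh v \<le> v (k + m) \<and> pq v \<le> X powr (real k / real n)}"
    if v: "v \<in> vecs n" for v
  proof -
    have "exp (real (m + 1) * (- \<tau>)) * Nh v \<le> exp (- real k * (- \<tau>)) * v (k + m)
        \<longleftrightarrow> exp (real (m + 1) * \<tau>) * (exp (real (m + 1) * (- \<tau>)) * Nh v)
          \<le> exp (real (m + 1) * \<tau>) * (exp (- real k * (- \<tau>)) * v (k + m))" by simp
    also have "\<dots> \<longleftrightarrow> Nh v \<le> X * v (k + m)"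
      by (simp only: mult.assoc[symmetric] e1 e2 mult_1)
    finally have 1: "exp (real (m + 1) * (- \<tau>)) * Nh v \<le> exp (- real k * (- \<tau>)) * v (k + m) \<longleftrightarrow> Nh v \<le> X * v (k + m)" .
    have 2: "exp (- real k * (- \<tau>)) * pq v \<le> X powr (real k / real n) \<longleftrightarrow> pq v \<le> 1"
      unfolding ek[symmetric] by simp
    have 3: "0 < exp (- real k * (- \<tau>)) * v (k + m) \<longleftrightarrow> 0 < v (k + m)"
      by (simp only: zero_less_mult_iff exp_gt_zero) simp
    show ?thesis unfolding mem_Collect_eq Phi_last Phi_Nh Phi_pq[OF v] 1 2 3 ..
  qed
  let ?S = "{v. 0 < v (k + m) \<and> Nh v \<le> v (k + m) \<and> pq v \<le> X powr (real k / real n)}"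
  let ?Q = "{v. 0 < v (k + m) \<and> Nh v \<le> X * v (k + m) \<and> pq v \<le> 1}"
  have "{x \<in> Xsp n. xact n x (Phi (- \<tau>)) \<in> Ec (X powr (real k / real n))} = Ev n {v. vmul n v (Phi (- \<tau>)) \<in> ?S}"
    unfolding Ec_def
  proof (intro subset_antisym subsetI)
    fix x assume "x \<in> {x \<in> Xsp n. xact n x (Phi (- \<tau>)) \<in> Ev n ?S}"
    then have "x \<in> Xsp n" "xact n x (Phi (- \<tau>)) \<in> Ev n ?S" by blast+
    then show "x \<in> Ev n {v. vmul n v (Phi (- \<tau>)) \<in> ?S}" by (simp only: Ev_xact[OF _ Phi_SLR])
  next
    fix x assume x: "x \<in> Ev n {v. vmul n v (Phi (- \<tau>)) \<in> ?S}"
    then have "x \<in> Xsp n" by (rule subsetD[OF Ev_subset])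
    with x show "x \<in> {x \<in> Xsp n. xact n x (Phi (- \<tau>)) \<in> Ev n ?S}"
      by (simp only: mem_Collect_eq[of _ "\<lambda>x. x \<in> Xsp n \<and> _ x"] Ev_xact[OF _ Phi_SLR] simp_thms)
  qed
  also have "Ev n {v. vmul n v (Phi (- \<tau>)) \<in> ?S} = Ev n ?Q"
  proof (rule subset_antisym; rule Ev_mono; rule subsetI; elim IntE)
    fix v assume "v \<in> {v. vmul n v (Phi (- \<tau>)) \<in> ?S}" "v \<in> vecs n"
    with P[of v] show "v \<in> ?Q" by (simp only: mem_Collect_eq)
  next
    fix v assume "v \<in> ?Q" "v \<in> vecs n"
    with P[of v] show "v \<in> {v. vmul n v (Phi (- \<tau>)) \<in> ?S}" by (simp only: mem_Collect_eq)
  qed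
  finally show ?thesis ..
qed

end

section \<open>Probabilities of the limiting events, and the density\<close>

locale flow_measure = flow_setting k m g0 Nk Nn for k m g0 Nk Nn +
  fixes \<mu> :: "(nat \<Rightarrow> nat \<Rightarrow> real) set measure"
  assumes mu: "invariant_prob n \<mu>"
begin

sublocale prob_space \<mu> by (rule mu_prob[OF mu])

lemma E0_sets [simp]: "E0 \<rho> \<in> sets \<mu>"
  unfolding mu_sets[OF mu] E0_def
  by (intro Ev_sets open_Collect_conj open_Collect_less continuous_Nh continuous_pq continuous_coordinate
      continuous_on_const continuous_on_rabs)

text \<open>A lattice in the difference has a nonzero vector in the hyperplane, or its minimum of
  \<open>qmax\<close> is exactly 1. The former is handled by shears, the latter by the diagonal
  flow.\<close>

lemma E1_null:
  assumes "\<rho> > 0"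
  shows "\<exists>N\<in>null_sets \<mu>. E1 \<rho> \<subseteq> E0 \<rho> \<union> N"
proof -
  obtain N0 where N0: "N0 \<in> null_sets \<mu>" "{x \<in> Xsp n. \<exists>v\<in>latt n x. v \<noteq> (\<lambda>_. 0) \<and> v (n - 1) = 0} \<subseteq> N0"
    using last_coordinate_null[OF mu] by blast
  have N1: "{x \<in> Xsp n. lmin n half (qmax \<rho>) x \<in> {1}} \<in> null_sets \<mu>" (is "?N1 \<in> _")
  proof (rule lmin_null[OF mu open_half continuous_qmax[OF assms] qmax_ge0 continuous_Phi Phi_SLR qmax_bdd[OF assms]])
    fix v :: "nat \<Rightarrow> real" assume v: "v \<in> vecs n" "v \<noteq> (\<lambda>_. 0)"
    let ?a = "Nh v / v (k + m)" and ?b = "pq v / \<rho>"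
    show "\<exists>N\<in>null_sets lborel. {t. vmul n v (Phi t) \<in> half \<and> ennreal (qmax \<rho> (vmul n v (Phi t))) \<in> {1}} \<subseteq> N"
    proof (rule bexI)
      \<comment> \<open>The times at which one of the two exponentials in
        \<open>vmul_Phi_qmax\<close> equals 1. If \<open>?a\<close> is 0 there is no such time, and
        the convention ln 0 = 0 just adds a point.\<close>
      show "{- ln ?a / real n, ln ?b / real k} \<in> null_sets lborel"
        by (intro finite_imp_null_set_lborel) simp
      show "{t. vmul n v (Phi t) \<in> half \<and> ennreal (qmax \<rho> (vmul n v (Phi t))) \<in> {1}} \<subseteq> {- ln ?a / real n, ln ?b / real k}"
      proof
        fix t assume "t \<in> {t. vmul n v (Phi t) \<in> half \<and> ennreal (qmax \<rho> (vmul n v (Phi t))) \<in> {1}}"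
        then have t: "vmul n v (Phi t) \<in> half" "qmax \<rho> (vmul n v (Phi t)) = 1" by auto
        then have vl: "0 < v (k + m)" by (simp add: half_def Phi_last zero_less_mult_iff)
        then consider "?a * exp (real n * t) = 1" | "?b * exp (- real k * t) = 1"
          using t(2) vmul_Phi_qmax[OF v(1) vl, of \<rho> t] by (auto simp: max_def split: if_splits)
        then show "t \<in> {- ln ?a / real n, ln ?b / real k}"
        proof cases
          case 1
          then have "inverse (exp (real n * t)) = ?a" by (intro inverse_unique) (simp only: mult.commute)
          then have "?a = exp (- (real n * t))" by (simp only: exp_minus)
          then have "ln ?a = - (real n * t)" by simp
          then show ?thesis by simp
        next
          case 2
          then have "inverse (exp (- real k * t)) = ?b" by (intro inverse_unique) (simp only: mult.commute)
          then have "?b = exp (real k * t)" by (simp add: exp_minus[symmetric])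
          then have "ln ?b = real k * t" by simp
          then show ?thesis using k_pos by simp
        qed
      qed
    qed
  qed simp_all
  have "E1 \<rho> \<subseteq> E0 \<rho> \<union> (N0 \<union> ?N1)"
  proof
    fix x assume "x \<in> E1 \<rho>"
    then obtain v where v: "x \<in> Xsp n" "v \<in> latt n x" "v \<noteq> (\<lambda>_. 0)" "Nh v \<le> \<bar>v (k + m)\<bar>" "pq v \<le> \<rho>"
      by (auto simp: E1_def Ev_def)
    show "x \<in> E0 \<rho> \<union> (N0 \<union> ?N1)"
    proof (cases "v (k + m) = 0")
      case True
      then have "x \<in> {x \<in> Xsp n. \<exists>v\<in>latt n x. v \<noteq> (\<lambda>_. 0) \<and> v (n - 1) = 0}"
        using v n_minus_1 by auto
      then show ?thesis using N0(2) by blast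
    next
      case False
      from latt_pos_last[OF v(1,2) this] obtain w
        where w: "w \<in> latt n x" "w (k + m) = \<bar>v (k + m)\<bar>" "Nh w = Nh v" "pq w = pq v" .
      then have "w \<noteq> (\<lambda>_. 0)" using False by auto
      then have "x \<in> Ec \<rho>" using w v False by (auto simp: Ec_def Ev_def intro!: bexI[of _ w])
      then have le: "lmin n half (qmax \<rho>) x \<le> 1" using Ec_eq_lmin[OF assms] by simp
      show ?thesis
      proof (cases "lmin n half (qmax \<rho>) x = 1")
        case True
        then show ?thesis using v(1) by simp
      next
        case False
        then have "lmin n half (qmax \<rho>) x < 1" using le by simp
        then obtain u where u: "u \<in> latt n x" "u \<noteq> (\<lambda>_. 0)" "u \<in> half" "ennreal (qmax \<rho> u) < 1"
          unfolding lmin_less_iff by blast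
        then have "qmax \<rho> u < 1" by (simp add: ennreal_less_one_iff)
        then have "Nh u < u (k + m) \<and> pq u < \<rho>" using qmax_less1[OF assms u(3)] by simp
        then have "x \<in> E0 \<rho>" using u v(1) by (auto simp: E0_def Ev_def half_def)
        then show ?thesis by blast
      qed
    qed
  qed
  moreover have "N0 \<union> ?N1 \<in> null_sets \<mu>" using N0(1) N1 by (rule null_sets.Un)
  ultimately show ?thesis by blast
qed

lemma Ec_sets:
  assumes "\<rho> > 0"
  shows "Ec \<rho> \<in> sets \<mu>"
proof -
  have "Ec \<rho> = lmin n half (qmax \<rho>) -` {..1} \<inter> space (Xborel n)" using Ec_eq_lmin[OF assms] by auto
  moreover have "lmin n half (qmax \<rho>) -` {..1} \<inter> space (Xborel n) \<in> sets (Xborel n)"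
    by (rule measurable_sets[OF lmin_measurable[OF open_half continuous_qmax[OF assms] qmax_ge0]]) simp_all
  ultimately show ?thesis unfolding mu_sets[OF mu] by simp
qed

lemma prob_Ec: "\<rho> > 0 \<Longrightarrow> prob (Ec \<rho>) = prob (E0 \<rho>)"
proof (rule antisym)
  assume \<rho>: "\<rho> > 0"
  obtain N where N: "N \<in> null_sets \<mu>" "E1 \<rho> \<subseteq> E0 \<rho> \<union> N" using E1_null[OF \<rho>] by blast
  have "prob (Ec \<rho>) \<le> prob (E0 \<rho> \<union> N)"
    using N Ec_subset_E1 by (intro finite_measure_mono) auto
  also have "\<dots> = prob (E0 \<rho>)" using N(1) by (simp add: measure_Un_null_set)
  finally show "prob (Ec \<rho>) \<le> prob (E0 \<rho>)" .
  show "prob (E0 \<rho>) \<le> prob (Ec \<rho>)" by (rule finite_measure_mono[OF E0_subset_Ec Ec_sets[OF \<rho>]])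
qed

lemma Fset_prob:
  assumes X: "X > 0"
  shows "Fset X \<in> sets \<mu>" "prob (Fset X) = 1 - prob (E0 (X powr (real k / real n)))"
proof -
  let ?E = "Ev n {v. 0 < v (k + m) \<and> Nh v \<le> X * v (k + m) \<and> pq v \<le> 1}"
  have \<rho>: "X powr (real k / real n) > 0" using X by simp
  note * = mu_invariant[OF mu Phi_SLR Ec_sets[OF \<rho>], of "- (ln X / real n)"]
  have E: "?E \<in> sets \<mu>" "prob ?E = prob (E0 (X powr (real k / real n)))"
    unfolding Ev_Phi_Ec[OF X refl] using * prob_Ec[OF \<rho>] by simp_all
  have F: "Fset X = space \<mu> - ?E" by (simp add: Fset_eq mu_space[OF mu])
  show "Fset X \<in> sets \<mu>" unfolding F using E(1) by (rule sets.compl_sets)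
  show "prob (Fset X) = 1 - prob (E0 (X powr (real k / real n)))"
    unfolding F prob_compl[OF E(1)] E(2) ..
qed

lemma hit_measurable: "hit \<in> borel_measurable \<mu>"
proof -
  have "lmin n scone pq \<in> borel_measurable (Xborel n)"
    by (rule lmin_measurable[OF open_scone continuous_pq pq_ge0])
  then have [measurable]: "lmin n scone pq \<in> borel_measurable \<mu>"
    by (simp add: measurable_cong_sets[OF mu_sets[OF mu] refl])
  show ?thesis unfolding hit_def by measurable
qed

text \<open>Each vector in the cone has pq^(n/k) proportional to e^(-nt) along the flow, and such a
  curve spends only a null set of times in a null set.\<close>

lemma hit_null:
  assumes A: "A \<in> null_sets lborel"
  shows "prob {x \<in> space \<mu>. hit x \<in> A} = 0"
proof -
  define S where "S = {a::ennreal. a < \<infinity> \<and> enn2real a powr (real n / real k) \<in> A}"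
  have [measurable]: "A \<in> sets borel" using A by (simp add: null_sets_def)
  have S: "S \<in> sets borel" unfolding S_def by measurable
  have "{x \<in> Xsp n. lmin n scone pq x \<in> S} \<in> null_sets \<mu>"
  proof (rule lmin_null[OF mu open_scone continuous_pq pq_ge0 continuous_Phi Phi_SLR scone_bdd S])
    show "\<infinity> \<notin> S" by (simp add: S_def)
    fix v :: "nat \<Rightarrow> real" assume v: "v \<in> vecs n" "v \<noteq> (\<lambda>_. 0)"
    show "\<exists>N\<in>null_sets lborel. {t. vmul n v (Phi t) \<in> scone \<and> ennreal (pq (vmul n v (Phi t))) \<in> S} \<subseteq> N"
    proof (cases "0 < v (k + m)")
      \<comment> \<open>\<open>Phi\<close> preserves the sign of the last coordinate, so this vector
        never enters the cone.\<close>
      case False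
      then have "{t. vmul n v (Phi t) \<in> scone \<and> ennreal (pq (vmul n v (Phi t))) \<in> S} = {}"
        by (auto simp: scone_def Phi_last zero_less_mult_iff)
      then show ?thesis by (intro bexI[of _ "{}"]) auto
    next
      case True
      then have p: "pq v > 0" by (intro pq_pos) simp
      let ?B = "pq v powr (real n / real k)"
      have "{t. ?B * exp (- real n * t) \<in> A} \<in> null_sets lborel"
        using p by (intro null_sets_exp_preimage[OF A]) auto
      moreover have "{t. vmul n v (Phi t) \<in> scone \<and> ennreal (pq (vmul n v (Phi t))) \<in> S}
          \<subseteq> {t. ?B * exp (- real n * t) \<in> A}"
      proof
        fix t assume t: "t \<in> {t. vmul n v (Phi t) \<in> scone \<and> ennreal (pq (vmul n v (Phi t))) \<in> S}"
        then have "(exp (- real k * t) * pq v) powr (real n / real k) \<in> A"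
          using pq_ge0[of "vmul n v (Phi t)"] by (simp add: S_def Phi_pq[OF v(1)])
        moreover have "(exp (- real k * t) * pq v) powr (real n / real k) = ?B * exp (- real n * t)"
          using p k1 by (simp add: powr_mult exp_powr_real)
        ultimately show "t \<in> {t. ?B * exp (- real n * t) \<in> A}" by simp
      qed
      ultimately show ?thesis by blast
    qed
  qed
  moreover have "{x \<in> space \<mu>. hit x \<in> A} = {x \<in> Xsp n. lmin n scone pq x \<in> S}"
    using lmin_scone_finite by (auto simp: hit_def S_def mu_space[OF mu])
  ultimately show ?thesis by (simp add: null_sets_def measure_def)
qed

text \<open>The event \<open>hit x \<ge> X\<close> is not \<open>Fset X\<close> itself, but the two
  agree in probability by invariance under the diagonal flow and by \<open>prob_Ec\<close>.\<close>

lemma ex_density: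
  "\<exists>\<psi>0 :: real \<Rightarrow> real. (\<forall>r>0. 0 \<le> \<psi>0 r) \<and> set_integrable lborel {0<..} \<psi>0 \<and>
    (LINT r:{0<..}|lborel. \<psi>0 r) = 1 \<and> (\<forall>X>0. (LINT r:{X..}|lborel. \<psi>0 r) = prob (Fset X))"
proof -
  obtain D where D: "\<And>y. 0 \<le> D y" "\<And>A. A \<in> sets borel \<Longrightarrow> set_integrable lborel A D"
    "\<And>A. A \<in> sets borel \<Longrightarrow> (LINT y:A|lborel. D y) = prob {x \<in> space \<mu>. hit x \<in> A}"
    using ex_real_density[OF hit_measurable hit_null] by blast
  have "{x \<in> space \<mu>. hit x \<in> {0<..}} = space \<mu>" using hit_pos by (auto simp: mu_space[OF mu])
  then have 1: "(LINT y:{0<..}|lborel. D y) = 1" using D(3)[of "{0<..}"] by (simp add: prob_space)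
  have "(LINT y:{X..}|lborel. D y) = prob (Fset X)" if X: "X > 0" for X
  proof -
    have "{x \<in> space \<mu>. hit x \<in> {X..}} = space \<mu> - E0 (X powr (real k / real n))"
      unfolding mu_space[OF mu] by (auto simp: hit_less_iff[OF _ X, symmetric])
    then show ?thesis using D(3)[of "{X..}"] by (simp add: prob_compl Fset_prob[OF X])
  qed
  then have "(\<forall>r>0. 0 \<le> D r) \<and> set_integrable lborel {0<..} D \<and>
      (LINT r:{0<..}|lborel. D r) = 1 \<and> (\<forall>X>0. (LINT r:{X..}|lborel. D r) = prob (Fset X))"
    using D(1) D(2)[of "{0<..}"] 1 by simp
  then show ?thesis by (rule exI[of _ D])
qed

end

subsection \<open>The supremum over the unipotent orbit\<close>

lemma minv_unique:
  assumes "A \<in> SLR n" "B \<in> mats n" "mmul n B A = idm n"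
  shows "minv n A = B"
proof -
  have "mmul n (mmul n B A) (minv n A) = mmul n B (mmul n A (minv n A))" by (rule mmul_assoc)
  then show ?thesis using assms by (simp add: minv)
qed

text \<open>A nonzero integer vector has \<open>l1\<close> at least 1, and g distorts lengths by a
  bounded factor.\<close>

lemma latt_l1_lower:
  assumes "x \<in> Xsp n"
  shows "\<exists>\<delta>>0. \<forall>v\<in>latt n x. v \<noteq> (\<lambda>_. 0) \<longrightarrow> \<delta> \<le> l1 n v"
proof -
  obtain g where g: "g \<in> SLR n" "x = coset n g" using Xsp_ex[OF assms] by auto
  define R where "R = mnorm n (minv n g) + 1"
  have R: "R > 0" unfolding R_def using mnorm_nonneg[of n "minv n g"] by linarith
  have "1 / R \<le> l1 n v" if v: "v \<in> latt n x" "v \<noteq> (\<lambda>_. 0)" for v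
  proof -
    obtain z where z: "z \<in> zvecs n" "v = vmul n z g" using v(1) g by (auto simp: latt_coset)
    then have zv: "z \<in> vecs n" by (simp add: zvecs_def)
    have "z \<noteq> (\<lambda>_. 0)" using v(2) z(2) by auto
    then obtain i where i: "z i \<noteq> 0" by blast
    then have "i < n" using zv unfolding vecs_def by (metis (mono_tags) linorder_not_le mem_Collect_eq)
    have "1 \<le> \<bar>z i\<bar>" using z(1) i by (intro Ints_nonzero_abs_ge1) (simp_all add: zvecs_def)
    also have "\<dots> \<le> l1 n z" by (rule abs_le_l1[OF \<open>i < n\<close>])
    also have "z = vmul n v (minv n g)" using z g zv by simp
    also have "l1 n (vmul n v (minv n g)) \<le> mnorm n (minv n g) * l1 n v" by (rule l1_vmul)
    also have "\<dots> \<le> R * l1 n v" by (intro mult_right_mono) (auto simp: R_def)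
    finally show ?thesis using R by (simp add: field_simps)
  qed
  then show ?thesis using R by (intro exI[of _ "1 / R"]) simp
qed

context flow_setting
begin

abbreviation "U \<equiv> Umat k m"

lemma U_SLR [simp]: "U s \<in> SLR n"
proof (rule SLR_lower_triangular)
  show "(\<Prod>i<n. U s i i) = 1" by (rule prod.neutral) (auto simp: Umat_def n_def)
qed (auto simp: Umat_def mats_def n_def)

lemma vmul_U:
  assumes y: "y \<in> vecs n" and s: "s \<in> vecs k"
  shows "vmul n y (U s) = (\<lambda>i. y i - y (k + m) * s i)"
proof
  fix j
  show "vmul n y (U s) j = y j - y (k + m) * s j"
  proof (cases "j < n")
    case True
    have "(\<Sum>i<n. y i * U s i j) = (\<Sum>i<n. (if i = j then y j else 0) - (if i = k + m then y (k + m) * s j else 0))"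
    proof (rule sum.cong)
      fix i assume "i \<in> {..<n}"
      then show "y i * U s i j = (if i = j then y j else 0) - (if i = k + m then y (k + m) * s j else 0)"
        using True s by (auto simp: Umat_def n_def vecs_def)
    qed simp
    also have "\<dots> = y j - y (k + m) * s j" using True by (simp add: sum_subtractf)
    finally show ?thesis using True by (simp add: vmul_def)
  next
    case False
    then have "k \<le> j" using k_le_n by linarith
    then show ?thesis using y s False by (simp add: vmul_def vecs_def)
  qed
qed

text \<open>\<open>U s\<close> fixes the last coordinate, so y is recovered by adding y_n s, at the
  cost of a factor 1 + |s|.\<close>

lemma l1_vmul_U:
  assumes y: "y \<in> vecs n" and s: "s \<in> vecs k"
  shows "l1 n y \<le> (1 + l1 k s) * l1 n (vmul n y (U s))"
proof -
  let ?w = "vmul n y (U s)"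
  have wl: "?w (k + m) = y (k + m)" using s by (simp add: vmul_U[OF y s] vecs_def)
  have l1s: "l1 n s = l1 k s" unfolding l1_def
    by (rule sum.mono_neutral_right) (use s in \<open>auto simp: vecs_def\<close>)
  have "l1 n y = l1 n (\<lambda>i. ?w i + ?w (k + m) * s i)" unfolding wl by (simp add: vmul_U[OF y s])
  also have "\<dots> \<le> l1 n ?w + l1 n (\<lambda>i. ?w (k + m) * s i)" by (rule l1_triangle)
  also have "\<dots> = l1 n ?w + \<bar>?w (k + m)\<bar> * l1 k s" by (simp only: l1_scale l1s)
  also have "\<dots> \<le> l1 n ?w + l1 n ?w * l1 k s"
    using abs_le_l1[of "k + m" n ?w] by (intro add_left_mono mult_right_mono) auto
  finally show ?thesis by (simp add: algebra_simps)
qed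

abbreviation "Uconj s \<equiv> mmul n g0 (mmul n (U s) (minv n g0))"

lemma hflow_eq: "hflow k m g0 s x = xact n x (Uconj s)"
  by (simp add: hflow_def n_def)

lemma Uconj_SLR [simp]: "Uconj s \<in> SLR n"
  by (simp add: minv)

lemma Nn_Uconj: "Nn (vmul n v (Uconj s)) = Ng (vmul n (vmul n v g0) (U s))"
  by (simp add: Ng_def vmul_mmul mmul_assoc)

text \<open>A bound uniform in s makes both suprema, the one in \<open>alpha\<close> and the one
  over s, bounded above; real suprema are meaningful only then.\<close>

lemma hflow_norm_lower:
  assumes x: "x \<in> Xsp n" and T: "T \<ge> 0"
  shows "\<exists>\<delta>>0. \<forall>s\<in>vecs k. Nk s \<le> T \<longrightarrow> (\<forall>w\<in>latt n (hflow k m g0 s x). w \<noteq> (\<lambda>_. 0) \<longrightarrow> \<delta> \<le> Nn w)"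
proof -
  obtain \<delta> where \<delta>: "\<delta> > 0" "\<And>v. v \<in> latt n (xact n x g0) \<Longrightarrow> v \<noteq> (\<lambda>_. 0) \<Longrightarrow> \<delta> \<le> l1 n v"
    using latt_l1_lower[OF xact_Xsp[OF x g0']] by blast
  define R where "R = 1 + T / ch"
  have R: "R > 0" using T ch(1) by (simp add: R_def add_pos_nonneg)
  have "cg * (\<delta> / R) \<le> Nn w" if s: "s \<in> vecs k" "Nk s \<le> T" and w: "w \<in> latt n (hflow k m g0 s x)" "w \<noteq> (\<lambda>_. 0)" for s w
  proof -
    obtain v where v: "v \<in> latt n x" "w = vmul n v (Uconj s)"
      using w(1) unfolding hflow_eq latt_xact[OF x Uconj_SLR] by blast
    define y where "y = vmul n v g0"
    have "v \<noteq> (\<lambda>_. 0)" using v(2) w(2) by auto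
    then have "y \<noteq> (\<lambda>_. 0)" unfolding y_def using latt_vecs[OF v(1)] by (simp add: vmul_eq_zero)
    moreover have "y \<in> latt n (xact n x g0)" unfolding latt_xact[OF x g0'] y_def using v(1) by blast
    ultimately have "\<delta> \<le> l1 n y" by (intro \<delta>(2))
    also have "\<dots> \<le> (1 + l1 k s) * l1 n (vmul n y (U s))" by (rule l1_vmul_U[OF _ s(1)]) (simp add: y_def)
    also have "\<dots> \<le> R * l1 n (vmul n y (U s))"
    proof (rule mult_right_mono)
      have "yfst k s = s" using s(1) by (auto simp: yfst_def vecs_def)
      then have "ch * l1 k s \<le> T" using ch(2)[of s] s(2) by (simp add: Nh_def)
      then show "1 + l1 k s \<le> R" using ch(1) by (simp add: R_def field_simps)
    qed simp
    finally have "\<delta> / R \<le> l1 n (vmul n y (U s))" using R by (simp add: field_simps)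
    then have "cg * (\<delta> / R) \<le> cg * l1 n (vmul n y (U s))" using cg(1) by (intro mult_left_mono) auto
    also have "\<dots> \<le> Ng (vmul n y (U s))" by (rule cg)
    finally show ?thesis by (simp only: v(2) Nn_Uconj y_def)
  qed
  moreover have "cg * (\<delta> / R) > 0" using cg(1) \<delta>(1) R by simp
  ultimately show ?thesis by blast
qed

definition "highset Y T = {x \<in> Xsp n. (SUP s \<in> {s \<in> vecs k. Nk s \<le> T}. ln (alpha n Nn (hflow k m g0 s x)))
                 > Y + real k / real n * ln T}"

text \<open>A supremum of a nonempty bounded set strictly exceeds a number iff some member does, so
  both suprema unfold into existence statements without any attainment.\<close>

lemma highset_eq:
  assumes T: "T > 0"
  shows "highset Y T = Ev n {v. \<exists>s\<in>vecs k. Nk s \<le> T \<and>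
    Ng (vmul n (vmul n v g0) (U s)) < exp (- (Y + real k / real n * ln T))}"
proof -
  let ?c = "Y + real k / real n * ln T" and ?S = "{s \<in> vecs k. Nk s \<le> T}"
  have "?c < (SUP s \<in> ?S. ln (alpha n Nn (hflow k m g0 s x))) \<longleftrightarrow>
      (\<exists>v\<in>latt n x. v \<noteq> (\<lambda>_. 0) \<and> (\<exists>s\<in>vecs k. Nk s \<le> T \<and> Ng (vmul n (vmul n v g0) (U s)) < exp (- ?c)))"
    if x: "x \<in> Xsp n" for x
  proof -
    obtain \<delta> where \<delta>: "\<delta> > 0" "\<And>s w. s \<in> ?S \<Longrightarrow> w \<in> latt n (hflow k m g0 s x) \<Longrightarrow> w \<noteq> (\<lambda>_. 0) \<Longrightarrow> \<delta> \<le> Nn w"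
      using hflow_norm_lower[OF x, of T] T by auto
    have hX: "hflow k m g0 s x \<in> Xsp n" for s using x by (simp add: hflow_eq)
    have inv: "1 / Nn w \<le> 1 / \<delta>" if "s \<in> ?S" "w \<in> latt n (hflow k m g0 s x) - {\<lambda>_. 0}" for s w
      using \<delta>(1) \<delta>(2)[of s w] that by (intro divide_left_mono) auto
    have ne: "latt n (hflow k m g0 s x) - {\<lambda>_. 0} \<noteq> {}" for s
      using latt_nonzero_ex[OF hX n_pos, of s] by blast
    have bdd: "bdd_above ((\<lambda>w. 1 / Nn w) ` (latt n (hflow k m g0 s x) - {\<lambda>_. 0}))" if "s \<in> ?S" for s
      using inv[OF that] by (intro bdd_aboveI2)
    have gt: "a < alpha n Nn (hflow k m g0 s x) \<longleftrightarrow> (\<exists>w\<in>latt n (hflow k m g0 s x) - {\<lambda>_. 0}. a < 1 / Nn w)"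
      if "s \<in> ?S" for a s
      unfolding alpha_def by (rule less_cSUP_iff[OF ne bdd[OF that]])
    have le: "alpha n Nn (hflow k m g0 s x) \<le> 1 / \<delta>" if "s \<in> ?S" for s
      unfolding alpha_def by (rule cSUP_least[OF ne]) (rule inv[OF that])
    have Nnpos: "0 < Nn w" if "s \<in> ?S" "w \<in> latt n (hflow k m g0 s x) - {\<lambda>_. 0}" for s w
      using \<delta>(1) \<delta>(2)[of s w] that by auto
    have pos: "0 < alpha n Nn (hflow k m g0 s x)" if "s \<in> ?S" for s
    proof -
      obtain w where "w \<in> latt n (hflow k m g0 s x) - {\<lambda>_. 0}" using ne[of s] by blast
      with Nnpos[OF that this] gt[OF that, of 0] show ?thesis by auto
    qed
    have S_ne: "?S \<noteq> {}"
    proof -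
      have "Nk (\<lambda>_. 0) = 0" using norm_eq0[OF Nk, of "\<lambda>_. 0"] by simp
      then have "(\<lambda>_. 0) \<in> ?S" using T by simp
      then show ?thesis by blast
    qed
    have "ln (alpha n Nn (hflow k m g0 s x)) \<le> ln (1 / \<delta>)" if "s \<in> ?S" for s
      using le[OF that] pos[OF that] \<delta>(1) by (subst ln_le_cancel_iff) auto
    then have "bdd_above ((\<lambda>s. ln (alpha n Nn (hflow k m g0 s x))) ` ?S)" by (intro bdd_aboveI2)
    then have "?c < (SUP s \<in> ?S. ln (alpha n Nn (hflow k m g0 s x))) \<longleftrightarrow>
        (\<exists>s\<in>?S. ?c < ln (alpha n Nn (hflow k m g0 s x)))"
      by (rule less_cSUP_iff[OF S_ne])
    also have "\<dots> \<longleftrightarrow> (\<exists>s\<in>?S. \<exists>v\<in>latt n x. v \<noteq> (\<lambda>_. 0) \<and> Ng (vmul n (vmul n v g0) (U s)) < exp (- ?c))"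
    proof (rule bex_cong[OF refl])
      fix s assume s: "s \<in> ?S"
      have "?c < ln (alpha n Nn (hflow k m g0 s x)) \<longleftrightarrow> exp ?c < alpha n Nn (hflow k m g0 s x)"
        using pos[OF s] by (metis exp_less_cancel_iff exp_ln)
      also have "\<dots> \<longleftrightarrow> (\<exists>w\<in>latt n (hflow k m g0 s x) - {\<lambda>_. 0}. Nn w < exp (- ?c))"
        unfolding gt[OF s]
      proof (rule bex_cong[OF refl])
        fix w assume "w \<in> latt n (hflow k m g0 s x) - {\<lambda>_. 0}"
        from Nnpos[OF s this] show "exp ?c < 1 / Nn w \<longleftrightarrow> Nn w < exp (- ?c)"
          by (simp add: exp_minus field_simps)
      qed
      also have "\<dots> \<longleftrightarrow> (\<exists>v\<in>latt n x. v \<noteq> (\<lambda>_. 0) \<and> Nn (vmul n v (Uconj s)) < exp (- ?c))"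
      proof -
        have "vmul n v (Uconj s) = (\<lambda>_. 0) \<longleftrightarrow> v = (\<lambda>_. 0)" if "v \<in> latt n x" for v
          using latt_vecs[OF that] by (rule vmul_eq_zero[OF Uconj_SLR])
        then show ?thesis unfolding hflow_eq latt_xact[OF x Uconj_SLR] by blast
      qed
      finally show "?c < ln (alpha n Nn (hflow k m g0 s x)) \<longleftrightarrow>
          (\<exists>v\<in>latt n x. v \<noteq> (\<lambda>_. 0) \<and> Ng (vmul n (vmul n v g0) (U s)) < exp (- ?c))"
        by (simp only: Nn_Uconj)
    qed
    finally show ?thesis by blast
  qed
  then show ?thesis unfolding highset_def Ev_def by blast
qed

lemma highset_sets: "T > 0 \<Longrightarrow> highset Y T \<in> sets (Xborel n)"
proof -
  assume T: "T > 0"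
  let ?r = "exp (- (Y + real k / real n * ln T))"
  have "open {v. Ng (vmul n (vmul n v g0) (U s)) < ?r}" for s
    by (intro open_Collect_less continuous_on_const continuous_on_compose2[OF continuous_Ng[of UNIV]]
        continuous_vmul continuous_on_id subset_UNIV)
  then have "open (\<Union>s\<in>{s\<in>vecs k. Nk s \<le> T}. {v. Ng (vmul n (vmul n v g0) (U s)) < ?r})" by blast
  moreover have "(\<Union>s\<in>{s\<in>vecs k. Nk s \<le> T}. {v. Ng (vmul n (vmul n v g0) (U s)) < ?r})
      = {v. \<exists>s\<in>vecs k. Nk s \<le> T \<and> Ng (vmul n (vmul n v g0) (U s)) < ?r}" by blast
  ultimately show ?thesis unfolding highset_eq[OF T] by (intro Ev_sets) simp
qed

text \<open>\<open>DT \<rho> T\<close> is the rescaled region for a fixed \<open>T\<close>; for large \<open>T\<close> it lies between \<open>D \<rho> (- \<delta>)\<close>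
  and \<open>D \<rho> \<delta>\<close>, which do not depend on \<open>T\<close>.\<close>

definition "DT \<rho> T = {z. \<exists>s\<in>vecs k. Nk s \<le> T \<and> Ng (\<lambda>i. if i < k then T * z i - z (k + m) * s i else z i) < \<rho>}"

definition "D \<rho> \<delta> = {z. Nh z < \<bar>z (k + m)\<bar> + \<delta> \<and> pq z < \<rho> + \<delta>}"

text \<open>In terms of z = y \<open>Phi (- t)\<close> one has y' - y_n s = e^(-kt) (T z' - z_n s),
  and the other coordinates are e^(-kt) times those of z. The common factor e^(-kt) is T^(-k/n) and
  cancels against the threshold.\<close>

lemma highset_Phi:
  assumes T: "T > 0"
  shows "highset Y T = Ev n {v. vmul n (vmul n v g0) (Phi (- (ln T / real n))) \<in> DT (exp (- Y)) T}"
proof -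
  define t where "t = ln T / real n"
  have nt: "exp (real n * t) = T" using T by (simp add: t_def)
  have r: "exp (- (Y + real k / real n * ln T)) = exp (- real k * t) * exp (- Y)"
    unfolding exp_add[symmetric] by (simp add: t_def)
  have "Ng (vmul n y (U s)) = exp (- real k * t) *
      Ng (\<lambda>i. if i < k then T * vmul n y (Phi (- t)) i - vmul n y (Phi (- t)) (k + m) * s i else vmul n y (Phi (- t)) i)"
    if y: "y \<in> vecs n" and s: "s \<in> vecs k" for y s
  proof -
    define z where "z = vmul n y (Phi (- t))"
    have "y = vmul n z (Phi t)" unfolding z_def using y by (simp add: vmul_mmul Phi_add Phi_0)
    have e: "exp (real (m + 1) * t) = exp (- real k * t) * T"
      unfolding nt[symmetric] real_n exp_add[symmetric] by (simp add: algebra_simps)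
    have z: "z \<in> vecs n" by (simp add: z_def)
    have "vmul n y (U s) = (\<lambda>i. exp (- real k * t) * (if i < k then T * z i - z (k + m) * s i else z i))"
    proof
      fix i
      have yi: "y i = (if i < k then exp (real (m + 1) * t) * z i else if i < n then exp (- real k * t) * z i else 0)"
        and yl: "y (k + m) = exp (- real k * t) * z (k + m)"
        unfolding \<open>y = vmul n z (Phi t)\<close> by (simp_all add: vmul_Phi)
      have "vmul n y (U s) i = y i - y (k + m) * s i" by (simp add: vmul_U[OF y s])
      also have "\<dots> = exp (- real k * t) * (if i < k then T * z i - z (k + m) * s i else z i)"
        using s z unfolding yi yl e by (auto simp: vecs_def algebra_simps)
      finally show "vmul n y (U s) i = exp (- real k * t) * (if i < k then T * z i - z (k + m) * s i else z i)" .
    qed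
    then show ?thesis unfolding z_def[symmetric] by (simp only: Ng_scale abs_exp_cancel)
  qed
  then have "Ng (vmul n (vmul n v g0) (U s)) < exp (- (Y + real k / real n * ln T)) \<longleftrightarrow>
      Ng (\<lambda>i. if i < k then T * vmul n (vmul n v g0) (Phi (- t)) i - vmul n (vmul n v g0) (Phi (- t)) (k + m) * s i
          else vmul n (vmul n v g0) (Phi (- t)) i) < exp (- Y)" if "s \<in> vecs k" for s v
    using that unfolding r by (subst mult_less_cancel_left_pos[OF exp_gt_zero, symmetric]) simp
  then have "{v. \<exists>s\<in>vecs k. Nk s \<le> T \<and> Ng (vmul n (vmul n v g0) (U s)) < exp (- (Y + real k / real n * ln T))}
      = {v. vmul n (vmul n v g0) (Phi (- t)) \<in> DT (exp (- Y)) T}"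
    unfolding DT_def mem_Collect_eq by (intro Collect_cong bex_cong refl) blast
  then show ?thesis unfolding highset_eq[OF T] t_def by simp
qed

text \<open>If w is the short vector, then T z' = w' + z_n s with |w'| at most
  \<open>Ch * (\<rho> / cg)\<close>. Dividing by T gives the slope condition with that error over T;
  and w, z have the same \<open>pq\<close>.\<close>

lemma DT_upper:
  assumes z: "z \<in> vecs n" "z \<in> DT \<rho> T" and T: "T > 0" and \<delta>: "Ch * (\<rho> / cg) / T < \<delta>"
  shows "z \<in> D \<rho> \<delta>"
proof -
  obtain s where s: "s \<in> vecs k" "Nk s \<le> T" "Ng (\<lambda>i. if i < k then T * z i - z (k + m) * s i else z i) < \<rho>"
    using z(2) by (auto simp: DT_def)
  define w where "w = (\<lambda>i. if i < k then T * z i - z (k + m) * s i else z i)"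
  have w: "Ng w < \<rho>" using s(3) by (simp add: w_def)
  have "(\<lambda>i. w i - z i) \<in> vecs k" by (simp add: w_def vecs_def)
  from pq_le[OF this, of z] have pqz: "pq z < \<rho>" using w by simp
  have "l1 n w \<le> \<rho> / cg" using cg(2)[of w] w cg(1) by (simp add: field_simps)
  then have "Ch * l1 n w \<le> Ch * (\<rho> / cg)" using Ch(1) by (intro mult_left_mono) auto
  then have Nw: "Nh w \<le> Ch * (\<rho> / cg)" using Ch(2)[of w] by linarith
  have ys: "yfst k s = s" using s(1) by (auto simp: yfst_def vecs_def)
  have "yfst k (\<lambda>i. T * z i) = yfst k (\<lambda>i. w i + z (k + m) * s i)" by (auto simp: yfst_def w_def)
  then have "Nh (\<lambda>i. T * z i) = Nh (\<lambda>i. w i + z (k + m) * s i)" by (simp only: Nh_def)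
  also have "\<dots> \<le> Nh w + Nh (\<lambda>i. z (k + m) * s i)" by (rule Nh_add)
  also have "Nh (\<lambda>i. z (k + m) * s i) = \<bar>z (k + m)\<bar> * Nk s" unfolding Nh_scale by (simp add: Nh_def ys)
  also have "\<bar>z (k + m)\<bar> * Nk s \<le> \<bar>z (k + m)\<bar> * T" using s(2) by (intro mult_left_mono) auto
  finally have "T * Nh z \<le> Ch * (\<rho> / cg) + \<bar>z (k + m)\<bar> * T" using Nw T by (simp add: Nh_scale)
  then have "Nh z \<le> (Ch * (\<rho> / cg) + \<bar>z (k + m)\<bar> * T) / T"
    unfolding pos_le_divide_eq[OF T] by (simp only: mult.commute)
  also have "\<dots> = Ch * (\<rho> / cg) / T + \<bar>z (k + m)\<bar>" using T by (simp add: add_divide_distrib)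
  finally have "Nh z \<le> Ch * (\<rho> / cg) / T + \<bar>z (k + m)\<bar>" .
  then have "Nh z < \<bar>z (k + m)\<bar> + \<delta>" using \<delta> by linarith
  \<comment> \<open>Existence of a vector with \<open>Ng w < \<rho>\<close> makes
    \<open>\<rho>\<close> nonnegative, hence also the quantity below
    \<open>\<delta>\<close>.\<close>
  moreover have "0 < \<delta>"
  proof -
    have "0 \<le> \<rho>" using w Ng_ge0[of w] by linarith
    then have "0 \<le> Ch * (\<rho> / cg) / T" using Ch(1) cg(1) T by simp
    then show ?thesis using \<delta> by linarith
  qed
  ultimately show ?thesis using pqz by (simp add: D_def)
qed

text \<open>Lift the last coordinates of z to a vector w with \<open>Ng w < \<rho>\<close> and
  choose s so that z is carried to w. The margin \<open>\<delta>\<close> pays for the contribution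
  of w' to |s|.\<close>

lemma DT_lower:
  assumes z: "z \<in> vecs n" "z \<in> D \<rho> (- \<delta>)" and T: "T > 0" and \<delta>: "\<delta> > 0" "Ch * (\<rho> / cg) / T < \<delta>"
  shows "z \<in> DT \<rho> T"
proof -
  have z': "Nh z < \<bar>z (k + m)\<bar> - \<delta>" "pq z < \<rho>" using z(2) \<delta>(1) by (auto simp: D_def)
  then have zl: "z (k + m) \<noteq> 0" using Nh_ge0[of z] \<delta>(1) by auto
  obtain u where u: "u \<in> vecs k" "Ng (\<lambda>i. z i + u i) < \<rho>" using z'(2) unfolding pq_less_iff by blast
  define w where "w = (\<lambda>i. z i + u i)"
  have w: "Ng w < \<rho>" using u(2) by (simp add: w_def)
  have "l1 n w \<le> \<rho> / cg" using cg(2)[of w] w cg(1) by (simp add: field_simps)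
  then have "Ch * l1 n w \<le> Ch * (\<rho> / cg)" using Ch(1) by (intro mult_left_mono) auto
  then have Nw: "Nh w \<le> Ch * (\<rho> / cg)" using Ch(2)[of w] by linarith
  \<comment> \<open>The solution of T z' - z_n s = w'. Division by z_n is legitimate because the
    margin forces |z_n| > \<open>\<delta>\<close>.\<close>
  define s where "s = yfst k (\<lambda>i. inverse (z (k + m)) * (T * z i + - 1 * w i))"
  have s: "s \<in> vecs k" by (simp add: s_def)
  have "Nk s = \<bar>inverse (z (k + m))\<bar> * Nh (\<lambda>i. T * z i + - 1 * w i)"
    unfolding s_def Nh_def[symmetric] by (rule Nh_scale)
  also have "\<dots> \<le> \<bar>inverse (z (k + m))\<bar> * (T * Nh z + Nh w)"
    using Nh_add[of "\<lambda>i. T * z i" "\<lambda>i. - 1 * w i"] T unfolding Nh_scale by (intro mult_left_mono) auto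
  also have "\<dots> \<le> \<bar>inverse (z (k + m))\<bar> * (T * \<bar>z (k + m)\<bar>)"
  proof (rule mult_left_mono)
    have "Ch * (\<rho> / cg) \<le> T * \<delta>" using \<delta>(2) unfolding pos_divide_less_eq[OF T] by (simp only: mult.commute less_imp_le)
    moreover have "T * Nh z \<le> T * (\<bar>z (k + m)\<bar> - \<delta>)" using z'(1) T by (intro mult_left_mono) auto
    ultimately show "T * Nh z + Nh w \<le> T * \<bar>z (k + m)\<bar>" using Nw by (simp add: right_diff_distrib)
  qed simp
  also have "\<dots> = T" using zl by simp
  finally have "Nk s \<le> T" .
  moreover have "(\<lambda>i. if i < k then T * z i - z (k + m) * s i else z i) = w"
  proof
    fix i
    have "z (k + m) * s i = T * z i + - 1 * w i" if "i < k"
      using that zl by (simp only: s_def yfst_def if_True mult.assoc[symmetric] right_inverse[OF zl] mult_1)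
    then show "(if i < k then T * z i - z (k + m) * s i else z i) = w i"
      using u(1) by (auto simp: w_def vecs_def)
  qed
  ultimately show ?thesis unfolding DT_def using s w by auto
qed

end

subsection \<open>Passage to the limit\<close>

context flow_setting
begin

lemma open_D: "open (D \<rho> \<delta>)"
  unfolding D_def
  by (intro open_Collect_conj open_Collect_less continuous_Nh continuous_pq continuous_coordinate
      continuous_on_const continuous_on_rabs continuous_on_add)

lemma D_mono: "\<delta> \<le> \<delta>' \<Longrightarrow> D \<rho> \<delta> \<subseteq> D \<rho> \<delta>'"
  by (auto simp: D_def)

lemma D_bdd: "\<exists>M. \<forall>z\<in>D \<rho> \<delta>. l1 n z \<le> M"
proof (intro exI ballI)
  fix z assume z: "z \<in> D \<rho> \<delta>"
  have p: "pq z \<le> \<rho> + \<delta>" using z by (simp add: D_def)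
  have "\<bar>z (k + m)\<bar> \<le> pq z / cg" using pq_lower[of "k + m" z] cg(1) by (simp add: field_simps)
  also have "\<dots> \<le> (\<rho> + \<delta>) / cg" using p cg(1) by (intro divide_right_mono) auto
  finally have "Nh z \<le> (\<rho> + \<delta>) / cg + \<delta>" using z by (simp add: D_def)
  then have "Nh z / ch \<le> ((\<rho> + \<delta>) / cg + \<delta>) / ch" using ch(1) by (intro divide_right_mono) auto
  moreover have "real (m + 1) * (pq z / cg) \<le> real (m + 1) * ((\<rho> + \<delta>) / cg)"
    using p cg(1) by (intro mult_left_mono divide_right_mono) auto
  ultimately show "l1 n z \<le> ((\<rho> + \<delta>) / cg + \<delta>) / ch + real (m + 1) * ((\<rho> + \<delta>) / cg)"
    using l1_bound[of z] by linarith
qed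

text \<open>\<open>Nh\<close>, the last coordinate and \<open>pq\<close> have Lipschitz constants
  \<open>Ch\<close>, 1 and \<open>Cg\<close>; the first two occur together in one
  inequality.\<close>

lemma D_thick:
  assumes "d \<in> D \<rho> \<delta>" and e: "(Ch + 1 + Cg) * l1 n (\<lambda>i. d i - e i) < \<epsilon>"
  shows "e \<in> D \<rho> (\<delta> + \<epsilon>)"
proof -
  let ?l = "l1 n (\<lambda>i. d i - e i)"
  have "Nh e \<le> Nh d + Ch * ?l" using Nh_lipschitz[of e d] by (simp add: l1_minus_commute[of n e d])
  moreover have "pq e \<le> pq d + Cg * ?l" using pq_lipschitz[of e d] by (simp add: l1_minus_commute[of n e d])
  moreover have "\<bar>d (k + m)\<bar> \<le> \<bar>e (k + m)\<bar> + ?l" using abs_le_l1[of "k + m" n "\<lambda>i. d i - e i"] by simp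
  moreover have "Ch * ?l + ?l \<le> (Ch + 1 + Cg) * ?l" "Cg * ?l \<le> (Ch + 1 + Cg) * ?l"
    using Ch(1) Cg(1) by (simp_all add: distrib_right)
  ultimately show ?thesis using assms unfolding D_def mem_Collect_eq by linarith
qed

definition "Eg \<rho> \<delta> = Ev n {v. vmul n v g0 \<in> D \<rho> \<delta>}"

lemma Eg_mono: "\<delta> \<le> \<delta>' \<Longrightarrow> Eg \<rho> \<delta> \<subseteq> Eg \<rho> \<delta>'"
  unfolding Eg_def by (rule Ev_mono) (use D_mono in blast)

lemma Eg_open: "openin (Xtop n) (Eg \<rho> \<delta>)"
proof -
  have "open ((\<lambda>v. vmul n v g0) -` D \<rho> \<delta>)"
    by (rule open_vimage[OF open_D]) (intro continuous_vmul continuous_on_id continuous_on_const)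
  then show ?thesis unfolding Eg_def by (intro openin_Ev) (simp add: vimage_def)
qed

text \<open>The factor \<open>mnorm n g0 + 1\<close> in \<open>K\<close> accounts for measuring the
  displacement after multiplication by \<open>g0\<close>.\<close>

lemma closure_Eg:
  assumes "\<epsilon> > 0"
  shows "Xtop n closure_of Eg \<rho> \<delta> \<subseteq> Eg \<rho> (\<delta> + \<epsilon>)"
proof -
  obtain M where M: "\<And>z. z \<in> D \<rho> \<delta> \<Longrightarrow> l1 n z \<le> M" using D_bdd by blast
  define K where "K = (Ch + 1 + Cg) * (mnorm n g0 + 1)"
  have K: "K > 0" unfolding K_def using Ch(1) Cg(1) mnorm_nonneg[of n g0] by (intro mult_pos_pos) linarith+
  show ?thesis unfolding Eg_def
  proof (rule closure_Ev)
    fix d assume d: "d \<in> {v. vmul n v g0 \<in> D \<rho> \<delta>}" "d \<in> vecs n"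
    then have "d = vmul n (vmul n d g0) (minv n g0)" by simp
    then have "l1 n d \<le> mnorm n (minv n g0) * l1 n (vmul n d g0)" by (metis l1_vmul)
    also have "\<dots> \<le> mnorm n (minv n g0) * M" using d(1) M by (intro mult_left_mono) auto
    finally show "l1 n d \<le> mnorm n (minv n g0) * M" .
  next
    show "\<epsilon> / K > 0" using assms K by simp
  next
    fix d e assume d: "d \<in> {v. vmul n v g0 \<in> D \<rho> \<delta>}" and de: "l1 n (\<lambda>i. d i - e i) < \<epsilon> / K"
    have "(\<lambda>i. vmul n d g0 i - vmul n e g0 i) = vmul n (\<lambda>i. d i - e i) g0"
      using vmul_lincomb[of n 1 d "-1" e g0] by simp
    then have "l1 n (\<lambda>i. vmul n d g0 i - vmul n e g0 i) \<le> mnorm n g0 * l1 n (\<lambda>i. d i - e i)" by (simp only: l1_vmul)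
    also have "\<dots> \<le> (mnorm n g0 + 1) * l1 n (\<lambda>i. d i - e i)" by (intro mult_right_mono) auto
    finally have "(Ch + 1 + Cg) * l1 n (\<lambda>i. vmul n d g0 i - vmul n e g0 i)
        \<le> (Ch + 1 + Cg) * ((mnorm n g0 + 1) * l1 n (\<lambda>i. d i - e i))"
      using Ch(1) Cg(1) by (intro mult_left_mono) auto
    also have "\<dots> = K * l1 n (\<lambda>i. d i - e i)" by (simp only: K_def mult.assoc)
    also have "\<dots> < \<epsilon>" using de unfolding pos_less_divide_eq[OF K] by (simp only: mult.commute)
    finally show "e \<in> {v. vmul n v g0 \<in> D \<rho> (\<delta> + \<epsilon>)}" using D_thick d by simp
  qed
qed

abbreviation "Pconj t \<equiv> mmul n g0 (mmul n (Phi t) (minv n g0))"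

lemma Pconj_SLR [simp]: "Pconj t \<in> SLR n"
  by (simp add: minv)

lemma minv_Pconj: "minv n (Pconj t) = Pconj (- t)"
proof (rule minv_unique)
  have "mmul n (Pconj (- t)) (Pconj t)
      = mmul n g0 (mmul n (Phi (- t)) (mmul n (mmul n (minv n g0) g0) (mmul n (Phi t) (minv n g0))))"
    by (simp add: mmul_assoc)
  also have "\<dots> = mmul n g0 (mmul n (mmul n (Phi (- t)) (Phi t)) (minv n g0))"
    by (simp only: minv(3)[OF g0'] mmul_idm(2)[OF mmul_mats] mmul_assoc)
  also have "\<dots> = idm n" by (simp add: Phi_add Phi_0 minv)
  finally show "mmul n (Pconj (- t)) (Pconj t) = idm n" .
qed simp_all

text \<open>The conjugation by \<open>g0\<close> cancels and leaves the vector v g0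
  \<open>Phi (- t)\<close> that also occurs in \<open>highset_Phi\<close>; the two events can then
  be compared region by region.\<close>

lemma phiflow_Eg:
  "phiflow k m g0 t ` Eg \<rho> \<delta> = Ev n {v. vmul n (vmul n v g0) (Phi (- t)) \<in> D \<rho> \<delta>}"
proof -
  have "phiflow k m g0 t ` Eg \<rho> \<delta> = (\<lambda>x. xact n x (Pconj t)) ` Eg \<rho> \<delta>"
    by (simp add: phiflow_def n_def)
  also have "\<dots> = {x \<in> Xsp n. xact n x (Pconj (- t)) \<in> Eg \<rho> \<delta>}"
    unfolding minv_Pconj[symmetric] by (rule xact_image_eq) (simp_all add: Eg_def Ev_subset)
  also have "\<dots> = {x \<in> Xsp n. x \<in> Ev n {v. vmul n (vmul n v (Pconj (- t))) g0 \<in> D \<rho> \<delta>}}"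
    unfolding Eg_def by (intro Collect_cong conj_cong refl) (simp add: Ev_xact[OF _ Pconj_SLR])
  also have "\<dots> = Ev n {v. vmul n (vmul n v (Pconj (- t))) g0 \<in> D \<rho> \<delta>}"
    using Ev_subset[of n "{v. vmul n (vmul n v (Pconj (- t))) g0 \<in> D \<rho> \<delta>}"] by blast
  also have "(\<lambda>v. vmul n (vmul n v (Pconj (- t))) g0) = (\<lambda>v. vmul n (vmul n v g0) (Phi (- t)))"
    by (rule ext) (simp add: vmul_mmul mmul_assoc minv SLR_mats)
  finally show ?thesis .
qed

end

section \<open>Dependence on the error parameter, and the sandwich\<close>

context flow_measure
begin

definition "G \<rho> \<delta> = prob (Ev n (D \<rho> \<delta>))"

lemma EvD_sets [simp]: "Ev n (D \<rho> \<delta>) \<in> sets \<mu>"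
  unfolding mu_sets[OF mu] by (rule Ev_sets[OF open_D])

lemma Eg_sets [simp]: "Eg \<rho> \<delta> \<in> sets \<mu>"
  unfolding mu_sets[OF mu] by (rule openin_Xborel[OF Eg_open])

lemma G_mono: "mono (G \<rho>)"
  unfolding G_def by (rule monoI, rule finite_measure_mono[OF Ev_mono]) (use D_mono in blast, simp)

lemma prob_Eg: "prob (Eg \<rho> \<delta>) = G \<rho> \<delta>"
proof -
  have "Eg \<rho> \<delta> = {x \<in> Xsp n. xact n x g0 \<in> Ev n (D \<rho> \<delta>)}"
    unfolding Eg_def using Ev_xact[OF _ g0', of _ "D \<rho> \<delta>"]
      Ev_subset[of n "{v. vmul n v g0 \<in> D \<rho> \<delta>}"] by auto
  then show ?thesis using mu_invariant(2)[OF mu g0' EvD_sets] by (simp add: G_def)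
qed

text \<open>The witnesses may vary with j, but they lie in one bounded region and so form a finite
  set. A minimiser of the gauge \<open>f\<close> over this set works for every j, hence in the
  limit.\<close>

lemma Inter_Ev_D: "(\<Inter>j. Ev n (D \<rho> (inverse (real (Suc j))))) \<subseteq> E1 \<rho>"
proof
  fix x assume "x \<in> (\<Inter>j. Ev n (D \<rho> (inverse (real (Suc j)))))"
  then have x: "x \<in> Ev n (D \<rho> (inverse (real (Suc j))))" for j by blast
  then have xX: "x \<in> Xsp n" by (rule subsetD[OF Ev_subset])
  define f where "f = (\<lambda>v. max (Nh v - \<bar>v (k + m)\<bar>) (pq v - \<rho>))"
  have fD: "v \<in> D \<rho> \<delta> \<longleftrightarrow> f v < \<delta>" for v \<delta> by (auto simp: D_def f_def)
  obtain M where M: "\<And>z. z \<in> D \<rho> 1 \<Longrightarrow> l1 n z \<le> M" using D_bdd by blast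
  define S where "S = {v \<in> latt n x. v \<noteq> (\<lambda>_. 0) \<and> l1 n v \<le> M}"
  have "finite S" by (rule finite_subset[OF _ finite_latt_bounded[OF xX, of M]]) (auto simp: S_def)
  have ex: "\<exists>v\<in>S. f v < inverse (real (Suc j))" for j
  proof -
    obtain v where v: "v \<in> latt n x" "v \<noteq> (\<lambda>_. 0)" "v \<in> D \<rho> (inverse (real (Suc j)))"
      using x[of j] by (auto simp: Ev_def)
    have "inverse (real (Suc j)) \<le> 1" by (rule inverse_le_1_iff[THEN iffD2]) simp
    then have "v \<in> D \<rho> 1" using v(3) D_mono by blast
    then have "v \<in> S" using v M by (simp add: S_def)
    then show ?thesis using v(3) fD by blast
  qed
  then have "S \<noteq> {}" by blast
  from ex_is_arg_min_if_finite[OF \<open>finite S\<close> this, of f] obtain w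
    where w: "w \<in> S" "\<And>v. v \<in> S \<Longrightarrow> f w \<le> f v" unfolding is_arg_min_linorder by blast
  have "f w < inverse (real (Suc j))" for j using ex[of j] w(2) by (meson le_less_trans)
  then have "f w \<le> 0" using reals_Archimedean[of "f w"] by (meson not_le less_asym)
  then have "Nh w \<le> \<bar>w (k + m)\<bar>" "pq w \<le> \<rho>" by (auto simp: f_def)
  then show "x \<in> E1 \<rho>" using w(1) xX by (auto simp: E1_def Ev_def S_def)
qed

text \<open>From below the events increase to a set containing \<open>E0 \<rho>\<close>, from above
  they decrease into \<open>E1 \<rho>\<close>, and the gap between these two is null by
  \<open>E1_null\<close>.\<close>

lemma G_near_0:
  assumes \<rho>: "\<rho> > 0" and \<epsilon>: "\<epsilon> > 0"
  shows "\<exists>\<delta>>0. G \<rho> \<delta> < prob (E0 \<rho>) + \<epsilon> \<and> prob (E0 \<rho>) - \<epsilon> < G \<rho> (- \<delta>)"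
proof -
  define i where "i = (\<lambda>j. inverse (real (Suc j)))"
  have i: "i j > 0" "j \<le> j' \<Longrightarrow> i j' \<le> i j" for j j' by (auto simp: i_def field_simps)
  let ?A = "\<lambda>j. Ev n (D \<rho> (i j))" and ?B = "\<lambda>j. Ev n (D \<rho> (- i j))"
  have "decseq ?A"
  proof (rule decseq_SucI, rule Ev_mono)
    fix j show "D \<rho> (i (Suc j)) \<inter> vecs n \<subseteq> D \<rho> (i j)" using D_mono[OF i(2)[of j "Suc j"]] by auto
  qed
  then have limA: "(\<lambda>j. prob (?A j)) \<longlonglongrightarrow> prob (\<Inter>j. ?A j)"
    by (intro finite_Lim_measure_decseq) auto
  have "incseq ?B"
  proof (rule incseq_SucI, rule Ev_mono)
    fix j
    have "- i j \<le> - i (Suc j)" using i(2)[of j "Suc j"] by simp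
    then show "D \<rho> (- i j) \<inter> vecs n \<subseteq> D \<rho> (- i (Suc j))" using D_mono by blast
  qed
  then have limB: "(\<lambda>j. prob (?B j)) \<longlonglongrightarrow> prob (\<Union>j. ?B j)"
    by (intro finite_Lim_measure_incseq) auto
  obtain N where N: "N \<in> null_sets \<mu>" "E1 \<rho> \<subseteq> E0 \<rho> \<union> N" using E1_null[OF \<rho>] by blast
  have "prob (\<Inter>j. ?A j) \<le> prob (E0 \<rho> \<union> N)"
    using N Inter_Ev_D[of \<rho>] unfolding i_def by (intro finite_measure_mono) auto
  also have "\<dots> = prob (E0 \<rho>)" using N(1) by (simp add: measure_Un_null_set)
  finally have "prob (\<Inter>j. ?A j) < prob (E0 \<rho>) + \<epsilon>" using \<epsilon> by simp
  from order_tendstoD(2)[OF limA this] obtain a where a: "\<And>j. j \<ge> a \<Longrightarrow> prob (?A j) < prob (E0 \<rho>) + \<epsilon>"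
    unfolding eventually_sequentially by blast
  have sub: "E0 \<rho> \<subseteq> (\<Union>j. ?B j)"
  proof
    fix x assume "x \<in> E0 \<rho>"
    then obtain v where v: "x \<in> Xsp n" "v \<in> latt n x" "v \<noteq> (\<lambda>_. 0)" "Nh v < \<bar>v (k + m)\<bar>" "pq v < \<rho>"
      by (auto simp: E0_def Ev_def)
    then have "0 < min (\<bar>v (k + m)\<bar> - Nh v) (\<rho> - pq v)" by simp
    from reals_Archimedean[OF this] obtain j where "i j < min (\<bar>v (k + m)\<bar> - Nh v) (\<rho> - pq v)"
      by (auto simp: i_def)
    then have "v \<in> D \<rho> (- i j)" by (simp add: D_def)
    then show "x \<in> (\<Union>j. ?B j)" using v by (auto simp: Ev_def)
  qed
  have "prob (E0 \<rho>) \<le> prob (\<Union>j. ?B j)"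
    using sub by (rule finite_measure_mono) auto
  then have "prob (E0 \<rho>) - \<epsilon> < prob (\<Union>j. ?B j)" using \<epsilon> by simp
  from order_tendstoD(1)[OF limB this] obtain b where b: "\<And>j. j \<ge> b \<Longrightarrow> prob (E0 \<rho>) - \<epsilon> < prob (?B j)"
    unfolding eventually_sequentially by blast
  show ?thesis
    using a[of "max a b"] b[of "max a b"] i(1)[of "max a b"] unfolding G_def by (intro exI[of _ "i (max a b)"]) simp
qed

text \<open>The frontier lies in
  \<open>Eg \<rho> (\<delta> + \<epsilon>) - Eg \<rho> \<delta>\<close> for every positive
  \<open>\<epsilon>\<close>, whose measure is an increment of \<open>G \<rho>\<close>.\<close>

lemma Eg_frontier:
  assumes "isCont (G \<rho>) \<delta>"
  shows "measure \<mu> (Xtop n frontier_of Eg \<rho> \<delta>) = 0"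
proof (rule ccontr)
  let ?c = "measure \<mu> (Xtop n frontier_of Eg \<rho> \<delta>)"
  assume "?c \<noteq> 0"
  then have c: "?c > 0" using measure_nonneg[of \<mu>] by (simp add: order_less_le)
  then obtain d where d: "d > 0" "\<And>y. \<bar>y - \<delta>\<bar> < d \<Longrightarrow> \<bar>G \<rho> y - G \<rho> \<delta>\<bar> < ?c"
    using assms unfolding continuous_at_eps_delta dist_real_def by blast
  have "Xtop n frontier_of Eg \<rho> \<delta> = Xtop n closure_of Eg \<rho> \<delta> - Eg \<rho> \<delta>"
    unfolding frontier_of_def interior_of_openin[OF Eg_open] ..
  also have "\<dots> \<subseteq> Eg \<rho> (\<delta> + d / 2) - Eg \<rho> \<delta>" using closure_Eg[of "d / 2"] d(1) by auto
  finally have "?c \<le> prob (Eg \<rho> (\<delta> + d / 2) - Eg \<rho> \<delta>)" by (rule finite_measure_mono) auto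
  also have "\<dots> = G \<rho> (\<delta> + d / 2) - G \<rho> \<delta>"
    using finite_measure_Diff[OF Eg_sets Eg_sets Eg_mono[of \<delta> "\<delta> + d / 2"]] d(1) by (simp add: prob_Eg)
  also have "\<dots> < ?c" using d(2)[of "\<delta> + d / 2"] d(1) by simp
  finally show False by simp
qed

lemma ex_isCont_G:
  assumes "a < b"
  shows "\<exists>\<delta>. a < \<delta> \<and> \<delta> < b \<and> isCont (G \<rho>) \<delta>"
proof -
  have "countable {\<delta>. \<not> isCont (G \<rho>) \<delta>}" by (rule mono_ctble_discont[OF G_mono])
  moreover have "uncountable {a<..<b}" using assms by (simp add: uncountable_open_interval)
  ultimately have "\<not> {a<..<b} \<subseteq> {\<delta>. \<not> isCont (G \<rho>) \<delta>}" using countable_subset by blast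
  then show ?thesis by auto
qed

lemma highset_limit:
  assumes lam: "prob_space lam" "sets lam = sets (Xborel n)"
    and adm: "admissible k m g0 \<mu> lam"
  shows "((\<lambda>T. measure lam (highset Y T)) \<longlongrightarrow> prob (E0 (exp (- Y)))) at_top"
proof -
  interpret L: prob_space lam by (rule lam(1))
  let ?\<rho> = "exp (- Y)"
  let ?I = "\<lambda>\<delta> T. phiflow k m g0 (ln T / real n) ` Eg ?\<rho> \<delta>"
  have I_sets: "?I \<delta> T \<in> sets lam" for \<delta> T
  proof -
    have "open ((\<lambda>v. vmul n (vmul n v g0) (Phi (- (ln T / real n)))) -` D ?\<rho> \<delta>)"
      by (rule open_vimage[OF open_D]) (intro continuous_vmul continuous_on_id continuous_on_const)
    then show ?thesis unfolding phiflow_Eg lam(2) by (intro Ev_sets) (simp add: vimage_def)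
  qed
  have "filterlim (\<lambda>T. inverse (real n) * ln T) at_top at_top"
    by (rule filterlim_tendsto_pos_mult_at_top[OF tendsto_const _ ln_at_top]) simp
  then have t_lim: "filterlim (\<lambda>T. ln T / real n) at_top at_top"
    by (simp add: divide_inverse mult.commute)
  have lim: "((\<lambda>T. measure lam (?I \<delta> T)) \<longlongrightarrow> G ?\<rho> \<delta>) at_top" if "isCont (G ?\<rho>) \<delta>" for \<delta>
  proof -
    have "((\<lambda>t. measure lam (phiflow k m g0 t ` Eg ?\<rho> \<delta>)) \<longlongrightarrow> measure \<mu> (Eg ?\<rho> \<delta>)) at_top"
      using adm Eg_frontier[OF that] openin_Xborel[OF Eg_open] unfolding admissible_def n_def[symmetric] by blast
    from filterlim_compose[OF this t_lim] show ?thesis by (simp only: prob_Eg)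
  qed
  have small: "\<forall>\<^sub>F T in at_top. T > 0 \<and> Ch * (?\<rho> / cg) / T < \<delta>" if "\<delta> > 0" for \<delta>
  proof -
    have "((\<lambda>T. Ch * (?\<rho> / cg) / T) \<longlongrightarrow> 0) at_top"
      by (rule tendsto_divide_0[OF tendsto_const]) (rule filterlim_at_top_imp_at_infinity, rule filterlim_ident)
    from order_tendstoD(2)[OF this that] eventually_gt_at_top[of 0] show ?thesis by (rule eventually_conj[rotated])
  qed
  show ?thesis
  proof (rule order_tendstoI)
    fix a assume a: "a < prob (E0 ?\<rho>)"
    obtain \<delta>0 where \<delta>0: "\<delta>0 > 0" "prob (E0 ?\<rho>) - (prob (E0 ?\<rho>) - a) < G ?\<rho> (- \<delta>0)"
      using G_near_0[of ?\<rho> "prob (E0 ?\<rho>) - a"] a by auto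
    \<comment> \<open>\<open>G_near_0\<close> provides some radius; by monotonicity any continuity
      point closer to 0 keeps the inequality.\<close>
    obtain \<delta> where \<delta>: "- \<delta>0 < - \<delta>" "- \<delta> < 0" "isCont (G ?\<rho>) (- \<delta>)"
      using ex_isCont_G[of "- \<delta>0" 0 ?\<rho>] \<delta>0(1) by (metis minus_minus neg_less_0_iff_less)
    have "a < G ?\<rho> (- \<delta>)" using \<delta>0(2) monoD[OF G_mono, of "- \<delta>0" "- \<delta>" ?\<rho>] \<delta>(1) by simp
    moreover have "\<delta> > 0" using \<delta>(2) by simp
    ultimately have "\<forall>\<^sub>F T in at_top. a < measure lam (?I (- \<delta>) T) \<and> (T > 0 \<and> Ch * (?\<rho> / cg) / T < \<delta>)"
      by (intro eventually_conj order_tendstoD(1)[OF lim[OF \<delta>(3)]] small)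
    then show "\<forall>\<^sub>F T in at_top. a < measure lam (highset Y T)"
    proof (rule eventually_mono)
      fix T assume T: "a < measure lam (?I (- \<delta>) T) \<and> (T > 0 \<and> Ch * (?\<rho> / cg) / T < \<delta>)"
      have "?I (- \<delta>) T \<subseteq> highset Y T"
        unfolding phiflow_Eg highset_Phi[OF T[THEN conjunct2, THEN conjunct1]]
        by (rule Ev_mono) (use DT_lower[of _ ?\<rho> \<delta> T] T \<delta>(2) in auto)
      then have "measure lam (?I (- \<delta>) T) \<le> measure lam (highset Y T)"
        using T by (intro L.finite_measure_mono) (simp_all add: lam(2) highset_sets)
      then show "a < measure lam (highset Y T)" using T by linarith
    qed
  next
    fix a assume a: "prob (E0 ?\<rho>) < a"
    obtain \<delta>0 where \<delta>0: "\<delta>0 > 0" "G ?\<rho> \<delta>0 < prob (E0 ?\<rho>) + (a - prob (E0 ?\<rho>))"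
      using G_near_0[of ?\<rho> "a - prob (E0 ?\<rho>)"] a by auto
    obtain \<delta> where \<delta>: "0 < \<delta>" "\<delta> < \<delta>0" "isCont (G ?\<rho>) \<delta>"
      using ex_isCont_G[OF \<delta>0(1), of ?\<rho>] by blast
    have "G ?\<rho> \<delta> < a" using \<delta>0(2) monoD[OF G_mono, of \<delta> \<delta>0 ?\<rho>] \<delta>(2) by simp
    from order_tendstoD(2)[OF lim[OF \<delta>(3)] this] small[OF \<delta>(1)]
    have "\<forall>\<^sub>F T in at_top. measure lam (?I \<delta> T) < a \<and> (T > 0 \<and> Ch * (?\<rho> / cg) / T < \<delta>)"
      by (rule eventually_conj)
    then show "\<forall>\<^sub>F T in at_top. measure lam (highset Y T) < a"
    proof (rule eventually_mono)
      fix T assume T: "measure lam (?I \<delta> T) < a \<and> (T > 0 \<and> Ch * (?\<rho> / cg) / T < \<delta>)"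
      have "highset Y T \<subseteq> ?I \<delta> T"
        unfolding phiflow_Eg highset_Phi[OF T[THEN conjunct2, THEN conjunct1]]
        by (rule Ev_mono) (use DT_upper[of _ ?\<rho> T \<delta>] T in auto)
      then have "measure lam (highset Y T) \<le> measure lam (?I \<delta> T)"
        by (intro L.finite_measure_mono I_sets)
      then show "measure lam (highset Y T) < a" using T by linarith
    qed
  qed
qed

end

subsection \<open>The limit distribution\<close>

lemma set_integral_atLeast_eq_greaterThan:
  fixes f :: "real \<Rightarrow> real"
  assumes "set_integrable lborel {X..} f"
  shows "(LINT r:{X..}|lborel. f r) = (LINT r:{X<..}|lborel. f r)"
proof -
  have "set_integrable lborel {X<..} f" by (rule set_integrable_subset[OF assms]) auto
  then show ?thesis
    unfolding set_lebesgue_integral_def using assms AE_lborel_singleton[of X]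
    by (intro integral_cong_AE) (auto simp: set_integrable_def indicator_def)
qed

text \<open>The change of variables r = e^(-cy) is decreasing, whence the absolute value of the
  derivative. It lives in Lebesgue integration theory, so integrals pass through the completion of
  \<open>lborel\<close> and back.\<close>

lemma exp_substitution:
  fixes f :: "real \<Rightarrow> real"
  assumes f: "set_integrable lborel {0<..} f" and c: "c > 0"
  shows "set_integrable lborel {Y..} (\<lambda>y. c * exp (- c * y) * f (exp (- c * y)))"
    and "(LINT y:{Y..}|lborel. c * exp (- c * y) * f (exp (- c * y))) = (LINT r:{0<..exp (- c * Y)}|lborel. f r)"
proof -
  let ?X = "exp (- c * Y)" and ?g = "\<lambda>y. exp (- c * y)"
  let ?h = "\<lambda>y. \<bar>- c * exp (- c * y)\<bar> * f (exp (- c * y))"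
  have fX: "set_integrable lborel {0<..?X} f" by (rule set_integrable_subset[OF f]) auto
  then have mX: "(\<lambda>x. indicator {0<..?X} x *\<^sub>R f x) \<in> borel_measurable lborel"
    by (simp add: set_integrable_def)
  have fL: "f absolutely_integrable_on {0<..?X}"
    using fX unfolding set_integrable_def by (simp only: integrable_completion[OF mX])
  have img: "?g ` {Y..} = {0<..?X}"
  proof (intro subset_antisym subsetI)
    fix r assume r: "r \<in> {0<..?X}"
    then have "ln r \<le> - c * Y" using ln_ge_iff[of r] by (metis exp_le_cancel_iff exp_ln greaterThanAtMost_iff)
    then have "- ln r / c \<in> {Y..}" using c by (simp add: field_simps)
    moreover have "r = ?g (- ln r / c)" using r c by simp
    ultimately show "r \<in> ?g ` {Y..}" by (rule rev_image_eqI)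
  qed (use c in auto)
  have sub: "?h absolutely_integrable_on {Y..} \<and> integral {Y..} ?h = integral {0<..?X} f"
    unfolding img[symmetric]
  proof (rule has_absolute_integral_change_of_variables_1'[where g = ?g and f = f, THEN iffD2])
    show "(?g has_field_derivative (- c * exp (- c * y))) (at y within {Y..})" if "y \<in> {Y..}" for y
      by (auto intro!: derivative_eq_intros)
    show "inj_on ?g {Y..}" using c by (auto intro!: inj_onI)
    show "f absolutely_integrable_on ?g ` {Y..} \<and> integral (?g ` {Y..}) f = integral (?g ` {Y..}) f"
      unfolding img using fL by simp
  qed simp
  have h_eq: "?h y = c * exp (- c * y) * f (exp (- c * y))" for y using c by (simp add: abs_mult)
  \<comment> \<open>\<open>f\<close> is known to be measurable only after restriction to the
    positive reals; as the exponential is positive, the composition is measurable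
    everywhere.\<close>
  have meas: "(\<lambda>y. indicator {Y..} y *\<^sub>R (c * exp (- c * y) * f (exp (- c * y)))) \<in> borel_measurable lborel"
  proof -
    have "(\<lambda>x. indicator {0<..} x *\<^sub>R f x) \<in> borel_measurable borel"
      using f by (simp add: set_integrable_def)
    then have "(\<lambda>y. indicator {0<..} (?g y) *\<^sub>R f (?g y)) \<in> borel_measurable borel"
      by (rule measurable_compose[rotated]) measurable
    then have [measurable]: "(\<lambda>y. f (?g y)) \<in> borel_measurable borel" by simp
    show ?thesis by measurable
  qed
  have habs: "(\<lambda>y. c * exp (- c * y) * f (exp (- c * y))) absolutely_integrable_on {Y..}"
    using sub by (simp only: h_eq)
  then show 1: "set_integrable lborel {Y..} (\<lambda>y. c * exp (- c * y) * f (exp (- c * y)))"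
    unfolding set_integrable_def by (simp only: integrable_completion[OF meas])
  have "(LINT y:{Y..}|lborel. c * exp (- c * y) * f (exp (- c * y)))
      = (LINT y:{Y..}|lebesgue. c * exp (- c * y) * f (exp (- c * y)))"
    unfolding set_lebesgue_integral_def by (simp only: integral_completion[OF meas])
  also have "\<dots> = integral {Y..} (\<lambda>y. c * exp (- c * y) * f (exp (- c * y)))"
    by (rule set_lebesgue_integral_eq_integral(2)[OF habs])
  also have "\<dots> = integral {0<..?X} f" using sub by (simp only: h_eq)
  also have "\<dots> = (LINT r:{0<..?X}|lebesgue. f r)"
    by (rule set_lebesgue_integral_eq_integral(2)[OF fL, symmetric])
  also have "\<dots> = (LINT r:{0<..?X}|lborel. f r)"
    unfolding set_lebesgue_integral_def by (simp only: integral_completion[OF mX])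
  finally show "(LINT y:{Y..}|lborel. c * exp (- c * y) * f (exp (- c * y))) = (LINT r:{0<..?X}|lborel. f r)" .
qed

text \<open>Tails fix the density only almost everywhere, so existence is asserted separately and
  the limit for every choice. With X = e^(-nY/k), total mass one minus the tail at X is the mass of
  (0, X], which the substitution turns into the integral over y from Y on.\<close>

theorem theorem8:
  fixes k m :: nat and g0 :: "nat \<Rightarrow> nat \<Rightarrow> real"
    and \<mu> lam :: "(nat \<Rightarrow> nat \<Rightarrow> real) set measure"
    and Nk Nn :: "(nat \<Rightarrow> real) \<Rightarrow> real" and Y :: real
  assumes "k \<ge> 1"
    and "is_norm_on k Nk" and "is_norm_on (k + m + 1) Nn"
    and "invariant_prob (k + m + 1) \<mu>"
    and "g0 \<in> SLR (k + m + 1)"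
    and "prob_space lam" and "space lam = Xsp (k + m + 1)"
    and "sets lam = sets (Xborel (k + m + 1))"
    and "admissible k m g0 \<mu> lam"
  shows
   "let n = k + m + 1;
        W = prj k n ` ({vmul n v g0 | v. v \<in> vecs n \<and> Nn v \<le> 1} \<inter> {y. y (n - 1) > 0});
        P = (\<lambda>\<psi>0::real \<Rightarrow> real. (\<forall>r>0. 0 \<le> \<psi>0 r) \<and> set_integrable lborel {0<..} \<psi>0 \<and>
               (LINT r:{0<..}|lborel. \<psi>0 r) = 1 \<and>
               (\<forall>X>0. (LINT r:{X..}|lborel. \<psi>0 r) =
                  measure \<mu> {x \<in> Xsp n. primlatt n x \<inter> Cset k n {a \<in> vecs k. Nk a \<le> X} W = {}}));
        \<eta> = (\<lambda>\<psi>0 y. real n / real k * exp (- real n * y / real k) * \<psi>0 (exp (- real n * y / real k)))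
    in (\<exists>\<psi>0. P \<psi>0) \<and>
       (\<forall>\<psi>0. P \<psi>0 \<longrightarrow> set_integrable lborel {Y..} (\<eta> \<psi>0) \<and>
          ((\<lambda>T. measure lam {x \<in> Xsp n.
               (SUP s \<in> {s \<in> vecs k. Nk s \<le> T}. ln (alpha n Nn (hflow k m g0 s x)))
                 > Y + real k / real n * ln T})
           \<longlongrightarrow> (LINT y:{Y..}|lborel. \<eta> \<psi>0 y)) at_top)"
proof -
  interpret flow_setting k m g0 Nk Nn by standard (use assms in auto)
  interpret flow_measure k m g0 Nk Nn \<mu> by standard (use assms in \<open>simp add: n_def\<close>)
  define P where "P = (\<lambda>\<psi>0::real \<Rightarrow> real. (\<forall>r>0. 0 \<le> \<psi>0 r) \<and> set_integrable lborel {0<..} \<psi>0 \<and>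
    (LINT r:{0<..}|lborel. \<psi>0 r) = 1 \<and> (\<forall>X>0. (LINT r:{X..}|lborel. \<psi>0 r) = prob (Fset X)))"
  define \<eta> where "\<eta> = (\<lambda>(\<psi>0::real \<Rightarrow> real) y. real n / real k * exp (- real n * y / real k) * \<psi>0 (exp (- real n * y / real k)))"
  have lam: "sets lam = sets (Xborel n)" using assms by (simp add: n_def)
  have ex: "\<exists>\<psi>0. P \<psi>0" unfolding P_def by (rule ex_density)
  have main: "set_integrable lborel {Y..} (\<eta> \<psi>0) \<and>
      ((\<lambda>T. measure lam (highset Y T)) \<longlongrightarrow> (LINT y:{Y..}|lborel. \<eta> \<psi>0 y)) at_top" if P: "P \<psi>0" for \<psi>0
  proof
    let ?c = "real n / real k" and ?X = "exp (- (real n / real k) * Y)"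
    have int: "set_integrable lborel {0<..} \<psi>0" and one: "(LINT r:{0<..}|lborel. \<psi>0 r) = 1"
      and F: "\<And>X. X > 0 \<Longrightarrow> (LINT r:{X..}|lborel. \<psi>0 r) = prob (Fset X)" using P by (auto simp: P_def)
    have c: "?c > 0" by simp
    have \<eta>: "\<eta> \<psi>0 = (\<lambda>y. ?c * exp (- ?c * y) * \<psi>0 (exp (- ?c * y)))" by (simp add: \<eta>_def)
    show "set_integrable lborel {Y..} (\<eta> \<psi>0)" unfolding \<eta> by (rule exp_substitution(1)[OF int c])
    have i1: "set_integrable lborel {0<..?X} \<psi>0" and i2: "set_integrable lborel {?X<..} \<psi>0"
      and i3: "set_integrable lborel {?X..} \<psi>0"
      by (rule set_integrable_subset[OF int]; auto intro: less_le_trans[OF exp_gt_zero] less_trans[OF exp_gt_zero])+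
    have split: "{0<..} = {0<..?X} \<union> {?X<..}" using less_trans[OF exp_gt_zero] by auto
    have "1 = (LINT r:{0<..?X}|lborel. \<psi>0 r) + (LINT r:{?X<..}|lborel. \<psi>0 r)"
      unfolding one[symmetric] split by (rule set_integral_Un[OF _ i1 i2]) auto
    also have "(LINT r:{?X<..}|lborel. \<psi>0 r) = prob (Fset ?X)"
      using set_integral_atLeast_eq_greaterThan[OF i3] F[of ?X] by simp
    also have "prob (Fset ?X) = 1 - prob (E0 (?X powr (real k / real n)))" by (rule Fset_prob(2)) simp
    \<comment> \<open>This power undoes the exponent n/k in the definition of \<open>hit\<close> and
      matches the radius found in \<open>highset_limit\<close>.\<close>
    also have "?X powr (real k / real n) = exp (- Y)" using k1 by (simp add: exp_powr_real)
    finally have "prob (E0 (exp (- Y))) = (LINT r:{0<..?X}|lborel. \<psi>0 r)" by simp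
    also have "\<dots> = (LINT y:{Y..}|lborel. \<eta> \<psi>0 y)" unfolding \<eta> by (rule exp_substitution(2)[OF int c, symmetric])
    finally show "((\<lambda>T. measure lam (highset Y T)) \<longlongrightarrow> (LINT y:{Y..}|lborel. \<eta> \<psi>0 y)) at_top"
      using highset_limit[OF assms(6) lam assms(9), of Y] by simp
  qed
  have "(\<exists>\<psi>0. P \<psi>0) \<and> (\<forall>\<psi>0. P \<psi>0 \<longrightarrow> set_integrable lborel {Y..} (\<eta> \<psi>0) \<and>
      ((\<lambda>T. measure lam (highset Y T)) \<longlongrightarrow> (LINT y:{Y..}|lborel. \<eta> \<psi>0 y)) at_top)"
    using ex main by blast
  then show ?thesis
    unfolding Let_def P_def \<eta>_def highset_def Fset_def Wset_def n_def .
qed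

end
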